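(* Fix an integer $k\ge1$ and a symmetric matrix $A\in\mathbb{R}^{k\times k}$. For $\beta>0$ and each integer $n>k$ let $X\in\mathbb{R}^{n\times k}$ be distributed according to the $n$-vector model $p$ (defined in the context) and let $S=X^{\top}X$. As $n\to\infty$, the law of $S$ concentrates to the delta measure on a positive definite matrix $S^{\star}_{\beta}\in\mathbb{R}^{k\times k}$, which is the unique maximizer of $$\max_{S\in\mathbb{R}^{k\times k}}\ \beta\,\mathrm{tr}(AS)+\tfrac12\log\det(S)\quad\text{subject to } S\succeq 0,\ S_{ii}=1,\ i=1,\dots,k.$$ Moreover, for any $b\in(0,1/2)$, $$\lim_{n\to\infty}\mathbb{P}\left[\lVert S-S^{\star}_{\beta}\rVert_F<n^{-1/2+b}\right]=1.$$ Additionally, $$\lim_{\beta\to\infty}\mathrm{tr}(AS^{\star}_{\beta})=\max_{S\in\mathbb{R}^{k\times k},\ S\succeq0,\ S_{ii}=1,\ i=1,\dots,k}\ \mathrm{tr}(AS),$$ and $S^{\star}_{\beta}$ converges, as $\beta\to\infty$, to a maximizer of the right-hand side (the semidefinite relaxation of the weighted max-cut problem with edge weight $A$).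
   Context: The $n$-vector model $p$ with inverse temperature $\beta$ and interaction matrix $A$ is the probability distribution of $X=[X_1,\dots,X_k]$ (columns $X_i\in\mathbb{R}^n$) proportional to the unnormalized distribution function $$p(x_1,\dots,x_k)=\exp\Big(\beta n\sum_{i,j=1}^k\langle x_i,x_j\rangle A_{ij}\Big)\prod_{i=1}^k\delta(1-\lVert x_i\rVert^2);$$ equivalently, it is supported on $(\mathbb{S}^{n-1})^k$ with density proportional to the exponential factor with respect to the product of the uniform measures on the unit spheres $\mathbb{S}^{n-1}\subset\mathbb{R}^n$. $\lVert\cdot\rVert_F$ is the Frobenius norm. $\log\det(S)=-\infty$ for singular $S\succeq0$. The matrix variable $S$ ranges over symmetric matrices. *)

theory Defs
  imports "HOL-Probability.Probability"
begin

section \<open>The \<open>n\<close>-vector model\<close>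

text \<open>
  As \<open>n\<close> varies inside the theorem, a vector of \<open>\<real>\<^sup>n\<close> is an (extensional) function on \<open>{..<n}\<close>,
  with the Euclidean norm \<^term>\<open>L2_set x {..<n}\<close>. A configuration \<open>X = [X\<^sub>1, \<dots>, X\<^sub>k]\<close> is a
  function \<open>x\<close> from the column index type \<open>'k\<close> (with \<open>k = CARD('k)\<close>) to such vectors: \<open>x i l\<close>
  is the entry of \<open>X\<close> in row \<open>l\<close> and column \<open>i\<close>.
\<close>

definition unit_ball_uniform :: "nat \<Rightarrow> (nat \<Rightarrow> real) measure" where
  "unit_ball_uniform n = uniform_measure (\<Pi>\<^sub>M l\<in>{..<n}. lborel)
     {x \<in> space (\<Pi>\<^sub>M l\<in>{..<n}. lborel). L2_set x {..<n} \<le> 1}"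

definition normalize_vec :: "nat \<Rightarrow> (nat \<Rightarrow> real) \<Rightarrow> (nat \<Rightarrow> real)" where
  "normalize_vec n x = (\<lambda>l\<in>{..<n}. x l / L2_set x {..<n})"

text \<open>
  The normalised surface measure of \<open>S\<^sup>n\<^sup>-\<^sup>1\<close>, \<open>n \<ge> 1\<close>, in its description as cone measure:
  the measure of \<open>E\<close> is the proportion of the volume of the unit ball occupied by the cone
  \<open>{r x | 0 < r \<le> 1, x \<in> E}\<close>. It is regarded as a measure on \<open>\<real>\<^sup>n\<close> supported on the sphere
  (\<open>AE_sphere_uniform\<close> below).
\<close>
definition sphere_uniform :: "nat \<Rightarrow> (nat \<Rightarrow> real) measure" where
  "sphere_uniform n = distr (unit_ball_uniform n) (\<Pi>\<^sub>M l\<in>{..<n}. borel) (normalize_vec n)"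

definition spheres_uniform :: "nat \<Rightarrow> ('k::finite \<Rightarrow> nat \<Rightarrow> real) measure" where
  "spheres_uniform n = (\<Pi>\<^sub>M i\<in>UNIV. sphere_uniform n)"

definition vec_inner :: "nat \<Rightarrow> (nat \<Rightarrow> real) \<Rightarrow> (nat \<Rightarrow> real) \<Rightarrow> real" where
  "vec_inner n x y = (\<Sum>l<n. x l * y l)"

definition boltzmann_weight ::
    "nat \<Rightarrow> real \<Rightarrow> real^'k^'k \<Rightarrow> ('k::finite \<Rightarrow> nat \<Rightarrow> real) \<Rightarrow> real" where
  "boltzmann_weight n \<beta> A x =
     exp (\<beta> * real n * (\<Sum>i\<in>UNIV. \<Sum>j\<in>UNIV. vec_inner n (x i) (x j) * A $ i $ j))"

definition partition_function :: "nat \<Rightarrow> real \<Rightarrow> real^'k^'k::finite \<Rightarrow> real" where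
  "partition_function n \<beta> A = (\<integral>x. boltzmann_weight n \<beta> A x \<partial>spheres_uniform n)"

definition n_vector_model ::
    "nat \<Rightarrow> real \<Rightarrow> real^'k^'k \<Rightarrow> ('k::finite \<Rightarrow> nat \<Rightarrow> real) measure" where
  "n_vector_model n \<beta> A = density (spheres_uniform n)
     (\<lambda>x. ennreal (boltzmann_weight n \<beta> A x / partition_function n \<beta> A))"

text \<open>The matrix \<open>S = X\<^sup>T X\<close> and its law.\<close>

definition gram :: "nat \<Rightarrow> ('k \<Rightarrow> nat \<Rightarrow> real) \<Rightarrow> real^'k^'k::finite" where
  "gram n x = (\<chi> i j. vec_inner n (x i) (x j))"

definition gram_law :: "nat \<Rightarrow> real \<Rightarrow> real^'k^'k \<Rightarrow> (real^'k^'k::finite) measure" where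
  "gram_law n \<beta> A = distr (n_vector_model n \<beta> A) borel (gram n)"

section \<open>The limiting optimisation problem\<close>

definition positive_semidefinite :: "real^'k^'k::finite \<Rightarrow> bool" where
  "positive_semidefinite S \<longleftrightarrow> transpose S = S \<and> (\<forall>v. 0 \<le> v \<bullet> (S *v v))"

definition positive_definite :: "real^'k^'k::finite \<Rightarrow> bool" where
  "positive_definite S \<longleftrightarrow> transpose S = S \<and> (\<forall>v. v \<noteq> 0 \<longrightarrow> 0 < v \<bullet> (S *v v))"

definition sdp_feasible :: "real^'k^'k::finite \<Rightarrow> bool" where
  "sdp_feasible S \<longleftrightarrow> positive_semidefinite S \<and> (\<forall>i. S $ i $ i = 1)"

text \<open>Only used for positive semidefinite \<open>S\<close>, where \<open>det S \<ge> 0\<close>.\<close>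
definition log_det :: "real^'k^'k::finite \<Rightarrow> ereal" where
  "log_det S = (if det S = 0 then -\<infinity> else ereal (ln (det S)))"

definition free_energy :: "real \<Rightarrow> real^'k^'k \<Rightarrow> real^'k^'k::finite \<Rightarrow> ereal" where
  "free_energy \<beta> A S = ereal (\<beta> * trace (A ** S)) + ereal (1 / 2) * log_det S"

section \<open>Weak convergence\<close>

definition weakly_converges ::
    "(nat \<Rightarrow> 'a::topological_space measure) \<Rightarrow> 'a measure \<Rightarrow> bool" where
  "weakly_converges \<mu> \<nu> \<longleftrightarrow>
     (\<forall>f::'a \<Rightarrow> real. continuous_on UNIV f \<longrightarrow> bounded (range f) \<longrightarrow>
        (\<lambda>n. \<integral>x. f x \<partial>\<mu> n) \<longlonglongrightarrow> (\<integral>x. f x \<partial>\<nu>))"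

section \<open>Well-definedness\<close>

text \<open>On matrices, \<^const>\<open>norm\<close> is the Frobenius norm.\<close>
lemma norm_matrix_eq_frobenius:
  "norm (S :: real^'k^'m) = sqrt (\<Sum>i\<in>UNIV. \<Sum>j\<in>UNIV. (S $ i $ j)\<^sup>2)"
  by (simp add: norm_vec_def L2_set_def sum_nonneg)

lemma sets_unit_ball_uniform [measurable_cong]:
  "sets (unit_ball_uniform n) = sets (\<Pi>\<^sub>M l\<in>{..<n}. borel)"
  unfolding unit_ball_uniform_def sets_uniform_measure by (intro sets_PiM_cong) auto

lemma measurable_L2_set [measurable]:
  "(\<lambda>x. L2_set x {..<n}) \<in> borel_measurable (\<Pi>\<^sub>M l\<in>{..<n}. borel)"
  unfolding L2_set_def by measurable

lemma measurable_normalize_vec [measurable]: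
  "normalize_vec n \<in> (\<Pi>\<^sub>M l\<in>{..<n}. borel) \<rightarrow>\<^sub>M (\<Pi>\<^sub>M l\<in>{..<n}. borel)"
  unfolding normalize_vec_def by measurable

lemma sets_sphere_uniform [measurable_cong, simp]:
  "sets (sphere_uniform n) = sets (\<Pi>\<^sub>M l\<in>{..<n}. borel)"
  by (simp add: sphere_uniform_def)

lemma emeasure_unit_ball:
  fixes n :: nat
  shows "emeasure (\<Pi>\<^sub>M l\<in>{..<n}. lborel)
     {x \<in> space (\<Pi>\<^sub>M l\<in>{..<n}. lborel). L2_set x {..<n} \<le> 1} = ennreal (unit_ball_vol (real n))"
  using emeasure_cball_aux[of "{..<n}" 1]
  by (simp add: L2_set_def Int_def conj_commute)

lemma prob_space_unit_ball_uniform: "prob_space (unit_ball_uniform n)"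
  unfolding unit_ball_uniform_def
  by (rule prob_space_uniform_measure)
     (use unit_ball_vol_pos[of "real n"] in \<open>auto simp: emeasure_unit_ball simp del: unit_ball_vol_pos\<close>)

lemma prob_space_sphere_uniform: "prob_space (sphere_uniform n)"
  unfolding sphere_uniform_def
  by (intro prob_space.prob_space_distr prob_space_unit_ball_uniform) measurable

lemma AE_sphere_uniform:
  assumes "n \<ge> 1"
  shows "AE x in sphere_uniform n. L2_set x {..<n} = 1"
proof -
  interpret product_sigma_finite "\<lambda>_. lborel :: real measure" by standard
  let ?L = "\<Pi>\<^sub>M l\<in>{..<n}. (lborel :: real measure)"
  have sL: "sets ?L = sets (\<Pi>\<^sub>M l\<in>{..<n}. borel)" by (intro sets_PiM_cong) auto
  have m[measurable]: "(\<lambda>x. L2_set x {..<n}) \<in> borel_measurable ?L"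
    using measurable_L2_set sL measurable_cong_sets by blast
  have "emeasure ?L (PiE {..<n} (\<lambda>_. {0})) = (\<Prod>l<n. emeasure lborel {0::real})"
    by (rule emeasure_PiM) auto
  also have "\<dots> = 0" using assms by (simp add: prod_zero_iff)
  finally have "PiE {..<n} (\<lambda>_. {0}) \<in> null_sets ?L"
    by (intro null_setsI sets_PiM_I_finite) auto
  moreover have "{x \<in> space ?L. \<not> L2_set x {..<n} \<noteq> 0} \<subseteq> PiE {..<n} (\<lambda>_. {0})"
    by (auto simp: L2_set_def space_PiM PiE_iff sum_nonneg_eq_0_iff intro!: extensionalityI[where A = "{..<n}"])
  ultimately have nz: "AE x in ?L. L2_set x {..<n} \<noteq> 0"
    by (rule AE_I')
  have "AE x in unit_ball_uniform n. L2_set x {..<n} \<noteq> 0"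
    unfolding unit_ball_uniform_def
    by (rule AE_uniform_measureI) (use nz in auto)
  moreover have "L2_set (normalize_vec n x) {..<n} = 1" if "L2_set x {..<n} \<noteq> 0" for x
  proof -
    have "L2_set (normalize_vec n x) {..<n} = sqrt (\<Sum>l<n. (x l)\<^sup>2 / (L2_set x {..<n})\<^sup>2)"
      unfolding L2_set_def[of "normalize_vec n x"]
      by (intro arg_cong[where f = sqrt] sum.cong) (simp_all add: normalize_vec_def power_divide)
    also have "\<dots> = sqrt ((\<Sum>l<n. (x l)\<^sup>2) / (L2_set x {..<n})\<^sup>2)"
      by (simp add: sum_divide_distrib)
    also have "\<dots> = sqrt ((\<Sum>l<n. (x l)\<^sup>2)) / L2_set x {..<n}"
      by (simp add: real_sqrt_divide)
    finally show ?thesis using that by (simp add: L2_set_def)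
  qed
  ultimately have "AE x in unit_ball_uniform n. L2_set (normalize_vec n x) {..<n} = 1"
    by auto
  then show ?thesis
    unfolding sphere_uniform_def by (subst AE_distr_iff) (auto simp: space_PiM)
qed

lemma sets_spheres_uniform [measurable_cong, simp]:
  "sets (spheres_uniform n :: ('k::finite \<Rightarrow> nat \<Rightarrow> real) measure) =
     sets (\<Pi>\<^sub>M i\<in>UNIV. \<Pi>\<^sub>M l\<in>{..<n}. borel)"
  unfolding spheres_uniform_def by (intro sets_PiM_cong) auto

lemma prob_space_spheres_uniform: "prob_space (spheres_uniform n)"
  unfolding spheres_uniform_def by (intro prob_space_PiM prob_space_sphere_uniform)

lemma measurable_vec_inner [measurable]:
  "(\<lambda>x. vec_inner n (x i) (x j)) \<in>
     borel_measurable (\<Pi>\<^sub>M i\<in>(UNIV::'k::finite set). \<Pi>\<^sub>M l\<in>{..<n}. borel)"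
proof -
  have "(\<lambda>x. x m l) \<in> borel_measurable
      (\<Pi>\<^sub>M i\<in>(UNIV::'k set). \<Pi>\<^sub>M l\<in>{..<n}. (borel :: real measure))" if "l < n" for m l
    by (rule measurable_compose[where f = "\<lambda>x. x m" and g = "\<lambda>y. y l" and
          N = "\<Pi>\<^sub>M l\<in>{..<n}. (borel :: real measure)"])
       (use that in \<open>auto intro!: measurable_component_singleton\<close>)
  then show ?thesis
    unfolding vec_inner_def by (intro borel_measurable_sum borel_measurable_times) auto
qed

lemma measurable_boltzmann_weight [measurable]:
  "boltzmann_weight n \<beta> A \<in>
     borel_measurable (\<Pi>\<^sub>M i\<in>(UNIV::'k::finite set). \<Pi>\<^sub>M l\<in>{..<n}. borel)"
  unfolding boltzmann_weight_def by measurable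

lemma measurable_gram [measurable]:
  "gram n \<in> (\<Pi>\<^sub>M i\<in>(UNIV::'k::finite set). \<Pi>\<^sub>M l\<in>{..<n}. borel) \<rightarrow>\<^sub>M borel"
proof (subst borel_measurable_euclidean_space, intro ballI)
  fix b :: "real^'k^'k" assume "b \<in> Basis"
  then obtain i j where b: "b = axis i (axis j 1)"
    by (auto simp: Basis_vec_def)
  have "(\<lambda>x. gram n x \<bullet> b) = (\<lambda>x. vec_inner n (x i) (x j))"
    by (simp add: fun_eq_iff b inner_axis gram_def)
  then show "(\<lambda>x. gram n x \<bullet> b) \<in> borel_measurable
      (\<Pi>\<^sub>M i\<in>UNIV. \<Pi>\<^sub>M l\<in>{..<n}. (borel :: real measure))"
    by simp
qed

lemma AE_spheres_uniform:
  assumes "n \<ge> 1"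
  shows "AE x in spheres_uniform n. \<forall>i::'k::finite. L2_set (x i) {..<n} = 1"
proof -
  have "AE x in spheres_uniform n. L2_set (x i) {..<n} = 1" for i :: 'k
    unfolding spheres_uniform_def
    by (rule AE_PiM_component) (use AE_sphere_uniform[OF assms] prob_space_sphere_uniform in auto)
  then show ?thesis by (simp add: AE_all_countable)
qed

lemma abs_vec_inner_le: "\<bar>vec_inner n x y\<bar> \<le> L2_set x {..<n} * L2_set y {..<n}"
proof -
  have "\<bar>vec_inner n x y\<bar> \<le> (\<Sum>l<n. \<bar>x l\<bar> * \<bar>y l\<bar>)"
    unfolding vec_inner_def by (rule order_trans[OF sum_abs]) (simp add: abs_mult)
  then show ?thesis using L2_set_mult_ineq[of x y "{..<n}"] by linarith
qed

lemma integrable_boltzmann_weight: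
  assumes "n \<ge> 1"
  shows "integrable (spheres_uniform n) (boltzmann_weight n \<beta> (A :: real^'k^'k::finite))"
proof -
  interpret prob_space "spheres_uniform n :: ('k \<Rightarrow> nat \<Rightarrow> real) measure"
    by (rule prob_space_spheres_uniform)
  let ?B = "exp (\<bar>\<beta> * real n\<bar> * (\<Sum>i\<in>UNIV. \<Sum>j\<in>UNIV. \<bar>A $ i $ j\<bar>))"
  have "AE x in spheres_uniform n. norm (boltzmann_weight n \<beta> A x) \<le> ?B"
    using AE_spheres_uniform[OF assms]
  proof eventually_elim
    case (elim x)
    have *: "\<bar>vec_inner n (x i) (x j) * A $ i $ j\<bar> \<le> \<bar>A $ i $ j\<bar>" for i j
      using abs_vec_inner_le[of n "x i" "x j"] elim
      by (simp add: abs_mult mult_left_le_one_le)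
    have "\<bar>\<Sum>i\<in>UNIV. \<Sum>j\<in>UNIV. vec_inner n (x i) (x j) * A $ i $ j\<bar>
        \<le> (\<Sum>i\<in>UNIV. \<Sum>j\<in>UNIV. \<bar>A $ i $ j\<bar>)"
      by (intro order_trans[OF sum_abs] sum_mono *)
    then have "\<bar>\<beta> * real n\<bar> * \<bar>\<Sum>i\<in>UNIV. \<Sum>j\<in>UNIV. vec_inner n (x i) (x j) * A $ i $ j\<bar>
        \<le> \<bar>\<beta> * real n\<bar> * (\<Sum>i\<in>UNIV. \<Sum>j\<in>UNIV. \<bar>A $ i $ j\<bar>)"
      by (rule mult_left_mono) simp
    then show ?case
      by (simp add: boltzmann_weight_def flip: abs_mult)
  qed
  then show ?thesis by (rule integrable_const_bound) measurable
qed

lemma partition_function_pos: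
  assumes "n \<ge> 1"
  shows "partition_function n \<beta> (A :: real^'k^'k::finite) > 0"
proof -
  interpret prob_space "spheres_uniform n :: ('k \<Rightarrow> nat \<Rightarrow> real) measure"
    by (rule prob_space_spheres_uniform)
  have "expectation (\<lambda>_. 0) < expectation (boltzmann_weight n \<beta> A)"
    by (rule integral_less_AE_space)
       (auto simp: boltzmann_weight_def emeasure_space_1 intro: integrable_boltzmann_weight[OF assms])
  then show ?thesis by (simp add: partition_function_def)
qed

lemma prob_space_n_vector_model:
  assumes "n \<ge> 1"
  shows "prob_space (n_vector_model n \<beta> (A :: real^'k^'k::finite))"
proof (rule prob_spaceI)
  note Z = partition_function_pos[OF assms, of \<beta> A]
  have int: "integrable (spheres_uniform n) (\<lambda>x. boltzmann_weight n \<beta> A x / partition_function n \<beta> A)"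
    using integrable_boltzmann_weight[OF assms, of \<beta> A] by simp
  have "emeasure (n_vector_model n \<beta> A) (space (n_vector_model n \<beta> A)) =
      (\<integral>\<^sup>+ x. ennreal (boltzmann_weight n \<beta> A x / partition_function n \<beta> A) \<partial>spheres_uniform n)"
    unfolding n_vector_model_def space_density
    by (subst emeasure_density)
       (auto intro!: nn_integral_cong borel_measurable_integrable[OF int] sets.top
         simp: indicator_def simp del: sets_spheres_uniform)
  also have "\<dots> = ennreal (\<integral>x. boltzmann_weight n \<beta> A x / partition_function n \<beta> A \<partial>spheres_uniform n)"
    by (rule nn_integral_eq_integral[OF int]) (use Z in \<open>simp add: boltzmann_weight_def\<close>)
  also have "\<dots> = ennreal (partition_function n \<beta> A / partition_function n \<beta> A)"
    by (simp add: partition_function_def)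
  finally show "emeasure (n_vector_model n \<beta> A) (space (n_vector_model n \<beta> A)) = 1"
    using Z by simp
qed

lemma prob_space_gram_law:
  assumes "n \<ge> 1"
  shows "prob_space (gram_law n \<beta> (A :: real^'k^'k::finite))"
proof -
  have "gram n \<in> n_vector_model n \<beta> A \<rightarrow>\<^sub>M borel"
    unfolding n_vector_model_def by measurable
  then show ?thesis
    unfolding gram_law_def
    by (intro prob_space.prob_space_distr prob_space_n_vector_model assms)
qed

end

theory Submission
  imports Defs
begin

text \<open>
  Let \<open>t = 2\<beta>\<close>. The maximiser \<open>S\<close> is characterised by: \<open>S\<close> is positive definite with unit diagonal and
  \<open>Q = S\<^sup>-\<^sup>1\<close> agrees with \<open>-t A\<close> off the diagonal. Uniqueness is the inequality
  \<open>det S' det Q \<le> exp (tr (Q S') - k)\<close>, a consequence of Hadamard's inequality.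

  Concentration. On the spheres the Boltzmann weight is a constant times \<open>exp (- (n/2) tr (Q X\<^sup>T X))\<close>,
  because \<open>Q + t A\<close> is diagonal. Hence the model is the Gaussian model with independent rows of covariance \<open>S/n\<close>,
  conditioned on all columns having norm \<open>1\<close>. Under the Gaussian law \<open>X\<^sup>T X\<close> concentrates at \<open>S\<close> at the rate
  \<open>exp (- c n s\<^sup>2)\<close> (Chernoff's bound, where Jensen's inequality replaces the computation of Gaussian determinants),
  and the conditioning costs only a power of \<open>n\<close>, as is seen by comparing in polar coordinates.

  Limit \<open>\<beta> \<rightarrow> \<infinity>\<close>. If an entry \<open>g\<close> of the path did not converge, then by Sard's theorem some regular value \<open>c\<close> of \<open>g\<close>
  would be attained infinitely often. But the points with \<open>g = c\<close> are nondegenerate zeros of a square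
  polynomial system, of which there are only finitely many.
\<close>

section \<open>Positive semidefinite matrices\<close>

text \<open>No formula for S is available, so every estimate runs through the pair (S, Q).
  Conditioning is cheap for two reasons. Thickening the spheres to shells of relative width 1/n
  keeps a fixed fraction of the volume of the ball and changes the exponent by O(1). Conversely,
  typical Gaussian radii deviate from 1 by 1/sqrt n, which moves the exponent by order sqrt n;
  comparison with the scale-invariant density r^-n cancels this term, and the radial integral of
  r^-n is polynomial in n relative to the volume of the unit ball. The resulting factor n^k loses
  against exp (- c n^(2 b)).

  As \<beta> grows, the duality gap k/t settles the value but not the convergence of S: the optimal
  face may have positive dimension and the path could wander in it. At a regular value c of an entry
  g, the equation g = c can replace the equation that fixes t, because the kernel of the other
  linearised equations is spanned by the tangent of the path. Finiteness then rests on the system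
  being quadratic: its difference quotients are exact matrices with affine entries.\<close>

lemma inner_matrix_eq: "A \<bullet> B = (\<Sum>i\<in>UNIV. \<Sum>j\<in>UNIV. A $ i $ j * B $ i $ j)"
  for A B :: "real^'k^'k::finite"
  by (simp add: inner_vec_def)

lemma trace_mult_eq_inner: "trace (A ** B) = transpose A \<bullet> B" for A B :: "real^'k^'k::finite"
  unfolding trace_def matrix_matrix_mult_def inner_matrix_eq transpose_def
  by (simp, rule sum.swap)

lemma inner_mult_left: "(A ** B) \<bullet> C = B \<bullet> (transpose A ** C)" for A B C :: "real^'k^'k::finite"
proof -
  have "(A ** B) \<bullet> C = trace (transpose (A ** B) ** C)" by (simp add: trace_mult_eq_inner)
  also have "\<dots> = trace (transpose B ** (transpose A ** C))"
    by (simp add: matrix_transpose_mul matrix_mul_assoc)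
  finally show ?thesis by (simp add: trace_mult_eq_inner)
qed

lemma inner_mult_right: "(A ** B) \<bullet> C = A \<bullet> (C ** transpose B)" for A B C :: "real^'k^'k::finite"
proof -
  have "(A ** B) \<bullet> C = trace (transpose (A ** B) ** C)" by (simp add: trace_mult_eq_inner)
  also have "\<dots> = trace ((transpose A ** C) ** transpose B)"
    by (subst trace_mul_sym) (simp add: matrix_transpose_mul matrix_mul_assoc)
  finally show ?thesis by (simp add: trace_mult_eq_inner flip: matrix_mul_assoc)
qed

lemma inner_mat_1: "mat 1 \<bullet> B = trace B" for B :: "real^'k^'k::finite"
  by (metis inner_commute trace_mult_eq_inner transpose_mat matrix_mul_lid)

lemma bilinear_form_eq: "v \<bullet> (B *v w) = (\<Sum>i\<in>UNIV. \<Sum>j\<in>UNIV. v $ i * B $ i $ j * w $ j)"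
  for B :: "real^'k^'k::finite"
  by (simp add: inner_vec_def matrix_vector_mult_def sum_distrib_left mult.assoc)

lemma symmetric_entry: "transpose B = B \<Longrightarrow> B $ i $ j = B $ j $ i" for B :: "real^'k^'k::finite"
  by (metis transpose_def vec_lambda_beta)

lemma symmetric_bilinear: "transpose B = B \<Longrightarrow> v \<bullet> (B *v w) = w \<bullet> (B *v v)" for B :: "real^'k^'k::finite"
  by (metis dot_lmul_matrix inner_commute transpose_matrix_vector)

lemma bilinear_form_axis: "axis a 1 \<bullet> (B *v axis b 1) = B $ a $ b" for B :: "real^'k^'k::finite"
  by (simp add: matrix_vector_mul_component inner_axis' inner_axis)

text \<open>Completing the square: subtracting the rank-one term of the pivot \<open>c\<close>
  amounts to evaluating the form at the component of \<open>v\<close> that is orthogonal to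
  \<open>axis c 1\<close> with respect to \<open>B\<close>. Hence Schur complements inherit
  nonnegativity.\<close>

lemma quadratic_form_elimination:
  fixes B :: "real^'k^'k::finite"
  assumes "transpose B = B" "B $ c $ c \<noteq> 0"
  shows "v \<bullet> (B *v v) - ((B *v v) $ c)\<^sup>2 / B $ c $ c
     = (v - ((B *v v) $ c / B $ c $ c) *\<^sub>R axis c 1) \<bullet> (B *v (v - ((B *v v) $ c / B $ c $ c) *\<^sub>R axis c 1))"
proof -
  define s where "s = (B *v v) $ c / B $ c $ c"
  have e: "axis c 1 \<bullet> (B *v v) = (B *v v) $ c" by (simp add: inner_axis')
  note e2 = bilinear_form_axis[of c B c]
  have "(v - s *\<^sub>R axis c 1) \<bullet> (B *v (v - s *\<^sub>R axis c 1))
    = v \<bullet> (B *v v) - s * (v \<bullet> (B *v axis c 1)) - s * (axis c 1 \<bullet> (B *v v)) + s * s * (axis c 1 \<bullet> (B *v axis c 1))"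
    by (simp add: matrix_vector_mult_diff_distrib matrix_vector_mult_scaleR inner_diff_left inner_diff_right algebra_simps)
  also have "\<dots> = v \<bullet> (B *v v) - ((B *v v) $ c)\<^sup>2 / B $ c $ c"
    using assms(2) by (simp add: symmetric_bilinear[OF assms(1), of v "axis c 1"] e e2 s_def power2_eq_square field_simps)
  finally show ?thesis by (simp add: s_def)
qed

lemma positive_semidefinite_diag_nonneg: "positive_semidefinite B \<Longrightarrow> 0 \<le> B $ i $ i"
proof -
  assume "positive_semidefinite B"
  then have "0 \<le> axis i 1 \<bullet> (B *v axis i 1)" by (simp add: positive_semidefinite_def)
  then show ?thesis by (simp add: bilinear_form_axis)
qed

lemma positive_semidefinite_zero_diag:
  fixes B :: "real^'k^'k::finite"
  assumes "positive_semidefinite B" "B $ c $ c = 0"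
  shows "B $ c $ j = 0"
proof (rule ccontr)
  assume nz: "B $ c $ j \<noteq> 0"
  have sym: "transpose B = B" and nn: "\<And>v. 0 \<le> v \<bullet> (B *v v)"
    using assms by (auto simp: positive_semidefinite_def)
  \<comment> \<open>The pivot vanishes, so the form at
    \<open>axis j 1 + s *\<^sub>R axis c 1\<close> is affine in \<open>s\<close>; at this
    \<open>s\<close> its value is -1.\<close>
  define s where "s = - (B $ j $ j + 1) / (2 * B $ c $ j)"
  note ax = bilinear_form_axis[of _ B]
  have "0 \<le> (axis j 1 + s *\<^sub>R axis c 1) \<bullet> (B *v (axis j 1 + s *\<^sub>R axis c 1))" by (rule nn)
  also have "\<dots> = B $ j $ j + 2 * s * B $ c $ j"
    using symmetric_entry[OF sym, of c j]
    by (simp add: matrix_vector_right_distrib matrix_vector_mult_scaleR inner_add_left inner_add_right ax assms(2) algebra_simps)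
  also have "\<dots> = -1" using nz by (simp add: s_def field_simps)
  finally show False by simp
qed

text \<open>Cholesky decomposition by induction on the set \<open>J\<close> of rows that may be
  nonzero. A nonzero pivot \<open>c\<close> contributes its row divided by
  \<open>sqrt (B $ c $ c)\<close> and leaves a Schur complement supported on the other rows; a zero
  pivot has a vanishing row. Indexing the vectors by \<open>J\<close> makes the factor in
  \<open>positive_semidefinite_factor\<close> square.\<close>

lemma positive_semidefinite_rank_one_sum_aux:
  fixes B :: "real^'k^'k::finite"
  assumes "finite J" "positive_semidefinite B" "\<And>i j. i \<notin> J \<Longrightarrow> B $ i $ j = 0"
  shows "\<exists>v :: 'k \<Rightarrow> real^'k. \<forall>i j. B $ i $ j = (\<Sum>a\<in>J. v a $ i * v a $ j)"
  using assms
proof (induction J arbitrary: B rule: finite_induct)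
  case empty
  then show ?case by auto
next
  case (insert c J)
  have sym: "transpose B = B" and nn: "\<And>v. 0 \<le> v \<bullet> (B *v v)"
    using insert.prems by (auto simp: positive_semidefinite_def)
  note se = symmetric_entry[OF sym]
  show ?case
  proof (cases "B $ c $ c = 0")
    case True
    have "\<exists>v :: 'k \<Rightarrow> real^'k. \<forall>i j. B $ i $ j = (\<Sum>a\<in>J. v a $ i * v a $ j)"
      using insert.prems positive_semidefinite_zero_diag[OF insert.prems(1) True]
      by (intro insert.IH) (auto, metis)
    then obtain v where v: "\<forall>i j. B $ i $ j = (\<Sum>a\<in>J. v a $ i * v a $ j)" by blast
    have "(\<Sum>a\<in>insert c J. (v(c := 0)) a $ i * (v(c := 0)) a $ j) = (\<Sum>a\<in>J. v a $ i * v a $ j)" for i j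
      using insert.hyps by (simp, intro sum.cong) auto
    with v show ?thesis by (intro exI[of _ "v(c := 0)"]) simp
  next
    case False
    then have pos: "B $ c $ c > 0"
      using positive_semidefinite_diag_nonneg[OF insert.prems(1), of c] by simp
    define B' :: "real^'k^'k" where "B' = (\<chi> i j. B $ i $ j - B $ c $ i * B $ c $ j / B $ c $ c)"
    have Bv: "(B *v v) $ c = (\<Sum>i\<in>UNIV. v $ i * B $ c $ i)" for v
      by (simp add: matrix_vector_mult_def mult.commute)
    have q: "v \<bullet> (B' *v v) = v \<bullet> (B *v v) - ((B *v v) $ c)\<^sup>2 / B $ c $ c" for v
    proof -
      have "v \<bullet> (B' *v v) = v \<bullet> (B *v v) - (\<Sum>i\<in>UNIV. \<Sum>j\<in>UNIV. (v $ i * B $ c $ i) * (v $ j * B $ c $ j) / B $ c $ c)"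
        unfolding bilinear_form_eq B'_def by (simp add: sum_subtractf[symmetric] algebra_simps)
      also have "(\<Sum>i\<in>UNIV. \<Sum>j\<in>UNIV. (v $ i * B $ c $ i) * (v $ j * B $ c $ j) / B $ c $ c)
         = ((B *v v) $ c)\<^sup>2 / B $ c $ c"
        by (simp add: Bv power2_eq_square sum_product sum_divide_distrib)
      finally show ?thesis .
    qed
    have "positive_semidefinite B'"
      unfolding positive_semidefinite_def
    proof
      show "transpose B' = B'" by (simp add: transpose_def B'_def vec_eq_iff mult.commute) (simp add: se)
      show "\<forall>v. 0 \<le> v \<bullet> (B' *v v)"
        using nn False by (simp only: q quadratic_form_elimination[OF sym False]) simp
    qed
    moreover have "B' $ i $ j = 0" if "i \<notin> J" for i j
    proof (cases "i = c")
      case True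
      then show ?thesis using False by (simp add: B'_def)
    next
      case ne: False
      then show ?thesis using that insert.prems(2)[of i] by (simp add: B'_def se[of c i])
    qed
    ultimately have "\<exists>v :: 'k \<Rightarrow> real^'k. \<forall>i j. B' $ i $ j = (\<Sum>a\<in>J. v a $ i * v a $ j)"
      by (rule insert.IH)
    then obtain v where v: "\<And>i j. B' $ i $ j = (\<Sum>a\<in>J. v a $ i * v a $ j)" by blast
    define w where "w = v(c := (\<chi> i. B $ c $ i / sqrt (B $ c $ c)))"
    have "B $ i $ j = (\<Sum>a\<in>insert c J. w a $ i * w a $ j)" for i j
    proof -
      have "(\<Sum>a\<in>J. w a $ i * w a $ j) = (\<Sum>a\<in>J. v a $ i * v a $ j)"
        using insert.hyps by (intro sum.cong) (auto simp: w_def)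
      moreover have "w c $ i * w c $ j = B $ c $ i * B $ c $ j / B $ c $ c"
        using pos by (simp add: w_def)
      moreover have "B' $ i $ j = B $ i $ j - B $ c $ i * B $ c $ j / B $ c $ c" by (simp add: B'_def)
      ultimately show ?thesis using insert.hyps v[of i j] by simp
    qed
    then show ?thesis by blast
  qed
qed

lemma positive_semidefinite_factor:
  fixes B :: "real^'k^'k::finite"
  assumes "positive_semidefinite B"
  obtains V :: "real^'k^'k" where "B = transpose V ** V"
proof -
  obtain v :: "'k \<Rightarrow> real^'k" where v: "\<And>i j. B $ i $ j = (\<Sum>a\<in>UNIV. v a $ i * v a $ j)"
    using positive_semidefinite_rank_one_sum_aux[of UNIV B] assms by auto
  have "B = transpose (\<chi> a i. v a $ i) ** (\<chi> a i. v a $ i)"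
    by (simp add: vec_eq_iff matrix_matrix_mult_def transpose_def v)
  then show ?thesis by (rule that)
qed

lemma positive_semidefinite_conjugate:
  fixes B N :: "real^'k^'k::finite"
  assumes "positive_semidefinite B"
  shows "positive_semidefinite (transpose N ** B ** N)"
proof -
  have "v \<bullet> (transpose N ** B ** N *v v) = (N *v v) \<bullet> (B *v (N *v v))" for v
    by (metis dot_lmul_matrix matrix_vector_mul_assoc inner_commute transpose_matrix_vector)
  then show ?thesis
    using assms by (auto simp: positive_semidefinite_def matrix_transpose_mul matrix_mul_assoc)
qed

text \<open>One half of the self-duality of the semidefinite cone: each rank-one summand of
  \<open>B\<close> contributes one value of the quadratic form of \<open>C\<close>.\<close>

lemma positive_semidefinite_inner_nonneg:
  fixes B C :: "real^'k^'k::finite"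
  assumes "positive_semidefinite B" "positive_semidefinite C"
  shows "0 \<le> B \<bullet> C"
proof -
  obtain v :: "'k \<Rightarrow> real^'k" where v: "\<And>i j. B $ i $ j = (\<Sum>a\<in>UNIV. v a $ i * v a $ j)"
    using positive_semidefinite_rank_one_sum_aux[of UNIV B] assms by auto
  have "B \<bullet> C = (\<Sum>i\<in>UNIV. \<Sum>j\<in>UNIV. \<Sum>a\<in>UNIV. v a $ i * C $ i $ j * v a $ j)"
    by (simp add: inner_matrix_eq v sum_distrib_right mult.assoc) (simp add: mult.commute mult.left_commute)
  also have "\<dots> = (\<Sum>i\<in>UNIV. \<Sum>a\<in>UNIV. \<Sum>j\<in>UNIV. v a $ i * C $ i $ j * v a $ j)"
    by (intro sum.cong refl sum.swap)
  also have "\<dots> = (\<Sum>a\<in>UNIV. v a \<bullet> (C *v v a))"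
    unfolding bilinear_form_eq by (rule sum.swap)
  also have "\<dots> \<ge> 0" using assms(2) by (intro sum_nonneg) (auto simp: positive_semidefinite_def)
  finally show ?thesis .
qed

lemma positive_definite_imp_semidefinite: "positive_definite B \<Longrightarrow> positive_semidefinite B"
  unfolding positive_definite_def positive_semidefinite_def
  by (metis inner_zero_left less_eq_real_def)

text \<open>\<open>l\<close> is the minimum of the form on the compact unit sphere; homogeneity does
  the rest.\<close>

lemma positive_definite_lower_bound:
  fixes B :: "real^'k^'k::finite"
  assumes "positive_definite B"
  obtains l where "l > 0" "\<And>v. l * (v \<bullet> v) \<le> v \<bullet> (B *v v)"
proof -
  have "continuous_on (sphere 0 1) (\<lambda>v. v \<bullet> (B *v v))"
    by (intro continuous_intros linear_continuous_on) auto
  then obtain u where u: "u \<in> sphere 0 1" "\<And>v. v \<in> sphere 0 1 \<Longrightarrow> u \<bullet> (B *v u) \<le> v \<bullet> (B *v v)"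
    using continuous_attains_inf[OF compact_sphere, of "0 :: real^'k" 1] by fastforce
  show ?thesis
  proof
    show "u \<bullet> (B *v u) > 0" using u(1) assms unfolding positive_definite_def
      by (metis mem_sphere_0 norm_zero zero_neq_one)
    fix v
    show "(u \<bullet> (B *v u)) * (v \<bullet> v) \<le> v \<bullet> (B *v v)"
    proof (cases "v = 0")
      case False
      have "u \<bullet> (B *v u) \<le> (v /\<^sub>R norm v) \<bullet> (B *v (v /\<^sub>R norm v))"
        using False by (intro u(2)) simp
      also have "\<dots> = v \<bullet> (B *v v) / (norm v)\<^sup>2"
        by (simp add: matrix_vector_mult_scaleR power2_eq_square field_simps)
      finally show ?thesis using False by (simp add: field_simps power2_norm_eq_inner)
    qed simp
  qed
qed

lemma positive_semidefinite_diff_scalar: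
  fixes B :: "real^'k^'k::finite"
  assumes "transpose B = B" "\<And>v. l * (v \<bullet> v) \<le> v \<bullet> (B *v v)"
  shows "positive_semidefinite (B - l *\<^sub>R mat 1)"
proof -
  have "transpose (B - l *\<^sub>R mat 1) = B - l *\<^sub>R mat 1"
    using assms(1) by (simp add: transpose_def vec_eq_iff mat_def)
  then show ?thesis using assms(2)
    by (simp add: positive_semidefinite_def matrix_vector_mult_diff_rdistrib inner_diff_right
        scaleR_matrix_vector_assoc[symmetric])
qed

text \<open>Two applications of \<open>positive_semidefinite_inner_nonneg\<close>: \<open>R\<close>
  is lowered to \<open>m *\<^sub>R mat 1\<close>, then \<open>Q\<close> to
  \<open>l *\<^sub>R mat 1\<close>, which leaves the trace of \<open>N ** N\<close>. This coercivity
  is behind both the Lipschitz bound and the nondegeneracy of the path.\<close>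

lemma inner_conjugate_lower_bound:
  fixes N Q R :: "real^'k^'k::finite"
  assumes N: "transpose N = N"
    and Q: "transpose Q = Q" "\<And>v. l * (v \<bullet> v) \<le> v \<bullet> (Q *v v)" "0 \<le> l"
    and R: "transpose R = R" "\<And>v. m * (v \<bullet> v) \<le> v \<bullet> (R *v v)" "0 \<le> m"
  shows "l * m * (norm N)\<^sup>2 \<le> (N ** Q ** N) \<bullet> R"
proof -
  have psdQ: "positive_semidefinite Q"
    unfolding positive_semidefinite_def using Q by (meson inner_ge_zero mult_nonneg_nonneg order_trans)
  have c: "positive_semidefinite (N ** Q ** N)"
    using positive_semidefinite_conjugate[OF psdQ, of N] N by simp
  have c1: "positive_semidefinite (N ** N)"
    using positive_semidefinite_conjugate[of "mat 1" N] N
    by (simp add: positive_semidefinite_def)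
  have t: "mat 1 \<bullet> (N ** Q ** N) = Q \<bullet> (N ** N)"
    using inner_mult_right[of "N ** Q" N "mat 1"] inner_mult_left[of N Q N] N
    by (simp add: inner_commute)
  have tn: "mat 1 \<bullet> (N ** N) = (norm N)\<^sup>2"
    by (simp add: inner_mat_1 trace_mult_eq_inner N power2_norm_eq_inner)
  have 1: "0 \<le> (N ** Q ** N) \<bullet> (R - m *\<^sub>R mat 1)"
    by (intro positive_semidefinite_inner_nonneg c positive_semidefinite_diff_scalar R)
  have 2: "0 \<le> (Q - l *\<^sub>R mat 1) \<bullet> (N ** N)"
    by (intro positive_semidefinite_inner_nonneg c1 positive_semidefinite_diff_scalar Q)
  have "l * (norm N)\<^sup>2 \<le> Q \<bullet> (N ** N)" using 2 by (simp add: inner_diff_left tn)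
  then have "m * (l * (norm N)\<^sup>2) \<le> m * (Q \<bullet> (N ** N))" by (rule mult_left_mono) (rule R(3))
  also have "\<dots> \<le> (N ** Q ** N) \<bullet> R"
    using 1 by (simp add: inner_diff_right t[unfolded inner_commute[of "mat 1"]] inner_commute[of _ "mat 1"] t)
  finally show ?thesis by (simp add: mult_ac)
qed

section \<open>Inverse and determinant of a positive definite matrix\<close>

lemma positive_definite_inverse:
  fixes S :: "real^'k^'k::finite"
  assumes "positive_definite S"
  obtains Q where "positive_definite Q" "Q ** S = mat 1" "S ** Q = mat 1"
proof -
  have sym: "transpose S = S" using assms by (simp add: positive_definite_def)
  have "x = 0" if "S *v x = 0" for x
    using assms that by (auto simp: positive_definite_def)
  then obtain Q where Q: "Q ** S = mat 1"
    using matrix_left_invertible_ker[of S] by blast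
  then have Q': "S ** Q = mat 1" by (simp add: matrix_left_right_inverse)
  have "transpose Q = Q"
  proof -
    have "S ** transpose Q = mat 1"
      using arg_cong[OF Q, of transpose] by (simp add: matrix_transpose_mul sym)
    then have "Q ** (S ** transpose Q) = Q" by simp
    then show ?thesis by (simp add: matrix_mul_assoc Q)
  qed
  moreover have "0 < v \<bullet> (Q *v v)" if "v \<noteq> 0" for v
  proof -
    have e: "S *v (Q *v v) = v" by (simp add: matrix_vector_mul_assoc Q')
    then have "Q *v v \<noteq> 0" using that by (metis matrix_vector_mult_0_right)
    then have "0 < (Q *v v) \<bullet> (S *v (Q *v v))" using assms by (auto simp: positive_definite_def)
    then show ?thesis by (simp add: e inner_commute)
  qed
  ultimately have "positive_definite Q" by (simp add: positive_definite_def)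
  then show ?thesis using Q Q' by (rule that)
qed

text \<open>One step of symmetric Gaussian elimination: M = L^T D L with \<open>L\<close> unipotent.
  Since the index type is fixed, \<open>M'\<close> keeps its size: row and column \<open>c\<close>
  become those of the identity instead of being deleted.\<close>

lemma det_elimination:
  fixes M :: "real^'k^'k::finite"
  assumes sym: "transpose M = M" and nz: "M $ c $ c \<noteq> 0"
  defines "M' \<equiv> (\<chi> i j. if i = c \<or> j = c then (if i = j then 1 else 0) else M $ i $ j - M $ c $ i * M $ c $ j / M $ c $ c)"
  shows "det M = M $ c $ c * det M'"
proof -
  define u :: "real^'k" where "u = (\<chi> i. if i = c then 0 else M $ c $ i / M $ c $ c)"
  define L :: "real^'k^'k" where "L = (\<chi> k. if k = c then row c (mat 1) + u else row k (mat 1))"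
  define D :: "real^'k^'k" where "D = (\<chi> i. if i = c then M $ c $ c *s M' $ i else M' $ i)"
  have "u \<in> vec.span {row j (mat 1 :: real^'k^'k) |j. j \<noteq> c}"
  proof -
    have "u = (\<Sum>j\<in>UNIV - {c}. u $ j *s row j (mat 1))"
      by (simp add: vec_eq_iff row_def mat_def if_distrib u_def cong: if_cong)
    also have "\<dots> \<in> vec.span {row j (mat 1 :: real^'k^'k) |j. j \<noteq> c}"
      by (intro vec.span_sum vec.span_scale vec.span_base) auto
    finally show ?thesis .
  qed
  then have detL: "det L = 1" unfolding L_def by (subst det_row_span) auto
  have "D = (\<chi> i. if i = c then M $ c $ c *s M' $ i else M' $ i)" by (simp add: D_def)
  then have "det D = M $ c $ c * det (\<chi> i. if i = c then M' $ i else M' $ i)"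
    by (simp only: det_row_mul)
  also have "(\<chi> i. if i = c then M' $ i else M' $ i) = M'" by (simp add: vec_eq_iff)
  finally have detD: "det D = M $ c $ c * det M'" .
  have Lij: "L $ a $ i = (if a = i then 1 else 0) + (if a = c then u $ i else 0)" for a i
    by (simp add: L_def row_def mat_def u_def)
  have DL: "(D ** L) $ a $ j = D $ a $ j + D $ a $ c * u $ j" for a j
    by (simp add: matrix_matrix_mult_def Lij distrib_left sum.distrib mult_delta_right)
  have LDL: "(transpose L ** R) $ i $ j = R $ i $ j + u $ i * R $ c $ j" for i j and R :: "real^'k^'k"
    by (simp add: matrix_matrix_mult_def transpose_def Lij distrib_right sum.distrib mult_delta_left)
  have "transpose L ** (D ** L) = M"
  proof (simp only: vec_eq_iff, intro allI)
    fix i j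
    have se: "M $ i $ c = M $ c $ i" by (rule symmetric_entry[OF sym])
    show "(transpose L ** (D ** L)) $ i $ j = M $ i $ j"
      unfolding LDL DL using nz by (auto simp: D_def M'_def u_def se field_simps)
  qed
  then have "det M = det (transpose L ** (D ** L))" by simp
  also have "\<dots> = det D" by (simp add: det_mul detL)
  finally show ?thesis by (simp add: detD)
qed

lemma positive_definite_diag_pos: "positive_definite B \<Longrightarrow> 0 < B $ i $ i"
proof -
  assume "positive_definite B"
  then have "0 < axis i 1 \<bullet> (B *v axis i 1)" by (simp add: positive_definite_def axis_eq_0_iff)
  then show ?thesis by (simp add: bilinear_form_axis)
qed

lemma positive_definite_elimination:
  fixes M :: "real^'k^'k::finite" and c :: 'k
  assumes pd: "positive_definite M"
  defines "M' \<equiv> (\<chi> i j. if i = c \<or> j = c then (if i = j then 1 else 0) else M $ i $ j - M $ c $ i * M $ c $ j / M $ c $ c)"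
  shows "positive_definite M'"
proof -
  have sym: "transpose M = M" and pos: "\<And>v. v \<noteq> 0 \<Longrightarrow> 0 < v \<bullet> (M *v v)"
    using pd by (auto simp: positive_definite_def)
  have c: "M $ c $ c > 0" using positive_definite_diag_pos[OF pd] .
  have "transpose M' = M'"
    by (simp add: transpose_def M'_def vec_eq_iff mult.commute) (use symmetric_entry[OF sym] in auto)
  moreover have "0 < v \<bullet> (M' *v v)" if "v \<noteq> 0" for v
  proof -
    \<comment> \<open>Row and column \<open>c\<close> of \<open>M'\<close> see only
      \<open>v $ c\<close>, so the rest of the form depends on \<open>w\<close> alone. Completing
      the square there with \<open>z\<close> gives the form of \<open>M\<close> at \<open>z\<close>
      plus \<open>(v $ c)\<^sup>2\<close>.\<close>
    define w where "w = (\<chi> i. if i = c then 0 else v $ i)"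
    define z where "z = w - ((M *v w) $ c / M $ c $ c) *\<^sub>R axis c 1"
    have Mw: "(M *v w) $ c = (\<Sum>i\<in>UNIV. w $ i * M $ c $ i)"
      by (simp add: matrix_vector_mult_def mult.commute)
    have "v \<bullet> (M' *v v) = (\<Sum>i\<in>UNIV. \<Sum>j\<in>UNIV. w $ i * M $ i $ j * w $ j - (w $ i * M $ c $ i) * (w $ j * M $ c $ j) / M $ c $ c
        + (if i = c \<and> j = c then (v $ c)\<^sup>2 else 0))"
      unfolding bilinear_form_eq
      by (intro sum.cong refl) (auto simp: M'_def w_def power2_eq_square algebra_simps)
    also have "\<dots> = (\<Sum>i\<in>UNIV. \<Sum>j\<in>UNIV. w $ i * M $ i $ j * w $ j - (w $ i * M $ c $ i) * (w $ j * M $ c $ j) / M $ c $ c)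
        + (\<Sum>i\<in>UNIV. \<Sum>j\<in>UNIV. if i = c \<and> j = c then (v $ c)\<^sup>2 else 0)"
      by (simp only: sum.distrib)
    also have "(\<Sum>i\<in>UNIV. \<Sum>j\<in>UNIV. if i = c \<and> j = c then (v $ c)\<^sup>2 else 0) = (\<Sum>i\<in>UNIV. if i = c then (v $ c)\<^sup>2 else 0)"
      by (intro sum.cong) auto
    also have "(\<Sum>i\<in>UNIV. \<Sum>j\<in>UNIV. w $ i * M $ i $ j * w $ j - (w $ i * M $ c $ i) * (w $ j * M $ c $ j) / M $ c $ c) + \<dots> = (w \<bullet> (M *v w) - ((M *v w) $ c)\<^sup>2 / M $ c $ c) + (v $ c)\<^sup>2"
      by (simp add: sum.distrib sum_subtractf bilinear_form_eq Mw power2_eq_square sum_product sum_divide_distrib)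
    also have "w \<bullet> (M *v w) - ((M *v w) $ c)\<^sup>2 / M $ c $ c = z \<bullet> (M *v z)"
      using quadratic_form_elimination[OF sym, of c w] c by (simp add: z_def)
    finally have e: "v \<bullet> (M' *v v) = z \<bullet> (M *v z) + (v $ c)\<^sup>2" .
    show ?thesis
    proof (cases "v $ c = 0")
      case True
      obtain i where "v $ i \<noteq> 0" using \<open>v \<noteq> 0\<close> unfolding vec_eq_iff zero_index by blast
      then have "z $ i \<noteq> 0" using True by (auto simp: z_def w_def axis_def)
      then have "z \<noteq> 0" by auto
      then show ?thesis using pos[of z] e True by simp
    next
      case False
      have "0 \<le> z \<bullet> (M *v z)" using pos[of z] by (cases "z = 0") auto
      then show ?thesis using e False by (simp add: add_nonneg_pos)
    qed
  qed
  ultimately show ?thesis by (simp add: positive_definite_def)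
qed

text \<open>Induction on the set \<open>J\<close> of indices where \<open>M\<close> may differ from
  the identity. Eliminating \<open>c\<close> splits the pivot off the determinant and can only lower
  the remaining diagonal entries.\<close>

lemma Hadamard_aux:
  fixes M :: "real^'k^'k::finite"
  assumes "finite J" "positive_definite M" "\<And>i j. i \<notin> J \<Longrightarrow> M $ i $ j = (if i = j then 1 else 0)"
  shows "0 < det M \<and> det M \<le> (\<Prod>j\<in>J. M $ j $ j)"
  using assms
proof (induction J arbitrary: M rule: finite_induct)
  case empty
  then have "M = mat 1" by (simp add: vec_eq_iff mat_def)
  then show ?case by simp
next
  case (insert c J)
  define M' :: "real^'k^'k" where
    "M' = (\<chi> i j. if i = c \<or> j = c then (if i = j then 1 else 0) else M $ i $ j - M $ c $ i * M $ c $ j / M $ c $ c)"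
  have sym: "transpose M = M" using insert.prems by (simp add: positive_definite_def)
  have c: "M $ c $ c > 0" using positive_definite_diag_pos[OF insert.prems(1)] .
  have d: "det M = M $ c $ c * det M'" unfolding M'_def by (rule det_elimination[OF sym]) (use c in simp)
  have pd: "positive_definite M'" unfolding M'_def by (rule positive_definite_elimination[OF insert.prems(1)])
  have "M' $ i $ j = (if i = j then 1 else 0)" if "i \<notin> J" for i j
    using that insert.prems(2)[of i] symmetric_entry[OF sym, of c i] by (auto simp: M'_def)
  then have IH: "0 < det M' \<and> det M' \<le> (\<Prod>j\<in>J. M' $ j $ j)" by (intro insert.IH pd) auto
  have "(\<Prod>j\<in>J. M' $ j $ j) \<le> (\<Prod>j\<in>J. M $ j $ j)"
  proof (intro prod_mono conjI)
    fix j assume "j \<in> J"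
    then have "j \<noteq> c" using insert.hyps by auto
    then show "M' $ j $ j \<le> M $ j $ j" using c by (simp add: M'_def)
    show "0 \<le> M' $ j $ j" using positive_definite_diag_pos[OF pd, of j] by simp
  qed
  then have "det M' \<le> (\<Prod>j\<in>J. M $ j $ j)" using IH by simp
  then show ?case using IH c insert.hyps by (simp add: d)
qed

lemma positive_definite_det_pos: "positive_definite M \<Longrightarrow> 0 < det M"
  using Hadamard_aux[of UNIV M] by auto

lemma Hadamard_inequality:
  assumes "positive_definite M"
  shows "det M \<le> (\<Prod>j\<in>UNIV. M $ j $ j)"
  using Hadamard_aux[of UNIV M] assms by auto

text \<open>Eliminating \<open>c\<close> first lowers the diagonal entry at \<open>d\<close> by
  \<open>(M $ c $ d)\<^sup>2 / M $ c $ c\<close>, which is positive.\<close>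

lemma Hadamard_inequality_strict:
  fixes M :: "real^'k^'k::finite"
  assumes "positive_definite M" "M $ c $ d \<noteq> 0" "c \<noteq> d"
  shows "det M < (\<Prod>j\<in>UNIV. M $ j $ j)"
proof -
  define M' :: "real^'k^'k" where
    "M' = (\<chi> i j. if i = c \<or> j = c then (if i = j then 1 else 0) else M $ i $ j - M $ c $ i * M $ c $ j / M $ c $ c)"
  have sym: "transpose M = M" using assms by (simp add: positive_definite_def)
  note pos = positive_definite_diag_pos[OF assms(1)]
  have det: "det M = M $ c $ c * det M'"
    unfolding M'_def by (rule det_elimination[OF sym]) (use pos[of c] in simp)
  have pd: "positive_definite M'" unfolding M'_def by (rule positive_definite_elimination[OF assms(1)])
  have "det M' \<le> (\<Prod>j\<in>UNIV. M' $ j $ j)" by (rule Hadamard_inequality[OF pd])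
  also have "\<dots> = (\<Prod>j\<in>UNIV - {c}. M' $ j $ j)"
    by (subst prod.remove[of _ c]) (auto simp: M'_def)
  also have "\<dots> < (\<Prod>j\<in>UNIV - {c}. M $ j $ j)"
  proof (rule prod_mono_strict[of d])
    have "0 < M $ c $ d * M $ c $ d" using assms(2) not_real_square_gt_zero by blast
    then show "M' $ d $ d < M $ d $ d" using assms pos[of c] by (simp add: M'_def)
    fix j assume "j \<in> UNIV - {c}"
    then show "0 \<le> M' $ j $ j \<and> M' $ j $ j \<le> M $ j $ j"
      using positive_definite_diag_pos[OF pd, of j] pos[of c] by (simp add: M'_def)
    show "0 < M $ j $ j" by (rule pos)
  qed (use assms in auto)
  finally have "det M < M $ c $ c * (\<Prod>j\<in>UNIV - {c}. M $ j $ j)" using pos[of c] by (simp add: det)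
  then show ?thesis by (subst prod.remove[of _ c]) auto
qed

text \<open>Hadamard's inequality combined with \<open>x \<le> exp (x - 1)\<close> on the diagonal
  entries. An entry that deviates from the identity makes the first inequality strict if it is off
  the diagonal, and the second if it is on it.\<close>

lemma det_le_exp_trace:
  fixes M :: "real^'k^'k::finite"
  assumes "positive_definite M"
  shows "det M \<le> exp (trace M - real CARD('k))"
    and "M \<noteq> mat 1 \<Longrightarrow> det M < exp (trace M - real CARD('k))"
proof -
  note pos = positive_definite_diag_pos[OF assms]
  have ex: "exp (trace M - real CARD('k)) = (\<Prod>j\<in>UNIV. exp (M $ j $ j - 1))"
    by (simp add: trace_def exp_sum[symmetric] sum_subtractf)
  have le: "x \<le> exp (x - 1)" for x :: real using exp_ge_add_one_self[of "x - 1"] by simp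
  have l: "(\<Prod>j\<in>UNIV. M $ j $ j) \<le> exp (trace M - real CARD('k))"
    unfolding ex by (intro prod_mono) (use pos le in \<open>auto intro: less_imp_le\<close>)
  show "det M \<le> exp (trace M - real CARD('k))"
    using Hadamard_inequality[OF assms] l by linarith
  assume "M \<noteq> mat 1"
  then obtain c d where cd: "M $ c $ d \<noteq> (if c = d then 1 else 0)"
    by (auto simp: vec_eq_iff mat_def)
  show "det M < exp (trace M - real CARD('k))"
  proof (cases "c = d")
    case False
    then show ?thesis using Hadamard_inequality_strict[OF assms, of c d] cd l by simp
  next
    case True
    have "x < exp (x - 1)" if "x \<noteq> 1" for x :: real
      using exp_ge_add_one_self[of "x - 1"] that exp_ge_one_plus_x_over_n_power_n le[of x]
      by (smt (verit) ln_exp ln_eq_minus_one exp_gt_zero)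
    then have "(\<Prod>j\<in>UNIV. M $ j $ j) < exp (trace M - real CARD('k))"
      unfolding ex using cd True
      by (intro prod_mono_strict[of c]) (use pos le in \<open>auto intro: less_imp_le\<close>)
    then show ?thesis using Hadamard_inequality[OF assms] by linarith
  qed
qed

text \<open>Fenchel's inequality for - ln det, in exponential form. If Q = V^T V, then V S V^T has
  determinant det S det Q and trace \<open>Q \<bullet> S\<close>, so the preceding bound applies; V
  S V^T is the identity only if Q inverts S.\<close>

lemma det_mult_le_exp_inner:
  fixes S Q :: "real^'k^'k::finite"
  assumes S: "positive_definite S" and Q: "positive_definite Q"
  shows "det S * det Q \<le> exp (Q \<bullet> S - real CARD('k))"
    and "S ** Q \<noteq> mat 1 \<Longrightarrow> det S * det Q < exp (Q \<bullet> S - real CARD('k))"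
proof -
  obtain V where V: "Q = transpose V ** (V :: real^'k^'k)"
    using positive_semidefinite_factor positive_definite_imp_semidefinite[OF Q] by metis
  define M where "M = V ** S ** transpose V"
  have dQ: "det Q = det V * det V" by (simp add: V det_mul)
  have dM: "det M = det S * det Q" by (simp add: M_def dQ det_mul)
  have dV: "det V \<noteq> 0" using positive_definite_det_pos[OF Q] dQ by auto
  have tr: "trace M = Q \<bullet> S"
  proof -
    have "trace M = trace (transpose V ** (V ** S))" unfolding M_def by (rule trace_mul_sym)
    also have "\<dots> = trace (Q ** S)" by (simp add: V matrix_mul_assoc)
    also have "\<dots> = Q \<bullet> S" using Q by (simp add: trace_mult_eq_inner positive_definite_def)
    finally show ?thesis .
  qed
  have pd: "positive_definite M"
  proof -
    have "positive_semidefinite M"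
      using positive_semidefinite_conjugate[OF positive_definite_imp_semidefinite[OF S], of "transpose V"]
      by (simp add: M_def)
    then have s: "transpose M = M" by (simp add: positive_semidefinite_def)
    have "0 < v \<bullet> (M *v v)" if "v \<noteq> 0" for v
    proof -
      have e: "v \<bullet> (M *v v) = (transpose V *v v) \<bullet> (S *v (transpose V *v v))"
        unfolding M_def
        by (metis dot_lmul_matrix matrix_vector_mul_assoc transpose_matrix_vector transpose_transpose)
      have "transpose V *v v \<noteq> 0"
        using dV that by (metis det_transpose invertible_det_nz invertible_def matrix_left_invertible_ker)
      then show ?thesis using S by (simp add: e positive_definite_def)
    qed
    then show ?thesis using s by (simp add: positive_definite_def)
  qed
  show "det S * det Q \<le> exp (Q \<bullet> S - real CARD('k))"
    using det_le_exp_trace(1)[OF pd] by (simp add: dM tr)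
  assume ne: "S ** Q \<noteq> mat 1"
  have "M \<noteq> mat 1"
  proof
    assume "M = mat 1"
    then have "(V ** S) ** transpose V = mat 1" by (simp add: M_def)
    then have "transpose V ** (V ** S) = mat 1" by (simp add: matrix_left_right_inverse)
    then have "Q ** S = mat 1" by (simp add: V matrix_mul_assoc)
    then show False using ne by (simp add: matrix_left_right_inverse)
  qed
  then show "det S * det Q < exp (Q \<bullet> S - real CARD('k))"
    using det_le_exp_trace(2)[OF pd] by (simp add: dM tr)
qed

lemma positive_semidefinite_det_nz_imp_definite:
  fixes B :: "real^'k^'k::finite"
  assumes B: "positive_semidefinite B" and d: "det B \<noteq> 0"
  shows "positive_definite B"
proof -
  obtain V where V: "B = transpose V ** (V :: real^'k^'k)" using positive_semidefinite_factor[OF B] .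
  have "0 < v \<bullet> (B *v v)" if "v \<noteq> 0" for v
  proof -
    have e: "v \<bullet> (B *v v) = (V *v v) \<bullet> (V *v v)"
      unfolding V by (metis dot_lmul_matrix matrix_vector_mul_assoc transpose_matrix_vector inner_commute)
    have "det V \<noteq> 0" using d by (auto simp: V det_mul)
    then have "V *v v \<noteq> 0"
      using that by (metis invertible_det_nz invertible_def matrix_left_invertible_ker)
    then show ?thesis by (simp add: e)
  qed
  then show ?thesis using B by (simp add: positive_definite_def positive_semidefinite_def)
qed

section \<open>The maximiser and its inverse\<close>

lemma norm_matrix_mult_le: "norm (A ** B) \<le> norm A * norm B" for A B :: "real^'k^'k::finite"
proof -
  have sq: "(norm M)\<^sup>2 = (\<Sum>i\<in>UNIV. \<Sum>j\<in>UNIV. (M $ i $ j)\<^sup>2)" for M :: "real^'k^'k"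
    by (simp add: norm_matrix_eq_frobenius sum_nonneg)
  have "((A ** B) $ i $ j)\<^sup>2 \<le> (\<Sum>l\<in>UNIV. (A $ i $ l)\<^sup>2) * (\<Sum>l\<in>UNIV. (B $ l $ j)\<^sup>2)" for i j
    unfolding matrix_matrix_mult_def by (simp add: Cauchy_Schwarz_ineq_sum)
  then have "(norm (A ** B))\<^sup>2 \<le> (\<Sum>i\<in>UNIV. \<Sum>j\<in>UNIV. (\<Sum>l\<in>UNIV. (A $ i $ l)\<^sup>2) * (\<Sum>l\<in>UNIV. (B $ l $ j)\<^sup>2))"
    unfolding sq by (intro sum_mono)
  also have "\<dots> = (\<Sum>i\<in>UNIV. \<Sum>l\<in>UNIV. (A $ i $ l)\<^sup>2) * (\<Sum>j\<in>UNIV. \<Sum>l\<in>UNIV. (B $ l $ j)\<^sup>2)"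
    by (simp add: sum_product)
  also have "(\<Sum>j\<in>UNIV. \<Sum>l\<in>UNIV. (B $ l $ j)\<^sup>2) = (norm B)\<^sup>2"
    unfolding sq by (rule sum.swap)
  also have "(\<Sum>i\<in>UNIV. \<Sum>l\<in>UNIV. (A $ i $ l)\<^sup>2) * (norm B)\<^sup>2 = (norm A * norm B)\<^sup>2"
    by (simp add: sq power_mult_distrib)
  finally show ?thesis by (rule power2_le_imp_le) simp
qed

lemma norm_matrix_le_entries:
  fixes A :: "real^'k^'k::finite"
  assumes "\<And>i j. \<bar>A $ i $ j\<bar> \<le> c"
  shows "norm A \<le> real CARD('k) * real CARD('k) * c"
proof -
  have "norm A \<le> (\<Sum>i\<in>UNIV. norm (A $ i))" unfolding norm_vec_def[of A] by (rule L2_set_le_sum) simp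
  also have "\<dots> \<le> (\<Sum>i\<in>UNIV. \<Sum>j\<in>UNIV. \<bar>A $ i $ j\<bar>)"
    by (intro sum_mono norm_le_l1_cart)
  also have "\<dots> \<le> (\<Sum>i\<in>(UNIV::'k set). \<Sum>j\<in>(UNIV::'k set). c)" by (intro sum_mono assms)
  finally show ?thesis by (simp add: mult.assoc)
qed

text \<open>A column \<open>w\<close> of \<open>R\<close> is mapped by \<open>M\<close> to a unit
  vector, so the form at \<open>w\<close> is at most \<open>norm w\<close>, and coercivity gives
  \<open>norm w \<le> 1 / l\<close>. The dimensional factor is crude; what matters is that the bound
  depends on \<open>M\<close> only through \<open>l\<close>.\<close>

lemma norm_inverse_le:
  fixes M R :: "real^'k^'k::finite"
  assumes l: "l > 0" "\<And>v. l * (v \<bullet> v) \<le> v \<bullet> (M *v v)" and R: "M ** R = mat 1"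
  shows "norm R \<le> real CARD('k) * real CARD('k) / l"
proof -
  have "\<bar>R $ i $ j\<bar> \<le> 1 / l" for i j
  proof -
    define w where "w = R *v axis j 1"
    have "l * (norm w * norm w) \<le> w \<bullet> (M *v w)"
      using l(2)[of w] by (simp add: power2_norm_eq_inner[symmetric] power2_eq_square)
    also have "M *v w = axis j 1" by (simp add: w_def matrix_vector_mul_assoc R)
    also have "w \<bullet> axis j 1 \<le> norm w * 1" by (metis norm_cauchy_schwarz norm_axis_1)
    finally have "norm w * (l * norm w) \<le> norm w * 1" by (simp add: mult_ac)
    then have "l * norm w \<le> 1" by (cases "norm w = 0") (auto simp: mult_le_cancel_left)
    then have "norm w \<le> 1 / l" using l(1) by (simp add: field_simps)
    moreover have "\<bar>w $ i\<bar> \<le> norm w" by (rule component_le_norm_cart)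
    moreover have "w $ i = R $ i $ j" using bilinear_form_axis[of i R j] by (simp add: w_def inner_axis')
    ultimately show ?thesis by simp
  qed
  from norm_matrix_le_entries[OF this] show ?thesis by simp
qed

lemma matrix_diff_ldistrib: "A ** (B - C) = A ** B - A ** C" for A B C :: "real^'k^'k::finite"
  by (simp add: matrix_matrix_mult_def vec_eq_iff right_diff_distrib sum_subtractf)

lemma matrix_diff_rdistrib: "(A - B) ** C = A ** C - B ** C" for A B C :: "real^'k^'k::finite"
  by (simp add: matrix_matrix_mult_def vec_eq_iff left_diff_distrib sum_subtractf)

lemma matrix_add_rdistrib: "(A + B) ** C = A ** C + B ** C" for A B C :: "real^'k^'k::finite"
  by (simp add: matrix_matrix_mult_def vec_eq_iff distrib_right sum.distrib)

lemma matrix_scaleR_left: "(c *\<^sub>R A) ** B = c *\<^sub>R (A ** B)" for A B :: "real^'k^'k::finite"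
  by (simp add: matrix_matrix_mult_def vec_eq_iff sum_distrib_left mult.assoc)

lemma matrix_scaleR_right: "A ** (c *\<^sub>R B) = c *\<^sub>R (A ** B)" for A B :: "real^'k^'k::finite"
  by (simp add: matrix_matrix_mult_def vec_eq_iff sum_distrib_left mult_ac)

text \<open>The resolvent identity. Together with \<open>norm_inverse_le\<close> it replaces
  differentiation of the inverse.\<close>

lemma inverse_difference:
  fixes M M' Q R :: "real^'k^'k::finite"
  assumes "R ** M' = mat 1" "M ** Q = mat 1"
  shows "R - Q = R ** (M - M') ** Q"
proof -
  have "R ** (M - M') ** Q = R ** (M ** Q) - (R ** M') ** Q"
    by (simp add: matrix_diff_ldistrib matrix_diff_rdistrib matrix_mul_assoc)
  then show ?thesis by (simp add: assms)
qed

lemma norm_matrix_vector_mult_le: "norm (N *v v) \<le> norm N * norm v" for N :: "real^'k^'k::finite"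
proof (rule power2_le_imp_le)
  have "(norm (N *v v))\<^sup>2 = (\<Sum>i\<in>UNIV. (\<Sum>j\<in>UNIV. N $ i $ j * v $ j)\<^sup>2)"
    by (simp add: norm_vec_def L2_set_def sum_nonneg matrix_vector_mult_def)
  also have "\<dots> \<le> (\<Sum>i\<in>UNIV. (\<Sum>j\<in>UNIV. (N $ i $ j)\<^sup>2) * (\<Sum>j\<in>UNIV. (v $ j)\<^sup>2))"
    by (intro sum_mono Cauchy_Schwarz_ineq_sum)
  also have "\<dots> = (norm N * norm v)\<^sup>2"
    by (simp add: norm_matrix_eq_frobenius norm_vec_def[of v] L2_set_def sum_nonneg power_mult_distrib sum_distrib_right)
  finally show "(norm (N *v v))\<^sup>2 \<le> (norm N * norm v)\<^sup>2" .
qed simp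

lemma positive_definite_perturbation:
  fixes M N :: "real^'k^'k::finite"
  assumes N: "transpose N = N" and M: "transpose M = M" and l: "\<And>v. l * (v \<bullet> v) \<le> v \<bullet> (M *v v)"
    and t: "\<bar>t\<bar> * norm N \<le> l / 2"
  shows "l / 2 * (v \<bullet> v) \<le> v \<bullet> ((M + t *\<^sub>R N) *v v)"
proof -
  have "\<bar>v \<bullet> (N *v v)\<bar> \<le> norm v * norm (N *v v)" by (rule Cauchy_Schwarz_ineq2)
  also note norm_matrix_vector_mult_le[of N v]
  finally have "\<bar>v \<bullet> (N *v v)\<bar> \<le> norm v * (norm N * norm v)" by (simp add: mult_left_mono)
  then have "\<bar>v \<bullet> (N *v v)\<bar> \<le> norm N * (v \<bullet> v)"
    by (simp add: mult_ac power2_norm_eq_inner[symmetric] power2_eq_square)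
  then have "\<bar>t\<bar> * \<bar>v \<bullet> (N *v v)\<bar> \<le> \<bar>t\<bar> * (norm N * (v \<bullet> v))" by (rule mult_left_mono) simp
  also have "\<dots> \<le> l / 2 * (v \<bullet> v)"
    using mult_right_mono[OF t, of "v \<bullet> v"] by (simp add: mult_ac)
  finally have "\<bar>t * (v \<bullet> (N *v v))\<bar> \<le> l / 2 * (v \<bullet> v)" by (simp add: abs_mult)
  then show ?thesis using l[of v]
    by (simp add: matrix_vector_mult_add_rdistrib inner_add_right scaleR_matrix_vector_assoc[symmetric])
qed

lemma positive_definiteI_lower_bound:
  "transpose M = M \<Longrightarrow> l > 0 \<Longrightarrow> (\<And>v. l * (v \<bullet> v) \<le> v \<bullet> (M *v v)) \<Longrightarrow> positive_definite M"
  unfolding positive_definite_def by (meson inner_gt_zero_iff less_le_trans mult_pos_pos)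

text \<open>The form is nonnegative at the sum and at the difference of two unit vectors.\<close>

lemma sdp_feasible_entry_le:
  fixes S :: "real^'k^'k::finite"
  assumes "sdp_feasible S" shows "\<bar>S $ i $ j\<bar> \<le> 1"
proof -
  have sym: "transpose S = S" and nn: "\<And>v. 0 \<le> v \<bullet> (S *v v)" and d: "\<And>i. S $ i $ i = 1"
    using assms by (auto simp: sdp_feasible_def positive_semidefinite_def)
  have "0 \<le> (axis i 1 + s *\<^sub>R axis j 1) \<bullet> (S *v (axis i 1 + s *\<^sub>R axis j 1))" for s by (rule nn)
  then have "0 \<le> 1 + 2 * s * S $ i $ j + s * s" for s
    using symmetric_entry[OF sym, of j i]
    by (simp add: matrix_vector_right_distrib matrix_vector_mult_scaleR inner_add_left inner_add_right
        bilinear_form_axis d algebra_simps)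
  from this[of 1] this[of "-1"] show ?thesis by (simp add: abs_le_iff)
qed

section \<open>The optimal pair: existence, uniqueness, duality gap\<close>

lemma compact_sdp_feasible: "compact (Collect (sdp_feasible :: real^'k^'k::finite \<Rightarrow> bool))"
proof -
  have "bounded (Collect (sdp_feasible :: real^'k^'k \<Rightarrow> bool))"
    by (intro boundedI[of _ "real CARD('k) * real CARD('k) * 1"] norm_matrix_le_entries sdp_feasible_entry_le) auto
  moreover have "closed (Collect (sdp_feasible :: real^'k^'k \<Rightarrow> bool))"
    unfolding sdp_feasible_def positive_semidefinite_def bilinear_form_eq vec_eq_iff transpose_def vec_lambda_beta
    by (intro closed_Collect_conj closed_Collect_all closed_Collect_eq closed_Collect_le continuous_intros)
  ultimately show ?thesis by (simp add: compact_eq_bounded_closed)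
qed

lemma continuous_on_det: "continuous_on X (det :: real^'k^'k::finite \<Rightarrow> real)"
  unfolding det_def by (intro continuous_intros)

lemma sdp_feasible_mat_1: "sdp_feasible (mat 1 :: real^'k^'k::finite)"
  by (simp add: sdp_feasible_def positive_semidefinite_def mat_def transpose_def vec_eq_iff)
     (auto simp: mat_def[symmetric])

text \<open>First-order conditions, with \<open>Q = S\<^sup>-\<^sup>1\<close> and \<open>t = 2 \<beta>\<close>; the diagonal of \<open>Q + t A\<close> carries the multipliers.\<close>
definition optimal_pair :: "real^'k^'k::finite \<Rightarrow> real \<Rightarrow> real^'k^'k \<Rightarrow> real^'k^'k \<Rightarrow> bool" where
  "optimal_pair A t S Q \<longleftrightarrow> positive_definite S \<and> positive_definite Q \<and> Q ** S = mat 1 \<and> S ** Q = mat 1 \<and>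
     (\<forall>i. S $ i $ i = 1) \<and> (\<forall>i j. i \<noteq> j \<longrightarrow> Q $ i $ j = - t * A $ i $ j)"

text \<open>The exponential of the objective is continuous up to the singular matrices, so it
  attains its maximum; its value at the identity is positive, so the maximiser is nonsingular. The
  first-order condition is found without differentiating det: for a feasible perturbation S + s N
  with inverse R, maximality and \<open>det_mult_le_exp_inner\<close> give a one-sided inequality
  between \<open>t * (A \<bullet> N)\<close> and \<open>- (R \<bullet> N)\<close>, and letting s
  tend to 0 from both sides turns it into an equality for Q.\<close>

lemma optimal_pair_exists:
  fixes A :: "real^'k^'k::finite"
  assumes symA: "transpose A = A"
  obtains S Q where "optimal_pair A t S Q"
proof -
  define f where "f S = det S * exp (t * (A \<bullet> S))" for S
  have "continuous_on (Collect sdp_feasible) f"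
    unfolding f_def by (intro continuous_intros continuous_on_det)
  then obtain S where S: "sdp_feasible S" and max: "\<And>S'. sdp_feasible S' \<Longrightarrow> f S' \<le> f S"
    using continuous_attains_sup[OF compact_sdp_feasible, of f] sdp_feasible_mat_1 by auto
  have "0 < f (mat 1)" by (simp add: f_def)
  also have "\<dots> \<le> f S" by (rule max[OF sdp_feasible_mat_1])
  finally have "det S > 0" by (simp add: f_def zero_less_mult_iff)
  then have pdS: "positive_definite S"
    using S positive_semidefinite_det_nz_imp_definite[of S] by (auto simp: sdp_feasible_def)
  have diag: "S $ i $ i = 1" for i using S by (simp add: sdp_feasible_def)
  have symS: "transpose S = S" using pdS by (simp add: positive_definite_def)
  obtain Q where Q: "positive_definite Q" "Q ** S = mat 1" "S ** Q = mat 1"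
    using positive_definite_inverse[OF pdS] .
  obtain l where l: "l > 0" "\<And>v. l * (v \<bullet> v) \<le> v \<bullet> (S *v v)"
    using positive_definite_lower_bound[OF pdS] by blast
  have "Q $ i $ j = - t * A $ i $ j" if ij: "i \<noteq> j" for i j
  proof -
    \<comment> \<open>A symmetric direction with zero diagonal, so that
      \<open>S + s *\<^sub>R N\<close> stays feasible for small \<open>s\<close>; pairing with it
      reads off one off-diagonal entry twice.\<close>
    define N :: "real^'k^'k" where "N = (\<chi> a b. if (a = i \<and> b = j) \<or> (a = j \<and> b = i) then 1 else 0)"
    have N: "transpose N = N" by (auto simp: N_def transpose_def vec_eq_iff)
    have nN: "norm N > 0" using ij by (auto simp: N_def vec_eq_iff)
    have NB: "N \<bullet> B = 2 * B $ i $ j" if "transpose B = B" for B :: "real^'k^'k"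
    proof -
      have "N \<bullet> B = (\<Sum>a\<in>UNIV. \<Sum>b\<in>UNIV. (if a = i then (if b = j then B $ i $ j else 0) else 0) + (if a = j then (if b = i then B $ j $ i else 0) else 0))"
        unfolding inner_matrix_eq by (intro sum.cong refl) (use ij in \<open>auto simp: N_def\<close>)
      also have "\<dots> = B $ i $ j + B $ j $ i"
      proof -
        have e: "(\<Sum>b\<in>UNIV. if a = c then (if b = d then x else 0) else 0) = (if a = c then x else 0)" for a c d :: 'k and x :: real
          by simp
        show ?thesis by (simp add: sum.distrib e)
      qed
      finally show ?thesis using symmetric_entry[OF that, of j i] by simp
    qed
    define d where "d = l / 2 / norm N"
    have d: "d > 0" using l nN by (simp add: d_def)
    have "\<exists>R. norm R \<le> real CARD('k) * real CARD('k) / (l / 2) \<and> 0 \<le> - s * (t * (A \<bullet> N) + R \<bullet> N) \<and>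
        R - Q = - s *\<^sub>R (R ** N ** Q)" if s: "\<bar>s\<bar> \<le> d" for s
    proof -
      define M where "M = S + s *\<^sub>R N"
      have "\<bar>s\<bar> * norm N \<le> l / 2" using s nN by (simp add: d_def pos_le_divide_eq)
      then have lM: "l / 2 * (v \<bullet> v) \<le> v \<bullet> (M *v v)" for v
        unfolding M_def using positive_definite_perturbation[OF N symS l(2)] by blast
      have symM: "transpose M = M" using symS N by (simp add: M_def transpose_def vec_eq_iff)
      have pdM: "positive_definite M" by (rule positive_definiteI_lower_bound[OF symM _ lM]) (use l in simp)
      then have "sdp_feasible M"
        using diag ij by (auto simp: sdp_feasible_def positive_definite_imp_semidefinite M_def N_def)
      then have "f M \<le> f S" by (rule max)
      then have 1: "det M * exp (t * s * (A \<bullet> N)) \<le> det S"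
        by (simp add: f_def M_def inner_add_right distrib_left exp_add mult_ac)
      obtain R where R: "positive_definite R" "R ** M = mat 1" "M ** R = mat 1"
        using positive_definite_inverse[OF pdM] .
      have RS: "R \<bullet> S = real CARD('k) - s * (R \<bullet> N)"
      proof -
        have "R \<bullet> M = trace (R ** M)" using R(1) by (simp add: trace_mult_eq_inner positive_definite_def)
        then have "R \<bullet> M = real CARD('k)" by (simp add: R(2) trace_I)
        then show ?thesis by (simp add: M_def inner_add_right)
      qed
      have dR: "det R * det M = 1" using arg_cong[OF R(2), of det] by (simp add: det_mul)
      have dM: "det M > 0" "det S > 0" using positive_definite_det_pos pdM pdS by auto
      \<comment> \<open>The inequality for the pair (S, R) bounds det S / det M from above, whereas
        maximality of \<open>S\<close> bounds it from below.\<close>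
      have "det S * det R \<le> exp (- s * (R \<bullet> N))"
        using det_mult_le_exp_inner(1)[OF pdS R(1)] by (simp add: RS)
      then have "det S \<le> det M * exp (- s * (R \<bullet> N))"
      proof -
        have "det S * det R * det M \<le> exp (- s * (R \<bullet> N)) * det M"
          by (rule mult_right_mono) (use \<open>det S * det R \<le> _\<close> dM in auto)
        then show ?thesis using dR by (simp add: mult.assoc mult.commute[of "exp _"])
      qed
      then have "det M * exp (t * s * (A \<bullet> N)) \<le> det M * exp (- s * (R \<bullet> N))" using 1 by simp
      then have "t * s * (A \<bullet> N) \<le> - s * (R \<bullet> N)" using dM by simp
      then have "0 \<le> - s * (t * (A \<bullet> N) + R \<bullet> N)" by (simp add: algebra_simps)
      moreover have "norm R \<le> real CARD('k) * real CARD('k) / (l / 2)"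
        by (rule norm_inverse_le[OF _ lM R(3)]) (use l in simp)
      moreover have "R - Q = - s *\<^sub>R (R ** N ** Q)"
        using inverse_difference[OF R(2) Q(3)]
        by (simp add: M_def scalar_matrix_assoc matrix_scalar_ac flip: scaleR_minus_left)
      ultimately show ?thesis by blast
    qed
    then obtain R where R: "\<And>s. \<bar>s\<bar> \<le> d \<Longrightarrow> norm (R s) \<le> real CARD('k) * real CARD('k) / (l / 2) \<and>
       0 \<le> - s * (t * (A \<bullet> N) + R s \<bullet> N) \<and> R s - Q = - s *\<^sub>R (R s ** N ** Q)" by metis
    \<comment> \<open>The error of replacing \<open>R s\<close> by \<open>Q\<close> is at most
      \<open>\<bar>s\<bar> * C\<close>, which vanishes in the limit.\<close>
    define C where "C = real CARD('k) * real CARD('k) / (l / 2) * norm N * norm Q * norm N"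
    have C: "\<bar>(R s - Q) \<bullet> N\<bar> \<le> \<bar>s\<bar> * C" if "\<bar>s\<bar> \<le> d" for s
    proof -
      have "\<bar>(R s - Q) \<bullet> N\<bar> \<le> norm (R s - Q) * norm N" by (rule Cauchy_Schwarz_ineq2)
      also have "norm (R s - Q) = \<bar>s\<bar> * norm (R s ** N ** Q)" using R[OF that] by simp
      also have "norm (R s ** N ** Q) \<le> norm (R s) * norm N * norm Q"
        by (meson norm_matrix_mult_le order_trans mult_right_mono norm_ge_zero)
      also have "norm (R s) \<le> real CARD('k) * real CARD('k) / (l / 2)" using R[OF that] by simp
      finally show ?thesis by (simp add: C_def mult_left_mono mult_right_mono mult_ac)
    qed
    have up: "t * (A \<bullet> N) + Q \<bullet> N \<le> s * C" if "0 < s" "s \<le> d" for s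
    proof -
      have "t * (A \<bullet> N) + R s \<bullet> N \<le> 0" using R[of s] that by (simp add: mult_le_0_iff zero_le_mult_iff)
      then show ?thesis using C[of s] that by (simp add: inner_diff_left abs_le_iff)
    qed
    have lo: "- (t * (A \<bullet> N) + Q \<bullet> N) \<le> s * C" if "0 < s" "s \<le> d" for s
    proof -
      have "0 \<le> t * (A \<bullet> N) + R (- s) \<bullet> N" using R[of "- s"] that by (simp add: zero_le_mult_iff)
      then show ?thesis using C[of "- s"] that by (simp add: inner_diff_left abs_le_iff)
    qed
    have lim: "((\<lambda>s. s * C) \<longlongrightarrow> 0 * C) (at_right 0)" by (intro tendsto_intros)
    have ev: "eventually (\<lambda>s::real. 0 < s \<and> s \<le> d) (at_right 0)"
      using d by (auto simp: eventually_at_right_field intro!: exI[of _ d])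
    have "t * (A \<bullet> N) + Q \<bullet> N \<le> 0 * C"
      by (rule tendsto_lowerbound[OF lim eventually_mono[OF ev]]) (use up in auto)
    moreover have "- (t * (A \<bullet> N) + Q \<bullet> N) \<le> 0 * C"
      by (rule tendsto_lowerbound[OF lim eventually_mono[OF ev] trivial_limit_at_right_real]) (use lo in blast)
    ultimately have "t * (N \<bullet> A) + N \<bullet> Q = 0" by (simp add: inner_commute)
    then show ?thesis using NB[OF symA] NB[of Q] Q(1) by (simp add: positive_definite_def algebra_simps)
  qed
  then show ?thesis using pdS Q diag by (intro that[of S Q]) (auto simp: optimal_pair_def)
qed

text \<open>\<open>Q\<close> and \<open>- t *\<^sub>R A\<close> differ only on the diagonal, where
  \<open>S' - S\<close> vanishes, and \<open>Q \<bullet> S\<close> is the trace of the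
  identity.\<close>

lemma optimal_pair_inner_diff:
  fixes A :: "real^'k^'k::finite"
  assumes "optimal_pair A t S Q" "\<And>i. S' $ i $ i = 1"
  shows "t * (A \<bullet> (S' - S)) = real CARD('k) - Q \<bullet> S'"
proof -
  have "Q \<bullet> (S' - S) = - t * (A \<bullet> (S' - S))"
  proof -
    have "Q $ i $ j * (S' - S) $ i $ j = - t * (A $ i $ j * (S' - S) $ i $ j)" for i j
      using assms by (cases "i = j") (simp_all add: optimal_pair_def)
    then show ?thesis unfolding inner_matrix_eq sum_distrib_left by simp
  qed
  moreover have "Q \<bullet> S = real CARD('k)"
    using assms(1) trace_mult_eq_inner[of Q S] by (simp add: optimal_pair_def positive_definite_def trace_I)
  ultimately show ?thesis by (simp add: inner_diff_right)
qed

text \<open>By \<open>optimal_pair_inner_diff\<close> this is the strict case of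
  \<open>det_mult_le_exp_inner\<close> for the pair (S', Q); \<open>S' ** Q = mat 1\<close> would
  force S' = S.\<close>

lemma optimal_pair_det_less:
  fixes A :: "real^'k^'k::finite"
  assumes op: "optimal_pair A t S Q" and S': "positive_definite S'" "\<And>i. S' $ i $ i = 1" and ne: "S' \<noteq> S"
  shows "t * (A \<bullet> S') + ln (det S') < t * (A \<bullet> S) + ln (det S)"
proof -
  have "S' ** Q \<noteq> mat 1"
  proof
    assume "S' ** Q = mat 1"
    then have "S' ** (Q ** S) = S" by (simp add: matrix_mul_assoc)
    then show False using ne op by (simp add: optimal_pair_def)
  qed
  then have "det S' * det Q < exp (Q \<bullet> S' - real CARD('k))"
    using op S' by (intro det_mult_le_exp_inner(2)) (auto simp: optimal_pair_def)
  moreover have pos: "det S' > 0" "det Q > 0" "det S > 0"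
    using op S' by (auto simp: optimal_pair_def intro: positive_definite_det_pos)
  ultimately have "ln (det S' * det Q) < Q \<bullet> S' - real CARD('k)"
    using ln_less_cancel_iff[of "det S' * det Q" "exp (Q \<bullet> S' - real CARD('k))"] by simp
  moreover have "ln (det Q) = - ln (det S)"
  proof -
    have "Q ** S = mat 1" using op by (simp add: optimal_pair_def)
    then have "det Q * det S = 1" by (simp flip: det_mul)
    then have "ln (det Q * det S) = 0" by simp
    then show ?thesis using pos by (simp add: ln_mult)
  qed
  moreover have "t * (A \<bullet> (S' - S)) = real CARD('k) - Q \<bullet> S'"
    by (rule optimal_pair_inner_diff[OF op S'(2)])
  ultimately show ?thesis using pos by (simp add: ln_mult inner_diff_right algebra_simps)
qed

lemma optimal_pair_feasible: "optimal_pair A t S Q \<Longrightarrow> sdp_feasible S"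
  by (simp add: optimal_pair_def sdp_feasible_def positive_definite_imp_semidefinite)

text \<open>The duality gap of the central path, from \<open>Q \<bullet> S' \<ge> 0\<close>. For t >
  0 it says that the value at \<open>S\<close> is within k/t of the optimum.\<close>

lemma optimal_pair_trace_gap:
  fixes A :: "real^'k^'k::finite"
  assumes "optimal_pair A t S Q" "sdp_feasible S'"
  shows "t * (A \<bullet> S') \<le> t * (A \<bullet> S) + real CARD('k)"
proof -
  have "0 \<le> Q \<bullet> S'"
    using assms by (intro positive_semidefinite_inner_nonneg positive_definite_imp_semidefinite[of Q])
      (auto simp: optimal_pair_def sdp_feasible_def)
  then show ?thesis using optimal_pair_inner_diff[OF assms(1), of S'] assms(2)
    by (simp add: sdp_feasible_def inner_diff_right right_diff_distrib)
qed

lemma optimal_pair_is_arg_max_iff: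
  fixes A :: "real^'k^'k::finite"
  assumes symA: "transpose A = A" and op: "optimal_pair A (2 * \<beta>) S Q"
  shows "is_arg_max (free_energy \<beta> A) sdp_feasible S' \<longleftrightarrow> S' = S"
proof -
  have fe: "free_energy \<beta> A R = ereal (\<beta> * (A \<bullet> R) + ln (det R) / 2)" if "det R \<noteq> 0" for R
    using that by (simp add: free_energy_def log_det_def trace_mult_eq_inner symA)
  have fe0: "free_energy \<beta> A R = - \<infinity>" if "det R = 0" for R
    using that by (simp add: free_energy_def log_det_def)
  have dS: "det S > 0" using op by (auto simp: optimal_pair_def intro: positive_definite_det_pos)
  \<comment> \<open>Singular competitors have value - infinity and are treated apart; nonsingular
    feasible ones are positive definite.\<close>
  have less: "free_energy \<beta> A R < free_energy \<beta> A S" if "sdp_feasible R" "R \<noteq> S" for R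
  proof (cases "det R = 0")
    case True
    then show ?thesis using dS by (simp add: fe0 fe)
  next
    case False
    then have "positive_definite R"
      using that positive_semidefinite_det_nz_imp_definite by (auto simp: sdp_feasible_def)
    then have "2 * \<beta> * (A \<bullet> R) + ln (det R) < 2 * \<beta> * (A \<bullet> S) + ln (det S)"
      using that by (intro optimal_pair_det_less[OF op]) (auto simp: sdp_feasible_def)
    then show ?thesis using dS False by (simp add: fe)
  qed
  have fS: "sdp_feasible S" by (rule optimal_pair_feasible[OF op])
  show ?thesis
    unfolding is_arg_max_def using less fS by (auto dest: less_asym)
qed

section \<open>Convergence of the central path\<close>

text \<open>Bezoutian argument: for a nondegenerate zero \<open>p\<close>, the polynomial \<open>\<lambda>x. det (B x p)\<close> is nonzero at \<open>p\<close>
  and vanishes at every other zero, so these polynomials are linearly independent;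
  but they all lie in one finite-dimensional space.\<close>
lemma finite_nondegenerate_zeros:
  fixes F :: "real^'n::finite \<Rightarrow> real^'n" and B :: "real^'n \<Rightarrow> real^'n \<Rightarrow> real^'n^'n"
  assumes aff: "\<And>y i j. linear (\<lambda>x. B x y $ i $ j - B 0 y $ i $ j)"
    and sec: "\<And>x y. F x - F y = B x y *v (x - y)"
    and Z: "\<And>p. p \<in> Z \<Longrightarrow> F p = 0" "\<And>p. p \<in> Z \<Longrightarrow> det (B p p) \<noteq> 0"
  shows "finite Z"
proof -
  \<comment> \<open>\<open>ext\<close> adjoins a coordinate 1 to \<open>x\<close>, so that an affine
    entry of \<open>B x y\<close> becomes a linear form in \<open>ext x\<close> with coefficients
    \<open>co\<close>.\<close>
  define ext :: "real^'n \<Rightarrow> 'n option \<Rightarrow> real" where "ext x z = (case z of None \<Rightarrow> 1 | Some m \<Rightarrow> x $ m)" for x z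
  define co where "co y i j z = (case z of None \<Rightarrow> B 0 y $ i $ j | Some m \<Rightarrow> B (axis m 1) y $ i $ j - B 0 y $ i $ j)" for y i j z
  have Bx: "B x y $ i $ j = (\<Sum>z\<in>UNIV. co y i j z * ext x z)" for x y i j
  proof -
    define f where "f x = B x y $ i $ j - B 0 y $ i $ j" for x
    have lf: "linear f" unfolding f_def by (rule aff)
    have "(\<Sum>m\<in>UNIV. x $ m *\<^sub>R axis m 1) = x"
      using basis_expansion[of x] by (simp add: scalar_mult_eq_scaleR)
    then have "f x = f (\<Sum>m\<in>UNIV. x $ m *\<^sub>R axis m 1)" by simp
    also have "\<dots> = (\<Sum>m\<in>UNIV. x $ m * f (axis m 1))"
      by (simp only: linear_sum[OF lf] linear_scale[OF lf]) simp
    finally show ?thesis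
      by (simp add: UNIV_option_conv sum.reindex co_def ext_def mult.commute f_def)
  qed
  \<comment> \<open>Expanding the determinant picks one extended coordinate \<open>\<phi> i\<close>
    in each row \<open>i\<close>. \<open>mo x\<close> lists the resulting products and
    \<open>C y\<close> their coefficients, which are free of \<open>x\<close>. Repeated monomials do
    no harm, since only the finiteness of the dimension counts.\<close>
  define C :: "real^'n \<Rightarrow> real^('n \<Rightarrow> 'n option)" where
    "C y = (\<chi> \<phi>. \<Sum>\<pi> | \<pi> permutes UNIV. of_int (sign \<pi>) * (\<Prod>i\<in>UNIV. co y i (\<pi> i) (\<phi> i)))" for y
  define mo :: "real^'n \<Rightarrow> real^('n \<Rightarrow> 'n option)" where "mo x = (\<chi> \<phi>. \<Prod>i\<in>UNIV. ext x (\<phi> i))" for x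
  have det: "det (B x y) = C y \<bullet> mo x" for x y
  proof -
    have "(\<Prod>i\<in>UNIV. B x y $ i $ \<pi> i) = (\<Sum>\<phi>\<in>UNIV. \<Prod>i\<in>UNIV. co y i (\<pi> i) (\<phi> i) * ext x (\<phi> i))" for \<pi>
      unfolding Bx by (subst prod_sum_PiE) (auto simp: PiE_UNIV_domain)
    then have "det (B x y) = (\<Sum>\<pi> | \<pi> permutes UNIV. \<Sum>\<phi>\<in>UNIV. of_int (sign \<pi>) * (\<Prod>i\<in>UNIV. co y i (\<pi> i) (\<phi> i)) * (\<Prod>i\<in>UNIV. ext x (\<phi> i)))"
      by (simp add: det_def prod.distrib sum_distrib_left mult.assoc)
    also have "\<dots> = (\<Sum>\<phi>\<in>UNIV. \<Sum>\<pi> | \<pi> permutes UNIV. of_int (sign \<pi>) * (\<Prod>i\<in>UNIV. co y i (\<pi> i) (\<phi> i)) * (\<Prod>i\<in>UNIV. ext x (\<phi> i)))"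
      by (rule sum.swap)
    finally show ?thesis by (simp add: C_def mo_def inner_vec_def sum_distrib_right)
  qed
  \<comment> \<open>For two zeros the secant identity gives \<open>B q p *v (q - p) = 0\<close>, so
    this matrix is singular.\<close>
  have orth: "C p \<bullet> mo q = 0" if "p \<in> Z" "q \<in> Z" "p \<noteq> q" for p q
  proof -
    have "B q p *v (q - p) = 0" using sec[of q p] Z that by simp
    then have "\<not> invertible (B q p)"
      using that by (metis invertible_def matrix_left_invertible_ker right_minus_eq)
    then show ?thesis using invertible_det_nz[of "B q p"] by (simp add: det)
  qed
  have nz: "C p \<bullet> mo p \<noteq> 0" if "p \<in> Z" for p using Z(2)[OF that] by (simp add: det)
  have inj: "inj_on C Z"
    by (rule inj_onI) (metis nz orth)
  \<comment> \<open>Pairing with \<open>mo p\<close> annihilates all other vectors of the family but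
    not \<open>C p\<close>.\<close>
  have "independent (C ` Z)"
    unfolding dependent_def
  proof (rule notI, clarsimp)
    fix p assume p: "p \<in> Z" "C p \<in> span (C ` Z - {C p})"
    have "subspace {v. v \<bullet> mo p = 0}" by (simp add: subspace_hyperplane2 inner_commute[of _ "mo p"] subspace_hyperplane)
    moreover have "C ` Z - {C p} \<subseteq> {v. v \<bullet> mo p = 0}" using orth p by auto
    ultimately have "span (C ` Z - {C p}) \<subseteq> {v. v \<bullet> mo p = 0}" by (rule span_minimal[rotated])
    then show False using p nz by blast
  qed
  then have "finite (C ` Z)" by (rule independent_imp_finite)
  then show ?thesis using inj by (rule finite_imageD)
qed

text \<open>The optimality system, in coordinates: the off-diagonal entries \<open>Some (a, b)\<close> hold \<open>S\<^sub>a\<^sub>b\<close>, the diagonal ones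
  hold \<open>d\<^sub>a\<close> with \<open>Q = diag d - t A\<close>, and \<open>None\<close> holds \<open>t\<close>.\<close>

definition path_S :: "real^(('k::finite \<times> 'k) option) \<Rightarrow> real^'k^'k" where
  "path_S x = (\<chi> a b. if a = b then 1 else x $ Some (a, b))"

definition path_N :: "real^(('k::finite \<times> 'k) option) \<Rightarrow> real^'k^'k" where
  "path_N x = (\<chi> a b. if a = b then 0 else x $ Some (a, b))"

definition path_D :: "real^(('k::finite \<times> 'k) option) \<Rightarrow> real^'k^'k" where
  "path_D x = (\<chi> a b. if a = b then x $ Some (a, a) else 0)"

text \<open>Pinning one coordinate makes the system square: \<open>s = None\<close> prescribes t,
  and \<open>s = Some (i, j)\<close> with distinct i, j prescribes an entry of S. Symmetry of
  \<open>path_S x\<close> is not built in and has to be recovered in the linearisation.\<close>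

definition path_system ::
    "real^'k^'k \<Rightarrow> ('k::finite \<times> 'k) option \<Rightarrow> real \<Rightarrow> real^(('k \<times> 'k) option) \<Rightarrow> real^(('k \<times> 'k) option)" where
  "path_system A s c x = (\<chi> z. case z of None \<Rightarrow> x $ s - c
     | Some (a, b) \<Rightarrow> ((path_D x - x $ None *\<^sub>R A) ** path_S x - mat 1) $ a $ b)"

text \<open>The exact divided difference of \<open>path_system\<close>: in the product rule the left
  factor is taken at \<open>x\<close> and the right one at \<open>y\<close>. It is linear in
  \<open>v\<close> and affine in \<open>x\<close>, as the Bezoutian argument requires, and it is the
  derivative when the two points coincide.\<close>

definition path_secant ::
    "real^'k^'k \<Rightarrow> ('k::finite \<times> 'k) option \<Rightarrow> real^(('k \<times> 'k) option) \<Rightarrow> real^(('k \<times> 'k) option) \<Rightarrow>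
      real^(('k \<times> 'k) option) \<Rightarrow> real^(('k \<times> 'k) option)" where
  "path_secant A s x y v = (\<chi> z. case z of None \<Rightarrow> v $ s
     | Some (a, b) \<Rightarrow> ((path_D x - x $ None *\<^sub>R A) ** path_N v + (path_D v - v $ None *\<^sub>R A) ** path_S y) $ a $ b)"

lemma path_linear:
  "path_N (x + y) = path_N x + path_N y" "path_N (r *\<^sub>R x) = r *\<^sub>R path_N x"
  "path_D (x + y) = path_D x + path_D y" "path_D (r *\<^sub>R x) = r *\<^sub>R path_D x"
  "path_D (x - y) = path_D x - path_D y" "path_N (x - y) = path_S x - path_S y"
  "path_D 0 = 0" "path_N 0 = 0"
  by (auto simp: path_N_def path_D_def path_S_def vec_eq_iff)

lemma linear_path_secant: "linear (path_secant A s x y)"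
  by (rule linearI)
     (auto simp: path_secant_def vec_eq_iff path_linear scaleR_add_left matrix_add_ldistrib matrix_scaleR_right matrix_scaleR_left
        matrix_diff_rdistrib matrix_diff_ldistrib algebra_simps matrix_add_rdistrib split: option.split)

lemma linear_path_secant_base: "linear (\<lambda>x. path_secant A s x y v $ z - path_secant A s 0 y v $ z)"
  by (rule linearI)
     (auto simp: path_secant_def path_linear scaleR_add_left matrix_scaleR_left
        matrix_diff_rdistrib algebra_simps matrix_add_rdistrib split: option.split)

lemma path_system_diff: "path_system A s c x - path_system A s c y = path_secant A s x y (x - y)"
  by (auto simp: path_system_def path_secant_def vec_eq_iff path_linear scaleR_diff_left matrix_scaleR_left
      matrix_add_rdistrib matrix_diff_rdistrib matrix_diff_ldistrib algebra_simps split: option.split)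

lemma finite_path_zeros:
  fixes A :: "real^'k^'k::finite"
  assumes "\<And>p. p \<in> Z \<Longrightarrow> path_system A s c p = 0"
    and "\<And>p v. p \<in> Z \<Longrightarrow> path_secant A s p p v = 0 \<Longrightarrow> v = 0"
  shows "finite Z"
proof (rule finite_nondegenerate_zeros[where B = "\<lambda>x y. matrix (path_secant A s x y)" and F = "path_system A s c"])
  have m: "matrix (path_secant A s x y) *v v = path_secant A s x y v" for x y v
    by (rule fun_cong[OF matrix_vector_mul(2)[OF linear_path_secant]])
  show "path_system A s c x - path_system A s c y = matrix (path_secant A s x y) *v (x - y)" for x y
    by (simp add: m path_system_diff)
  show "det (matrix (path_secant A s p p)) \<noteq> 0" if "p \<in> Z" for p
  proof -
    have "\<forall>v. matrix (path_secant A s p p) *v v = 0 \<longrightarrow> v = 0"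
      using assms(2)[OF that] by (simp only: m) blast
    then show ?thesis
      by (simp only: invertible_det_nz[symmetric] invertible_left_inverse matrix_left_invertible_ker)
  qed
  show "linear (\<lambda>x. matrix (path_secant A s x y) $ i $ j - matrix (path_secant A s 0 y) $ i $ j)" for y i j
    unfolding matrix_def using linear_path_secant_base by simp
qed (rule assms(1))

text \<open>\<open>S\<close> has trace k, so its form is at most k times the squared norm, and that
  of the inverse is at least 1/k times it; the bound is uniform in t. The factorisation of
  \<open>S\<close> and Cauchy-Schwarz take the place of eigenvalues.\<close>

lemma optimal_pair_lower_bound:
  fixes A :: "real^'k^'k::finite"
  assumes op: "optimal_pair A t S Q"
  shows "1 / real CARD('k) * (v \<bullet> v) \<le> v \<bullet> (Q *v v)"
proof -
  have pS: "positive_semidefinite S" and symS: "transpose S = S" and SQ: "S ** Q = mat 1"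
    using op by (auto simp: optimal_pair_def positive_definite_imp_semidefinite) (simp add: positive_definite_def)
  obtain V where V: "S = transpose V ** (V :: real^'k^'k)" using positive_semidefinite_factor[OF pS] .
  have "(norm V)\<^sup>2 = trace S" by (simp add: V trace_mult_eq_inner power2_norm_eq_inner)
  also have "\<dots> = real CARD('k)" using op by (simp add: trace_def optimal_pair_def)
  finally have nV: "(norm V)\<^sup>2 = real CARD('k)" .
  define w where "w = Q *v v"
  have form: "a \<bullet> (S *v b) = (V *v a) \<bullet> (V *v b)" for a b
    unfolding V by (metis dot_lmul_matrix matrix_vector_mul_assoc transpose_matrix_vector inner_commute)
  have Sw: "S *v w = v" by (simp add: w_def matrix_vector_mul_assoc SQ)
  have "v \<bullet> v = (V *v v) \<bullet> (V *v w)" using form[of v w] Sw by simp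
  then have "(v \<bullet> v)\<^sup>2 \<le> ((V *v v) \<bullet> (V *v v)) * ((V *v w) \<bullet> (V *v w))" by (simp add: Cauchy_Schwarz_ineq)
  also have "(V *v w) \<bullet> (V *v w) = v \<bullet> (Q *v v)" using form[of w w] Sw by (simp add: w_def inner_commute)
  also have "(V *v v) \<bullet> (V *v v) \<le> real CARD('k) * (v \<bullet> v)"
  proof -
    have "(norm (V *v v))\<^sup>2 \<le> real CARD('k) * (norm v)\<^sup>2"
      using power_mono[OF norm_matrix_vector_mult_le[of V v], of 2] unfolding power_mult_distrib nV by simp
    then show ?thesis by (simp add: power2_norm_eq_inner)
  qed
  finally have "(v \<bullet> v) * (v \<bullet> v) \<le> (v \<bullet> v) * (real CARD('k) * (v \<bullet> (Q *v v)))"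
    using op positive_definite_imp_semidefinite[of Q]
    by (simp add: optimal_pair_def positive_semidefinite_def power2_eq_square mult_right_mono mult_ac)
  then have "v = 0 \<or> v \<bullet> v \<le> real CARD('k) * (v \<bullet> (Q *v v))"
    by (metis inner_gt_zero_iff mult_le_cancel_left_pos)
  then show ?thesis by (auto simp: field_simps)
qed

text \<open>Pairing the difference of the optimality conditions with N = S - S', whose diagonal
  vanishes, gives \<open>(Q - Q') \<bullet> N = - (s - t) * (A \<bullet> N)\<close>. By the
  resolvent identity the left side is the negative of a quantity that is at least
  \<open>(norm N)\<^sup>2\<close> divided by k^2.\<close>

lemma optimal_pair_Lipschitz:
  fixes A :: "real^'k^'k::finite"
  assumes s: "optimal_pair A s S Q" and t: "optimal_pair A t S' Q'"
  shows "norm (S - S') \<le> (real CARD('k))\<^sup>2 * norm A * \<bar>s - t\<bar>"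
proof -
  define N where "N = S - S'"
  have N: "transpose N = N" using s t by (simp add: N_def transpose_def vec_eq_iff optimal_pair_def positive_definite_def)
  have sym: "transpose Q = Q" "transpose Q' = Q'" using s t by (auto simp: optimal_pair_def positive_definite_def)
  have "Q - Q' = Q ** (S' - S) ** Q'"
    using s t by (intro inverse_difference) (auto simp: optimal_pair_def)
  then have d: "Q - Q' = - (Q ** N ** Q')"
    by (simp add: N_def matrix_diff_ldistrib matrix_diff_rdistrib)
  have "(Q - Q') \<bullet> N = - (s - t) * (A \<bullet> N)"
  proof -
    have "(Q - Q') $ i $ j * N $ i $ j = - (s - t) * (A $ i $ j * N $ i $ j)" for i j
      using s t by (cases "i = j") (simp_all add: optimal_pair_def N_def algebra_simps)
    then show ?thesis unfolding inner_matrix_eq sum_distrib_left by (intro sum.cong refl)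
  qed
  moreover have "(Q - Q') \<bullet> N = - ((Q ** N ** Q') \<bullet> N)" by (simp add: d)
  ultimately have "(s - t) * (A \<bullet> N) = (Q ** N ** Q') \<bullet> N" by linarith
  also have "\<dots> = (N ** Q ** N) \<bullet> Q'"
    using inner_mult_left[of "N ** Q" N Q'] N sym by (simp add: matrix_transpose_mul inner_commute)
  finally have "(s - t) * (A \<bullet> N) = (N ** Q ** N) \<bullet> Q'" .
  moreover have "1 / real CARD('k) * (1 / real CARD('k)) * (norm N)\<^sup>2 \<le> (N ** Q ** N) \<bullet> Q'"
    by (rule inner_conjugate_lower_bound[OF N sym(1) optimal_pair_lower_bound[OF s] _ sym(2) optimal_pair_lower_bound[OF t]]) auto
  moreover have "(s - t) * (A \<bullet> N) \<le> \<bar>s - t\<bar> * (norm A * norm N)"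
  proof -
    have "(s - t) * (A \<bullet> N) \<le> \<bar>s - t\<bar> * \<bar>A \<bullet> N\<bar>" by (simp flip: abs_mult)
    also have "\<dots> \<le> \<bar>s - t\<bar> * (norm A * norm N)"
      by (intro mult_left_mono Cauchy_Schwarz_ineq2) simp
    finally show ?thesis .
  qed
  ultimately have "(norm N)\<^sup>2 / (real CARD('k))\<^sup>2 \<le> \<bar>s - t\<bar> * (norm A * norm N)"
    by (simp add: power2_eq_square)
  then have "norm N * norm N \<le> norm N * ((real CARD('k))\<^sup>2 * norm A * \<bar>s - t\<bar>)"
    by (simp add: field_simps power2_eq_square)
  then have "norm N \<le> (real CARD('k))\<^sup>2 * norm A * \<bar>s - t\<bar>"
    by (cases "norm N = 0") (auto simp: mult_le_cancel_left)
  then show ?thesis by (simp add: N_def)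
qed

section \<open>Nondegeneracy and differentiability of the path\<close>

definition path_point :: "real^'k^'k \<Rightarrow> real \<Rightarrow> real^'k^'k \<Rightarrow> real^'k^'k \<Rightarrow> real^(('k::finite \<times> 'k) option)" where
  "path_point A t S Q = (\<chi> z. case z of None \<Rightarrow> t | Some (a, b) \<Rightarrow> if a = b then (Q + t *\<^sub>R A) $ a $ a else S $ a $ b)"

lemma path_point:
  fixes A :: "real^'k^'k::finite"
  assumes op: "optimal_pair A t S Q"
  shows "path_S (path_point A t S Q) = S" "path_D (path_point A t S Q) - t *\<^sub>R A = Q"
    "path_point A t S Q $ None = t"
    "a \<noteq> b \<Longrightarrow> path_point A t S Q $ Some (a, b) = S $ a $ b"
proof -
  have "S $ i $ i = 1" "i \<noteq> j \<Longrightarrow> Q $ i $ j = - (t * A $ i $ j)" for i j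
    using op by (simp_all add: optimal_pair_def)
  then have *: "(if i = j then 1 else S $ i $ j) = S $ i $ j"
     "(if i = j then Q $ i $ i + t * A $ i $ i else 0) - t * A $ i $ j = Q $ i $ j" for i j
    by simp_all
  show "path_S (path_point A t S Q) = S" "path_D (path_point A t S Q) - t *\<^sub>R A = Q"
    unfolding vec_eq_iff using * by (simp_all add: path_S_def path_D_def path_point_def cong: if_cong)
qed (simp_all add: path_point_def)

lemma path_system_path_point:
  assumes "optimal_pair A t S Q" "path_point A t S Q $ s = c"
  shows "path_system A s c (path_point A t S Q) = 0"
proof -
  have "Q ** S = mat 1" using assms(1) by (simp add: optimal_pair_def)
  then show ?thesis
    unfolding vec_eq_iff by (simp add: path_system_def assms(2) path_point[OF assms(1)] split: option.split)
qed

text \<open>At fixed t the linearised equations read Q N + D S = 0, hence Q N Q = - D. As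
  \<open>N\<close> has zero diagonal and \<open>D\<close> is diagonal, N is orthogonal to Q N Q, and
  coercivity leaves N = 0 and then D = 0.\<close>

lemma path_secant_nondegenerate:
  fixes A :: "real^'k^'k::finite"
  assumes op: "optimal_pair A t S Q"
    and v: "path_secant A None (path_point A t S Q) (path_point A t S Q) v = 0"
  shows "v = 0"
proof -
  define N where "N = path_N v"
  define D where "D = path_D v"
  have Q: "transpose Q = Q" and S: "transpose S = S" and SQ: "S ** Q = mat 1" "Q ** S = mat 1" and pdQ: "positive_definite Q"
    using op by (auto simp: optimal_pair_def positive_definite_def)
  have 0: "path_secant A None (path_point A t S Q) (path_point A t S Q) v $ z = 0" for z by (simp add: v)
  have v0: "v $ None = 0" using 0[of None] by (simp add: path_secant_def)
  have "(Q ** N + D ** S) $ a $ b = 0" for a b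
    using 0[of "Some (a, b)"] by (simp add: path_secant_def path_point[OF op] N_def D_def v0)
  then have eq: "Q ** N + D ** S = 0" by (simp add: vec_eq_iff)
  have z: "M ** 0 = 0" "0 ** M = 0" for M :: "real^'k^'k"
    by (simp_all add: vec_eq_iff matrix_matrix_mult_def)
  have "S ** (Q ** N + D ** S) = 0" by (simp only: eq z)
  then have "N + S ** D ** S = 0" by (simp add: matrix_add_ldistrib matrix_mul_assoc SQ)
  \<comment> \<open>The symmetry of \<open>N\<close>, which the coordinates do not guarantee, is
    read off from this formula.\<close>
  then have NS: "N = - (S ** D ** S)" by (rule eq_neg_iff_add_eq_0[THEN iffD2])
  have "transpose D = D" by (auto simp: D_def path_D_def transpose_def vec_eq_iff)
  then have "transpose (S ** D ** S) = S ** D ** S" by (simp add: matrix_transpose_mul S matrix_mul_assoc)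
  then have N: "transpose N = N" unfolding NS by (simp add: transpose_def vec_eq_iff)
  have "(Q ** N + D ** S) ** Q = 0" by (simp only: eq z)
  then have "Q ** N ** Q + D = 0"
    by (simp add: matrix_add_rdistrib SQ flip: matrix_mul_assoc[of D])
  then have QNQ: "Q ** N ** Q = - D" by (rule eq_neg_iff_add_eq_0[THEN iffD2])
  moreover have "(N ** Q ** N) \<bullet> Q = N \<bullet> (Q ** N ** Q)"
    using inner_mult_left[of "N ** Q" N Q] N Q by (simp add: matrix_transpose_mul)
  moreover have "N \<bullet> D = 0"
    unfolding inner_matrix_eq by (intro sum.neutral ballI) (auto simp: N_def D_def path_N_def path_D_def)
  ultimately have "(N ** Q ** N) \<bullet> Q = 0" by (simp only: QNQ) simp
  moreover obtain l where l: "l > 0" "\<And>v. l * (v \<bullet> v) \<le> v \<bullet> (Q *v v)"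
    using positive_definite_lower_bound[OF pdQ] by blast
  moreover have "l * l * (norm N)\<^sup>2 \<le> (N ** Q ** N) \<bullet> Q"
    by (rule inner_conjugate_lower_bound[OF N Q l(2) _ Q l(2)]) (use l(1) in simp_all)
  ultimately have "l * l * (norm N)\<^sup>2 \<le> 0" by (simp only:)
  then have N0: "N = 0" using l(1) by (simp add: mult_le_0_iff power2_eq_square)
  then have D0: "D = 0" using QNQ by (simp add: z)
  show "v = 0"
  proof (simp only: vec_eq_iff zero_index, rule allI)
    fix z show "v $ z = 0"
    proof (cases z)
      case (Some ab)
      then obtain a b where "z = Some (a, b)" by (cases ab) auto
      moreover have "v $ Some (a, b) = N $ a $ b + D $ a $ b"
        by (simp add: N_def D_def path_N_def path_D_def)
      ultimately show ?thesis by (simp add: N0 D0)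
    qed (simp add: v0)
  qed
qed

text \<open>An implicit-function argument made explicit: by the secant identity X t - X s solves a
  linear system with matrix \<open>M s\<close> exactly, so Cramer's rule expresses the difference
  quotient, and its limit exists because det (M t) is nonzero.\<close>

lemma optimal_path_derivative:
  fixes A :: "real^'k^'k::finite"
  assumes op: "\<And>t. optimal_pair A t (S t) (Q t)"
  defines "X \<equiv> \<lambda>t. path_point A t (S t) (Q t)"
  obtains x' where "path_secant A None (X t) (X t) x' = axis None 1"
    "\<And>z. ((\<lambda>s. X s $ z) has_real_derivative x' $ z) (at t)"
proof -
  define M where "M s = matrix (path_secant A None (X t) (X s))" for s
  have Mv: "M s *v v = path_secant A None (X t) (X s) v" for s v
    unfolding M_def by (rule fun_cong[OF matrix_vector_mul(2)[OF linear_path_secant]])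
  \<comment> \<open>The moving point enters the secant matrix only through \<open>path_S\<close>, so
    continuity of S suffices for the convergence of \<open>M s\<close>.\<close>
  have limS: "(S \<longlongrightarrow> S t) (at t)"
  proof -
    have "((\<lambda>s. (real CARD('k))\<^sup>2 * norm A * \<bar>s - t\<bar>) \<longlongrightarrow> (real CARD('k))\<^sup>2 * norm A * \<bar>t - t\<bar>) (at t)"
      by (intro tendsto_intros)
    then have "((\<lambda>s. (real CARD('k))\<^sup>2 * norm A * \<bar>s - t\<bar>) \<longlongrightarrow> 0) (at t)" by simp
    then have "((\<lambda>s. S s - S t) \<longlongrightarrow> 0) (at t)"
      by (rule Lim_null_comparison[OF always_eventually, rotated]) (use optimal_pair_Lipschitz[OF op op] in blast)
    then show ?thesis by (rule LIM_zero_cancel)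
  qed
  have limM: "((\<lambda>s. M s $ i $ j) \<longlongrightarrow> M t $ i $ j) (at t)" for i j
  proof (cases i)
    case None
    then show ?thesis by (simp add: M_def matrix_def path_secant_def)
  next
    case (Some ab)
    have "path_S (X s) = S s" for s unfolding X_def by (rule path_point(1)[OF op])
    then show ?thesis
      by (cases ab) (auto simp: Some M_def matrix_def path_secant_def matrix_matrix_mult_def intro!: tendsto_intros limS)
  qed
  have limdet: "((\<lambda>s. det (M s)) \<longlongrightarrow> det (M t)) (at t)"
    unfolding det_def by (intro tendsto_intros limM)
  have detM: "det (M t) \<noteq> 0"
  proof -
    have "\<forall>v. M t *v v = 0 \<longrightarrow> v = 0"
      using path_secant_nondegenerate[OF op, of t] unfolding Mv X_def by blast
    then show ?thesis
      by (simp only: invertible_det_nz[symmetric] invertible_left_inverse matrix_left_invertible_ker)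
  qed
  define e :: "real^(('k \<times> 'k) option)" where "e = axis None 1"
  define u where "u s = (\<chi> k. det (\<chi> i j. if j = k then e $ i else M s $ i $ j) / det (M s))" for s
  have limu: "((\<lambda>s. u s $ z) \<longlongrightarrow> u t $ z) (at t)" for z
  proof -
    have "((\<lambda>s. (\<chi> i j. if j = z then e $ i else M s $ i $ j) $ i $ j) \<longlongrightarrow>
        (\<chi> i j. if j = z then e $ i else M t $ i $ j) $ i $ j) (at t)" for i j
      using limM[of i j] by (cases "j = z") auto
    then have "((\<lambda>s. det (\<chi> i j. if j = z then e $ i else M s $ i $ j)) \<longlongrightarrow>
        det (\<chi> i j. if j = z then e $ i else M t $ i $ j)) (at t)"
      unfolding det_def by (intro tendsto_sum tendsto_mult tendsto_const tendsto_prod)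
    then show ?thesis
      unfolding u_def using limdet detM by (simp add: tendsto_divide)
  qed
  have quot: "(X s $ z - X t $ z) / (s - t) = u s $ z" if "s \<noteq> t" "det (M s) \<noteq> 0" for s z
  proof -
    have "path_system A None t (X t) = 0" "path_system A None s (X s) = 0"
      unfolding X_def by (auto intro!: path_system_path_point[OF op] path_point(3)[OF op])
    \<comment> \<open>Changing the prescribed value of t affects the \<open>None\<close> component
      alone.\<close>
    moreover have "path_system A None t (X s) - path_system A None s (X s) = (s - t) *\<^sub>R e"
      by (auto simp: path_system_def vec_eq_iff e_def axis_def split: option.split)
    moreover have "path_system A None t (X t) - path_system A None t (X s) = M s *v (X t - X s)"
      by (simp add: path_system_diff Mv)
    ultimately have "M s *v (X t - X s) = - ((s - t) *\<^sub>R e)" by simp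
    then have "M s *v ((1 / (t - s)) *\<^sub>R (X t - X s)) = (1 / (t - s)) *\<^sub>R (t - s) *\<^sub>R e"
      by (simp only: matrix_vector_mult_scaleR) (simp add: algebra_simps)
    also have "\<dots> = e" using that(1) by simp
    finally have "M s *v ((1 / (t - s)) *\<^sub>R (X t - X s)) = e" .
    then have "(1 / (t - s)) *\<^sub>R (X t - X s) = u s"
      unfolding u_def by (rule cramer[OF that(2), THEN iffD1])
    then have "u s $ z = (1 / (t - s)) * (X t $ z - X s $ z)" by (simp add: vec_eq_iff)
    also have "\<dots> = (X s $ z - X t $ z) / (s - t)"
      using that(1) by (simp add: divide_simps) (simp add: algebra_simps)
    finally show ?thesis by simp
  qed
  show ?thesis
  proof
    have "M t *v u t = e" unfolding u_def by (rule cramer[OF detM, THEN iffD2]) simp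
    then show "path_secant A None (X t) (X t) (u t) = axis None 1" by (simp add: Mv e_def)
    fix z
    have "eventually (\<lambda>s. det (M s) \<noteq> 0) (at t)"
      by (rule tendsto_imp_eventually_ne[OF limdet detM])
    then have "eventually (\<lambda>s. u s $ z = (X s $ z - X t $ z) / (s - t)) (at t)"
      using eventually_neq_at_within[of t t UNIV] by eventually_elim (simp add: quot)
    then show "((\<lambda>s. X s $ z) has_real_derivative u t $ z) (at t)"
      unfolding has_field_derivative_iff by (rule Lim_transform_eventually[OF limu])
  qed
qed

text \<open>Sard's theorem in dimension one, transported to \<open>real^1\<close> because
  \<open>baby_Sard\<close> speaks of vectors: the critical values form a negligible set, which
  cannot contain an interval.\<close>

lemma regular_value_between:
  fixes g g' :: "real \<Rightarrow> real"
  assumes der: "\<And>t. (g has_real_derivative g' t) (at t)" and "lo < hi"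
  obtains c where "lo < c" "c < hi" "\<And>t. g t = c \<Longrightarrow> g' t \<noteq> 0"
proof -
  define f :: "real^1 \<Rightarrow> real^1" where "f x = (\<chi> i. g (x $ 1))" for x
  define C :: "(real^1) set" where "C = {x. g' (x $ 1) = 0}"
  have "negligible (f ` C)"
  proof (rule baby_Sard[where f' = "\<lambda>x. \<lambda>h. 0"])
    fix x :: "real^1" assume "x \<in> C"
    have v: "vec (z $ 1) = z" for z :: "real^1" by (simp add: vec_eq_iff)
    then have r: "range (vec :: real \<Rightarrow> real^1) = UNIV" by (rule surjI[where f = "\<lambda>z. z $ 1"])
    have "(g has_derivative (\<lambda>z. z * (\<lambda>t. 0) (x $ 1))) (at (x $ 1))"
      using der[of "x $ 1"] \<open>x \<in> C\<close> by (simp add: C_def has_field_derivative_def lambda_zero)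
    from has_derivative_vector_1[OF this]
    have "((\<lambda>x. vec (g (x $ 1))) has_derivative (*\<^sub>R) 0) (at x)" by (simp only: r v)
    moreover have "f = (\<lambda>x. vec (g (x $ 1)))" by (simp add: f_def fun_eq_iff vec_eq_iff)
    moreover have "(*\<^sub>R) (0::real) = (\<lambda>h::real^1. 0)" by (simp add: fun_eq_iff)
    ultimately show "(f has_derivative (\<lambda>h. 0)) (at x within C)"
      by (simp add: has_derivative_at_withinI)
    have "matrix (\<lambda>h::real^1. 0::real^1) = 0" by (simp add: matrix_def vec_eq_iff)
    then show "rank (matrix (\<lambda>h. 0) :: real^1^1) < CARD(1)" by simp
  qed simp
  moreover have "\<not> negligible (box (vec lo) (vec hi) :: (real^1) set)"
    using \<open>lo < hi\<close> by (simp add: negligible_interval interval_eq_empty_cart not_le)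
  ultimately have "\<not> box (vec lo) (vec hi) \<subseteq> f ` C" using negligible_subset by blast
  then obtain y where y: "y \<in> box (vec lo) (vec hi)" "y \<notin> f ` C" by blast
  have "g' t \<noteq> 0" if "g t = y $ 1" for t
  proof
    assume "g' t = 0"
    then have "vec t \<in> C" by (simp add: C_def)
    moreover have "f (vec t) = y" using that by (simp add: f_def vec_eq_iff)
    ultimately show False using y(2) by blast
  qed
  then show ?thesis using y(1) by (intro that[of "y $ 1"]) (auto simp: mem_box_cart)
qed

text \<open>\<open>L\<close> is the limit superior, and \<open>osc\<close> excludes a smaller limit
  inferior.\<close>

lemma convergent_at_top_if_no_oscillation:
  fixes g :: "real \<Rightarrow> real"
  assumes bdd: "\<And>t. \<bar>g t\<bar> \<le> K"
    and osc: "\<And>lo hi. lo < hi \<Longrightarrow> frequently (\<lambda>t. g t < lo) at_top \<Longrightarrow> frequently (\<lambda>t. hi < g t) at_top \<Longrightarrow> False"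
  obtains L where "(g \<longlongrightarrow> L) at_top"
proof -
  define U where "U = {c. eventually (\<lambda>t. g t \<le> c) at_top}"
  have KU: "K \<in> U" using bdd by (auto simp: U_def abs_le_iff)
  have low: "- K \<le> c" if "c \<in> U" for c
  proof -
    have "eventually (\<lambda>t. g t \<le> c) at_top" using that by (simp add: U_def)
    then obtain t where "g t \<le> c" using eventually_happens'[OF trivial_limit_at_top_linorder] by blast
    then show ?thesis using bdd[of t] by linarith
  qed
  have bb: "bdd_below U" using low by (auto simp: bdd_below_def)
  define L where "L = Inf U"
  have up: "eventually (\<lambda>t. g t < a) at_top" if "L < a" for a
  proof -
    have "\<exists>c\<in>U. c < a" using that KU by (intro cInf_lessD) (auto simp: L_def)
    then obtain c where "c \<in> U" "c < a" by blast
    then show ?thesis by (auto simp: U_def elim!: eventually_mono)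
  qed
  have lo: "eventually (\<lambda>t. a < g t) at_top" if "a < L" for a
  proof -
    \<comment> \<open>Two levels between \<open>a\<close> and \<open>L\<close>: values above
      \<open>d\<close> recur because \<open>d\<close> lies below the limit superior, so values below
      \<open>b\<close> eventually stop.\<close>
    define b d where "b = a + (L - a) / 3" and "d = a + 2 * (L - a) / 3"
    have o: "a < b" "b < d" "d < L" using that by (auto simp: b_def d_def field_simps)
    have "d \<notin> U" using o(3) cInf_lower[OF _ bb, of d] by (auto simp: L_def)
    then have "frequently (\<lambda>t. d < g t) at_top" by (simp add: U_def frequently_def not_less)
    then have "\<not> frequently (\<lambda>t. g t < b) at_top" using osc[OF o(2)] by blast
    then have "eventually (\<lambda>t. b \<le> g t) at_top" by (simp add: frequently_def not_less)
    then show ?thesis using o(1) by (auto elim!: eventually_mono)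
  qed
  have "(g \<longlongrightarrow> L) at_top" by (rule order_tendstoI) (use up lo in auto)
  then show ?thesis by (rule that)
qed

lemma optimal_path_converges:
  fixes A :: "real^'k^'k::finite"
  assumes op: "\<And>t. optimal_pair A t (S t) (Q t)"
  obtains L where "(S \<longlongrightarrow> L) at_top"
proof -
  define X where "X t = path_point A t (S t) (Q t)" for t
  have "\<exists>L. ((\<lambda>t. S t $ i $ j) \<longlongrightarrow> L) at_top" for i j
  proof (cases "i = j")
    case True
    have "(\<lambda>t. S t $ i $ j) = (\<lambda>t. 1)" using op True by (simp add: optimal_pair_def)
    then show ?thesis using tendsto_const by metis
  next
    case False
    define s where "s = Some (i, j)"
    define g where "g t = S t $ i $ j" for t
    have gX: "g t = X t $ s" for t using path_point(4)[OF op False] by (simp add: g_def X_def s_def)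
    have "\<forall>t. \<exists>x'. path_secant A None (X t) (X t) x' = axis None 1 \<and>
        (\<forall>z. ((\<lambda>s. X s $ z) has_real_derivative x' $ z) (at t))"
      unfolding X_def by (rule allI, rule optimal_path_derivative[OF op]) blast
    from choice[OF this] obtain x' where x': "\<And>t. path_secant A None (X t) (X t) (x' t) = axis None 1"
      "\<And>t z. ((\<lambda>s. X s $ z) has_real_derivative x' t $ z) (at t)" by blast
    have der: "(g has_real_derivative x' t $ s) (at t)" for t
      using x'(2)[of s t] by (simp add: gX[abs_def])
    have cont: "continuous_on I g" for I
      using DERIV_isCont[OF der] by (simp add: continuous_at_imp_continuous_on)
    have fin: "finite {t. g t = c \<and> x' t $ s \<noteq> 0}" for c
    proof -
      \<comment> \<open>Points of the path where \<open>g = c\<close> and the derivative of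
        \<open>g\<close> is nonzero are nondegenerate zeros of the system that prescribes the
        coordinate \<open>s\<close> instead of t.\<close>
      have "finite (X ` {t. g t = c \<and> x' t $ s \<noteq> 0})"
      proof (rule finite_path_zeros[where A = A and s = s and c = c])
        fix p assume "p \<in> X ` {t. g t = c \<and> x' t $ s \<noteq> 0}"
        then obtain t where t: "p = X t" "g t = c" "x' t $ s \<noteq> 0" by blast
        show "path_system A s c p = 0"
          unfolding t(1) X_def by (rule path_system_path_point[OF op]) (use t gX in \<open>simp add: X_def\<close>)
        fix v assume v: "path_secant A s p p v = 0"
        have vs: "v $ s = 0" using arg_cong[OF v, of "\<lambda>w. w $ None"] by (simp add: path_secant_def)
        \<comment> \<open>A kernel vector satisfies all linearised equations except the one for t,
          so it is a multiple of the tangent \<open>x' t\<close>; its vanishing component at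
          \<open>s\<close> then makes the multiple zero.\<close>
        have "path_secant A None p p v $ z = (v $ None *\<^sub>R axis None 1) $ z" for z
          using arg_cong[OF v, of "\<lambda>w. w $ z"]
          by (cases z) (auto simp: path_secant_def axis_def split: prod.splits)
        then have "path_secant A None p p v = v $ None *\<^sub>R path_secant A None p p (x' t)"
          unfolding t(1) x'(1)[of t] by (simp add: vec_eq_iff)
        then have "path_secant A None p p (v - v $ None *\<^sub>R x' t) = 0"
          by (simp only: linear_diff[OF linear_path_secant] linear_scale[OF linear_path_secant]) simp
        then have "v - v $ None *\<^sub>R x' t = 0"
          using path_secant_nondegenerate[OF op, of t] unfolding t(1) X_def by blast
        then have v': "v = v $ None *\<^sub>R x' t" by simp
        have "v $ s = v $ None * x' t $ s" using arg_cong[OF v', of "\<lambda>w. w $ s"] by simp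
        then have "v $ None = 0" using vs t(3) by simp
        then show "v = 0" using v' by simp
      qed
      moreover have "inj X"
      proof (rule injI)
        fix t t' assume "X t = X t'"
        moreover have "X t $ None = t" for t unfolding X_def by (rule path_point(3)[OF op])
        ultimately show "t = t'" by metis
      qed
      ultimately show ?thesis by (meson finite_imageD inj_on_subset subset_UNIV)
    qed
    show ?thesis
    proof (rule convergent_at_top_if_no_oscillation[of g 1])
      show "\<bar>g t\<bar> \<le> 1" for t
        unfolding g_def by (rule sdp_feasible_entry_le[OF optimal_pair_feasible[OF op]])
      fix lo hi :: real
      assume "lo < hi" and f: "frequently (\<lambda>t. g t < lo) at_top" "frequently (\<lambda>t. hi < g t) at_top"
      obtain c where c: "lo < c" "c < hi" "\<And>t. g t = c \<Longrightarrow> x' t $ s \<noteq> 0"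
        using regular_value_between[OF der \<open>lo < hi\<close>] by blast
      have "finite {t. g t = c}" by (rule finite_subset[OF _ fin[of c]]) (use c(3) in blast)
      then obtain T where T: "\<And>t. g t = c \<Longrightarrow> t \<le> T"
        using bdd_above_finite[of "{t. g t = c}"] by (auto simp: bdd_above_def)
      obtain a where a: "a > T" "g a < lo"
        using f(1) unfolding frequently_def eventually_at_top_dense by blast
      obtain b where b: "b > T" "hi < g b"
        using f(2) unfolding frequently_def eventually_at_top_dense by blast
      \<comment> \<open>Beyond \<open>T\<close> there are values on both sides of \<open>c\<close>,
        hence a crossing after \<open>T\<close>, although \<open>T\<close> bounds all
        crossings.\<close>
      have "\<exists>t. t > T \<and> g t = c"
      proof (cases "a \<le> b")
        case True
        then obtain t where "a \<le> t" "g t = c" using IVT'[of g a c b] a b c cont by auto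
        then show ?thesis using a by (intro exI[of _ t]) simp
      next
        case False
        then obtain t where "b \<le> t" "g t = c" using IVT2'[of g a c b] a b c cont by auto
        then show ?thesis using b by (intro exI[of _ t]) simp
      qed
      then show False using T by force
    qed (auto simp: g_def[abs_def])
  qed
  then have "\<forall>i. \<exists>L. \<forall>j. ((\<lambda>t. S t $ i $ j) \<longlongrightarrow> L j) at_top" by (intro allI choice)
  from choice[OF this] obtain L where L: "\<And>i j. ((\<lambda>t. S t $ i $ j) \<longlongrightarrow> L i j) at_top" by blast
  have "(S \<longlongrightarrow> (\<chi> i j. L i j)) at_top"
    by (intro vec_tendstoI) (simp add: L)
  then show ?thesis by (rule that)
qed

section \<open>Polar decomposition of Lebesgue measure\<close>

lemma ennreal_mult_divide_cancel: "c \<noteq> 0 \<Longrightarrow> c \<noteq> \<infinity> \<Longrightarrow> c * (x / c) = (x :: ennreal)"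
  by (simp add: ennreal_times_divide ennreal_mult_divide_eq mult.commute[of c])

abbreviation vec_lborel :: "nat \<Rightarrow> (nat \<Rightarrow> real) measure" where
  "vec_lborel n \<equiv> \<Pi>\<^sub>M l\<in>{..<n}. lborel"

abbreviation conf_lborel :: "nat \<Rightarrow> ('k::finite \<Rightarrow> nat \<Rightarrow> real) measure" where
  "conf_lborel n \<equiv> \<Pi>\<^sub>M i\<in>UNIV. vec_lborel n"

lemma sets_vec_lborel: "sets (vec_lborel n) = sets (\<Pi>\<^sub>M l\<in>{..<n}. borel)"
  by (intro sets_PiM_cong) auto

lemma sets_conf_lborel:
  "sets (conf_lborel n :: ('k::finite \<Rightarrow> nat \<Rightarrow> real) measure) = sets (\<Pi>\<^sub>M i\<in>UNIV. \<Pi>\<^sub>M l\<in>{..<n}. borel)"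
  by (intro sets_PiM_cong) (auto simp: sets_vec_lborel)

lemma sigma_finite_vec_lborel: "sigma_finite_measure (vec_lborel n)"
proof -
  interpret product_sigma_finite "\<lambda>_. lborel :: real measure" by standard
  show ?thesis by (rule sigma_finite) simp
qed

section \<open>Product measures under maps, densities, shifts and scalings\<close>

lemma distr_PiM_map:
  assumes I: "finite I"
    and M: "\<And>i. sigma_finite_measure (M i)"
    and f[measurable]: "\<And>i. f i \<in> M i \<rightarrow>\<^sub>M N i"
    and D: "\<And>i. sigma_finite_measure (distr (M i) (N i) (f i))"
  shows "distr (Pi\<^sub>M I M) (Pi\<^sub>M I N) (\<lambda>x. \<lambda>i\<in>I. f i (x i)) = (\<Pi>\<^sub>M i\<in>I. distr (M i) (N i) (f i))"
proof -
  interpret M: product_sigma_finite M using M by (simp add: product_sigma_finite_def)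
  interpret D: product_sigma_finite "\<lambda>i. distr (M i) (N i) (f i)" using D by (simp add: product_sigma_finite_def)
  have meas: "(\<lambda>x. \<lambda>i\<in>I. f i (x i)) \<in> Pi\<^sub>M I M \<rightarrow>\<^sub>M Pi\<^sub>M I N" by measurable
  show ?thesis
  proof (rule D.PiM_eqI[OF I])
    show "sets (distr (Pi\<^sub>M I M) (Pi\<^sub>M I N) (\<lambda>x. \<lambda>i\<in>I. f i (x i))) = sets (\<Pi>\<^sub>M i\<in>I. distr (M i) (N i) (f i))"
      by (simp cong: sets_PiM_cong)
    fix A assume A: "\<And>i. i \<in> I \<Longrightarrow> A i \<in> sets (distr (M i) (N i) (f i))"
    have "emeasure (distr (Pi\<^sub>M I M) (Pi\<^sub>M I N) (\<lambda>x. \<lambda>i\<in>I. f i (x i))) (Pi\<^sub>E I A)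
       = emeasure (Pi\<^sub>M I M) ((\<lambda>x. \<lambda>i\<in>I. f i (x i)) -` Pi\<^sub>E I A \<inter> space (Pi\<^sub>M I M))"
      using A I by (intro emeasure_distr meas sets_PiM_I_finite) auto
    also have "(\<lambda>x. \<lambda>i\<in>I. f i (x i)) -` Pi\<^sub>E I A \<inter> space (Pi\<^sub>M I M) = (\<Pi>\<^sub>E i\<in>I. f i -` A i \<inter> space (M i))"
      by (auto simp: space_PiM PiE_iff)
    also have "emeasure (Pi\<^sub>M I M) \<dots> = (\<Prod>i\<in>I. emeasure (M i) (f i -` A i \<inter> space (M i)))"
      using A I by (intro M.emeasure_PiM) (auto intro!: measurable_sets[OF f])
    also have "\<dots> = (\<Prod>i\<in>I. emeasure (distr (M i) (N i) (f i)) (A i))"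
      using A by (intro prod.cong refl emeasure_distr[symmetric] f) auto
    finally show "emeasure (distr (Pi\<^sub>M I M) (Pi\<^sub>M I N) (\<lambda>x. \<lambda>i\<in>I. f i (x i))) (Pi\<^sub>E I A)
       = (\<Prod>i\<in>I. emeasure (distr (M i) (N i) (f i)) (A i))" .
  qed
qed

lemma density_PiM:
  assumes I: "finite I"
    and M: "\<And>i. sigma_finite_measure (M i)"
    and f[measurable]: "\<And>i. f i \<in> borel_measurable (M i)"
    and D: "\<And>i. sigma_finite_measure (density (M i) (f i))"
  shows "density (Pi\<^sub>M I M) (\<lambda>x. \<Prod>i\<in>I. f i (x i)) = (\<Pi>\<^sub>M i\<in>I. density (M i) (f i))"
proof -
  interpret M: product_sigma_finite M using M by (simp add: product_sigma_finite_def)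
  interpret D: product_sigma_finite "\<lambda>i. density (M i) (f i)" using D by (simp add: product_sigma_finite_def)
  have meas[measurable]: "(\<lambda>x. \<Prod>i\<in>I. f i (x i)) \<in> borel_measurable (Pi\<^sub>M I M)"
    by (intro borel_measurable_prod_ennreal) measurable
  show ?thesis
  proof (rule D.PiM_eqI[OF I])
    show "sets (density (Pi\<^sub>M I M) (\<lambda>x. \<Prod>i\<in>I. f i (x i))) = sets (\<Pi>\<^sub>M i\<in>I. density (M i) (f i))"
      by (simp cong: sets_PiM_cong)
    fix A assume "\<And>i. i \<in> I \<Longrightarrow> A i \<in> sets (density (M i) (f i))"
    then have A[measurable]: "\<And>i. i \<in> I \<Longrightarrow> A i \<in> sets (M i)" by simp
    have "emeasure (density (Pi\<^sub>M I M) (\<lambda>x. \<Prod>i\<in>I. f i (x i))) (Pi\<^sub>E I A)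
      = (\<integral>\<^sup>+x. (\<Prod>i\<in>I. f i (x i)) * indicator (Pi\<^sub>E I A) x \<partial>Pi\<^sub>M I M)"
      using I A by (intro emeasure_density meas sets_PiM_I_finite)
    also have "\<dots> = (\<integral>\<^sup>+x. (\<Prod>i\<in>I. f i (x i) * indicator (A i) (x i)) \<partial>Pi\<^sub>M I M)"
    proof (intro nn_integral_cong)
      fix x assume x: "x \<in> space (Pi\<^sub>M I M)"
      have "indicator (Pi\<^sub>E I A) x = (\<Prod>i\<in>I. indicator (A i) (x i) :: ennreal)"
      proof (cases "x \<in> Pi\<^sub>E I A")
        case True
        then show ?thesis by (simp add: PiE_iff)
      next
        case False
        then obtain i where "i \<in> I" "x i \<notin> A i" using x by (auto simp: space_PiM PiE_iff)
        then show ?thesis using False I by (auto simp: prod_zero_iff indicator_def)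
      qed
      then show "(\<Prod>i\<in>I. f i (x i)) * indicator (Pi\<^sub>E I A) x = (\<Prod>i\<in>I. f i (x i) * indicator (A i) (x i))"
        by (simp add: prod.distrib)
    qed
    also have "\<dots> = (\<Prod>i\<in>I. \<integral>\<^sup>+x. f i x * indicator (A i) x \<partial>M i)"
      using I A by (intro M.product_nn_integral_prod) auto
    also have "\<dots> = (\<Prod>i\<in>I. emeasure (density (M i) (f i)) (A i))"
      using A by (intro prod.cong refl emeasure_density[symmetric]) auto
    finally show "emeasure (density (Pi\<^sub>M I M) (\<lambda>x. \<Prod>i\<in>I. f i (x i))) (Pi\<^sub>E I A)
        = (\<Prod>i\<in>I. emeasure (density (M i) (f i)) (A i))" .
  qed
qed

lemma vec_lborel_shift:
  "distr (vec_lborel n) (vec_lborel n) (\<lambda>y. \<lambda>l\<in>{..<n}. v l + y l) = vec_lborel n"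
proof -
  have d: "distr lborel lborel ((+) c) = (lborel :: real measure)" for c
    using lborel_distr_plus[of c] by (simp cong: distr_cong)
  show ?thesis
    using distr_PiM_map[of "{..<n}" "\<lambda>_. lborel" "\<lambda>l. (+) (v l)" "\<lambda>_. lborel"]
    by (simp add: d sigma_finite_lborel)
qed

lemma conf_lborel_shift:
  "distr (conf_lborel n) (conf_lborel n) (\<lambda>y. \<lambda>i\<in>UNIV. \<lambda>l\<in>{..<n}. v i l + y i l) = (conf_lborel n :: ('k::finite \<Rightarrow> _) measure)"
  using distr_PiM_map[of "UNIV :: 'k set" "\<lambda>_. vec_lborel n" "\<lambda>i y. \<lambda>l\<in>{..<n}. v i l + y l" "\<lambda>_. vec_lborel n"]
  by (simp add: vec_lborel_shift sigma_finite_vec_lborel)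

lemma vec_lborel_scale:
  assumes b: "b > 0"
  shows "scale_measure (ennreal b ^ n) (distr (vec_lborel n) (vec_lborel n) (\<lambda>y. \<lambda>l\<in>{..<n}. b * y l)) = vec_lborel n"
proof -
  interpret product_sigma_finite "\<lambda>_. lborel :: real measure" by standard
  have meas: "(\<lambda>y. \<lambda>l\<in>{..<n}. b * y l) \<in> vec_lborel n \<rightarrow>\<^sub>M vec_lborel n" by measurable
  show ?thesis
  proof (rule PiM_eqI)
    fix A :: "nat \<Rightarrow> real set" assume A: "\<And>i. i \<in> {..<n} \<Longrightarrow> A i \<in> sets lborel"
    have "emeasure (distr (vec_lborel n) (vec_lborel n) (\<lambda>y. \<lambda>l\<in>{..<n}. b * y l)) (Pi\<^sub>E {..<n} A)
      = emeasure (vec_lborel n) ((\<lambda>y. \<lambda>l\<in>{..<n}. b * y l) -` Pi\<^sub>E {..<n} A \<inter> space (vec_lborel n))"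
      using A by (intro emeasure_distr meas sets_PiM_I_finite) auto
    also have "(\<lambda>y. \<lambda>l\<in>{..<n}. b * y l) -` Pi\<^sub>E {..<n} A \<inter> space (vec_lborel n) = (\<Pi>\<^sub>E l\<in>{..<n}. (*) b -` A l)"
      by (auto simp: space_PiM PiE_iff)
    also have "emeasure (vec_lborel n) \<dots> = (\<Prod>l<n. emeasure lborel ((*) b -` A l))"
      using A by (intro emeasure_PiM) (auto intro!: measurable_sets_borel[where M = borel])
    finally have "emeasure (scale_measure (ennreal b ^ n) (distr (vec_lborel n) (vec_lborel n) (\<lambda>y. \<lambda>l\<in>{..<n}. b * y l))) (Pi\<^sub>E {..<n} A)
       = (\<Prod>l<n. ennreal b * emeasure lborel ((*) b -` A l))"
      by (simp only: emeasure_scale_measure prod.distrib prod_constant card_lessThan)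
    also have "\<dots> = (\<Prod>l<n. emeasure lborel (A l))"
    proof (intro prod.cong refl)
      fix l assume "l \<in> {..<n}"
      then have Al: "A l \<in> sets borel" using A by simp
      have "emeasure lborel (A l) = emeasure (density (distr lborel borel ((*) b)) (\<lambda>_. ennreal \<bar>b\<bar>)) (A l)"
        using b by (subst lborel_distr_mult'[of b]) auto
      also have "\<dots> = ennreal b * emeasure lborel ((*) b -` A l)"
        using Al b by (simp add: emeasure_density nn_integral_cmult_indicator emeasure_distr)
      finally show "ennreal b * emeasure lborel ((*) b -` A l) = emeasure lborel (A l)" by simp
    qed
    finally show "emeasure (scale_measure (ennreal b ^ n) (distr (vec_lborel n) (vec_lborel n) (\<lambda>y. \<lambda>l\<in>{..<n}. b * y l))) (Pi\<^sub>E {..<n} A)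
       = (\<Prod>l<n. emeasure lborel (A l))" .
  qed auto
qed

lemma L2_set_scale: "0 \<le> b \<Longrightarrow> L2_set (\<lambda>l\<in>{..<n}. b * y l) {..<n} = b * L2_set y {..<n}"
proof -
  assume "0 \<le> b"
  have "L2_set (\<lambda>l\<in>{..<n}. b * y l) {..<n} = L2_set (\<lambda>l. b * y l) {..<n}" by (intro L2_set_cong) auto
  also have "\<dots> = b * L2_set y {..<n}" using \<open>0 \<le> b\<close> by (simp add: L2_set_right_distrib)
  finally show ?thesis .
qed

lemma normalize_vec_scale: "0 < b \<Longrightarrow> normalize_vec n (\<lambda>l\<in>{..<n}. b * y l) = normalize_vec n y"
  by (auto simp: normalize_vec_def L2_set_scale fun_eq_iff)

text \<open>Scaling reduces to \<open>b = 1\<close>, where the formula is the definition of the cone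
  measure. For b \<le> 0 the set lies in the origin, which is null since n \<ge> 1.\<close>

lemma emeasure_ball_cone:
  assumes n: "n \<ge> 1" and E: "E \<in> sets (\<Pi>\<^sub>M l\<in>{..<n}. borel)"
  shows "emeasure (vec_lborel n) {y \<in> space (vec_lborel n). L2_set y {..<n} \<le> b \<and> normalize_vec n y \<in> E}
     = ennreal (unit_ball_vol (real n)) * emeasure (sphere_uniform n) E * (if b > 0 then ennreal b ^ n else 0)"
proof -
  note [measurable] = E
  let ?L = "vec_lborel n"
  let ?C = "\<lambda>b. {y \<in> space ?L. L2_set y {..<n} \<le> b \<and> normalize_vec n y \<in> E}"
  have nL[measurable]: "normalize_vec n \<in> ?L \<rightarrow>\<^sub>M (\<Pi>\<^sub>M l\<in>{..<n}. borel)" "(\<lambda>x. L2_set x {..<n}) \<in> borel_measurable ?L"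
    using measurable_normalize_vec measurable_L2_set measurable_cong_sets[OF sets_vec_lborel refl] by blast+
  have CM[measurable]: "?C b \<in> sets ?L" for b by measurable
  have one: "emeasure ?L (?C 1) = ennreal (unit_ball_vol (real n)) * emeasure (sphere_uniform n) E"
  proof -
    let ?B = "{x \<in> space ?L. L2_set x {..<n} \<le> 1}"
    have B: "?B \<in> sets ?L" by measurable
    have v: "emeasure ?L ?B = ennreal (unit_ball_vol (real n))" by (rule emeasure_unit_ball)
    have "emeasure (sphere_uniform n) E = emeasure (unit_ball_uniform n) (normalize_vec n -` E \<inter> space (unit_ball_uniform n))"
      unfolding sphere_uniform_def
      by (intro emeasure_distr E) (use measurable_normalize_vec measurable_cong_sets[OF sets_unit_ball_uniform refl] in blast)
    also have "\<dots> = emeasure ?L (?B \<inter> (normalize_vec n -` E \<inter> space ?L)) / emeasure ?L ?B"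
      unfolding unit_ball_uniform_def
      using B measurable_sets[OF nL(1) E] by (subst emeasure_uniform_measure) auto
    also have "?B \<inter> (normalize_vec n -` E \<inter> space ?L) = ?C 1" by auto
    finally have e: "emeasure (sphere_uniform n) E = emeasure ?L (?C 1) / ennreal (unit_ball_vol (real n))"
      by (simp only: v)
    have "ennreal (unit_ball_vol (real n)) \<noteq> 0" by (simp add: ennreal_eq_0_iff not_le)
    then show ?thesis unfolding e by (intro ennreal_mult_divide_cancel[symmetric]) auto
  qed
  show ?thesis
  proof (cases "b > 0")
    case True
    have "emeasure ?L (?C b) = ennreal b ^ n * emeasure (distr ?L ?L (\<lambda>y. \<lambda>l\<in>{..<n}. b * y l)) (?C b)"
      by (subst vec_lborel_scale[OF True, symmetric]) (simp only: emeasure_scale_measure)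
    also have "emeasure (distr ?L ?L (\<lambda>y. \<lambda>l\<in>{..<n}. b * y l)) (?C b)
       = emeasure ?L ((\<lambda>y. \<lambda>l\<in>{..<n}. b * y l) -` ?C b \<inter> space ?L)"
      by (intro emeasure_distr CM) measurable
    also have "(\<lambda>y. \<lambda>l\<in>{..<n}. b * y l) -` ?C b \<inter> space ?L = ?C 1"
      using True by (auto simp: L2_set_scale normalize_vec_scale space_PiM)
    finally show ?thesis using True by (simp add: one mult.commute)
  next
    case False
    have Z: "Pi\<^sub>E {..<n} (\<lambda>_. {0}) \<in> sets ?L" by (rule sets_PiM_I_finite) auto
    have "?C b \<subseteq> Pi\<^sub>E {..<n} (\<lambda>_. {0})"
    proof
      fix y assume y: "y \<in> ?C b"
      then have "L2_set y {..<n} \<le> 0" using False by auto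
      then have "L2_set y {..<n} = 0" using L2_set_nonneg[of y "{..<n}"] by linarith
      then show "y \<in> Pi\<^sub>E {..<n} (\<lambda>_. {0})"
        using y by (intro PiE_I) (auto simp: L2_set_eq_0_iff space_PiM PiE_iff extensional_def)
    qed
    then have "emeasure ?L (?C b) \<le> emeasure ?L (Pi\<^sub>E {..<n} (\<lambda>_. {0}))"
      by (rule emeasure_mono[OF _ Z])
    also have "emeasure ?L (Pi\<^sub>E {..<n} (\<lambda>_. {0})) = (\<Prod>l<n. emeasure lborel {0::real})"
    proof -
      interpret product_sigma_finite "\<lambda>_. lborel :: real measure" by standard
      show ?thesis by (rule emeasure_PiM) auto
    qed
    also have "\<dots> = 0" using n by (simp add: prod_zero_iff)
    finally show ?thesis using False by simp
  qed
qed

text \<open>Polar coordinates without a radial density: the law of the radius on the cone over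
  \<open>E\<close> is a multiple of its law on the whole space, because this holds on every
  half-line \<open>{..b}\<close>.\<close>

lemma nn_integral_radial_cone:
  assumes n: "n \<ge> 1" and E: "E \<in> sets (\<Pi>\<^sub>M l\<in>{..<n}. borel)" and h[measurable]: "h \<in> borel_measurable borel"
  shows "(\<integral>\<^sup>+y. h (L2_set y {..<n}) * indicator E (normalize_vec n y) \<partial>vec_lborel n)
     = emeasure (sphere_uniform n) E * (\<integral>\<^sup>+y. h (L2_set y {..<n}) \<partial>vec_lborel n)"
proof -
  let ?L = "vec_lborel n"
  have nL[measurable]: "normalize_vec n \<in> ?L \<rightarrow>\<^sub>M (\<Pi>\<^sub>M l\<in>{..<n}. borel)" "(\<lambda>x. L2_set x {..<n}) \<in> borel_measurable ?L"
    using measurable_normalize_vec measurable_L2_set measurable_cong_sets[OF sets_vec_lborel refl] by blast+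
  define N where "N F = distr (density ?L (\<lambda>y. indicator F (normalize_vec n y))) borel (\<lambda>y. L2_set y {..<n})" for F
  let ?S = "space (\<Pi>\<^sub>M l\<in>{..<n}. (borel :: real measure))"
  have S1: "emeasure (sphere_uniform n) ?S = 1"
    using prob_space.emeasure_space_1[OF prob_space_sphere_uniform[of n]]
    by (simp add: sets_eq_imp_space_eq[OF sets_sphere_uniform, symmetric])
  have Nb: "emeasure (N F) {..b} = ennreal (unit_ball_vol (real n)) * emeasure (sphere_uniform n) F * (if b > 0 then ennreal b ^ n else 0)"
    if F[measurable]: "F \<in> sets (\<Pi>\<^sub>M l\<in>{..<n}. borel)" for F b
  proof -
    have "emeasure (N F) {..b} = emeasure (density ?L (\<lambda>y. indicator F (normalize_vec n y))) ((\<lambda>y. L2_set y {..<n}) -` {..b} \<inter> space ?L)"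
      unfolding N_def by (subst emeasure_distr) auto
    also have "\<dots> = (\<integral>\<^sup>+y. indicator F (normalize_vec n y) * indicator ((\<lambda>y. L2_set y {..<n}) -` {..b} \<inter> space ?L) y \<partial>?L)"
      by (intro emeasure_density) measurable
    also have "\<dots> = (\<integral>\<^sup>+y. indicator {y \<in> space ?L. L2_set y {..<n} \<le> b \<and> normalize_vec n y \<in> F} y \<partial>?L)"
      by (intro nn_integral_cong) (auto simp: indicator_def)
    also have "\<dots> = emeasure ?L {y \<in> space ?L. L2_set y {..<n} \<le> b \<and> normalize_vec n y \<in> F}"
      by (intro nn_integral_indicator) measurable
    finally show ?thesis by (simp add: emeasure_ball_cone[OF n F])
  qed
  have eq: "N E = scale_measure (emeasure (sphere_uniform n) E) (N ?S)"
  proof (rule measure_eqI_generator_eq[where E = "range atMost" and \<Omega> = UNIV and A = "\<lambda>i. {..real i}"])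
    show "Int_stable (range (atMost :: real \<Rightarrow> _))" by (auto simp: Int_stable_def)
    show "emeasure (N E) X = emeasure (scale_measure (emeasure (sphere_uniform n) E) (N ?S)) X" if "X \<in> range atMost" for X
      using that Nb[OF E] Nb[OF sets.top] S1 by (auto simp: mult_ac)
    show "sets (N E) = sigma_sets UNIV (range atMost)"
      "sets (scale_measure (emeasure (sphere_uniform n) E) (N ?S)) = sigma_sets UNIV (range atMost)"
      by (simp_all add: N_def borel_eq_atMost[where 'a = real])
    show "(\<Union>i. {..real i}) = UNIV" using real_arch_simple by auto
    show "emeasure (N E) {..real i} \<noteq> \<infinity>" for i
    proof -
      have "emeasure (sphere_uniform n) E \<le> 1" by (rule subprob_space.subprob_emeasure_le_1[OF prob_space_imp_subprob_space[OF prob_space_sphere_uniform]])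
      then show ?thesis by (auto simp: Nb[OF E] ennreal_mult_eq_top_iff top_unique power_eq_top_ennreal)
    qed
  qed auto
  have int: "(\<integral>\<^sup>+r. h r \<partial>N F) = (\<integral>\<^sup>+y. h (L2_set y {..<n}) * indicator F (normalize_vec n y) \<partial>?L)"
    if F[measurable]: "F \<in> sets (\<Pi>\<^sub>M l\<in>{..<n}. borel)" for F
    unfolding N_def by (subst nn_integral_distr) (auto simp: nn_integral_density mult.commute)
  have "(\<integral>\<^sup>+y. h (L2_set y {..<n}) * indicator E (normalize_vec n y) \<partial>?L) = (\<integral>\<^sup>+r. h r \<partial>N E)"
    by (rule int[OF E, symmetric])
  also have "\<dots> = emeasure (sphere_uniform n) E * (\<integral>\<^sup>+r. h r \<partial>N ?S)"
    unfolding eq by (rule nn_integral_scale_measure) (simp add: N_def)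
  also have "(\<integral>\<^sup>+r. h r \<partial>N ?S) = (\<integral>\<^sup>+y. h (L2_set y {..<n}) * indicator ?S (normalize_vec n y) \<partial>?L)"
    by (rule int) auto
  also have "\<dots> = (\<integral>\<^sup>+y. h (L2_set y {..<n}) \<partial>?L)"
    by (intro nn_integral_cong) (auto simp: indicator_def normalize_vec_def space_PiM)
  finally show ?thesis .
qed

text \<open>Under the normalised weight each column is a random vector with uniform direction, and
  the columns are combined by product measures. The freedom in \<open>h\<close> is essential: a thin
  shell serves one comparison, a majorant of r^-n the other.\<close>

lemma nn_integral_radial_spheres:
  fixes g :: "('k::finite \<Rightarrow> nat \<Rightarrow> real) \<Rightarrow> ennreal"
  assumes n: "n \<ge> 1" and h[measurable]: "h \<in> borel_measurable borel"
    and c: "(\<integral>\<^sup>+y. h (L2_set y {..<n}) \<partial>vec_lborel n) = c" "c \<noteq> 0" "c \<noteq> \<infinity>"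
    and g[measurable]: "g \<in> borel_measurable (\<Pi>\<^sub>M i\<in>UNIV. \<Pi>\<^sub>M l\<in>{..<n}. borel)"
  shows "(\<integral>\<^sup>+Y. (\<Prod>i\<in>UNIV. h (L2_set (Y i) {..<n})) * g (\<lambda>i. normalize_vec n (Y i)) \<partial>conf_lborel n)
     = c ^ CARD('k) * (\<integral>\<^sup>+x. g x \<partial>spheres_uniform n)"
proof -
  let ?L = "vec_lborel n"
  let ?B = "\<Pi>\<^sub>M l\<in>{..<n}. (borel :: real measure)"
  have nL[measurable]: "normalize_vec n \<in> ?L \<rightarrow>\<^sub>M ?B" "(\<lambda>x. L2_set x {..<n}) \<in> borel_measurable ?L"
    using measurable_normalize_vec measurable_L2_set measurable_cong_sets[OF sets_vec_lborel refl] by blast+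
  define d where "d y = h (L2_set y {..<n}) / c" for y
  have d[measurable]: "d \<in> borel_measurable ?L" unfolding d_def by measurable
  define \<nu> where "\<nu> = density ?L d"
  have \<nu>d: "distr \<nu> ?B (normalize_vec n) = sphere_uniform n"
  proof (rule measure_eqI)
    fix E assume "E \<in> sets (distr \<nu> ?B (normalize_vec n))"
    then have E[measurable]: "E \<in> sets ?B" by simp
    have "emeasure (distr \<nu> ?B (normalize_vec n)) E = emeasure \<nu> (normalize_vec n -` E \<inter> space ?L)"
      unfolding \<nu>_def by (subst emeasure_distr) auto
    also have "\<dots> = (\<integral>\<^sup>+y. d y * indicator (normalize_vec n -` E \<inter> space ?L) y \<partial>?L)"
      unfolding \<nu>_def by (intro emeasure_density) measurable
    also have "\<dots> = (\<integral>\<^sup>+y. h (L2_set y {..<n}) * indicator E (normalize_vec n y) / c \<partial>?L)"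
      by (intro nn_integral_cong) (auto simp: d_def indicator_def)
    also have "\<dots> = emeasure (sphere_uniform n) E * c / c"
      by (simp add: nn_integral_divide nn_integral_radial_cone[OF n E h] c(1))
    also have "\<dots> = emeasure (sphere_uniform n) E"
      using c by (simp add: ennreal_mult_divide_eq)
    finally show "emeasure (distr \<nu> ?B (normalize_vec n)) E = emeasure (sphere_uniform n) E" .
  qed simp
  interpret \<nu>: prob_space \<nu>
  proof
    have "emeasure \<nu> (space \<nu>) = (\<integral>\<^sup>+y. d y \<partial>?L)"
      unfolding \<nu>_def by (simp add: emeasure_density cong: nn_integral_cong)
    also have "\<dots> = c / c" by (simp add: d_def nn_integral_divide c(1))
    finally show "emeasure \<nu> (space \<nu>) = 1" using c by (simp add: ennreal_divide_self less_top)
  qed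
  have sph: "sigma_finite_measure (sphere_uniform n)"
    using prob_space_sphere_uniform[of n] by (simp add: prob_space_imp_sigma_finite)
  have P1: "spheres_uniform n = distr (\<Pi>\<^sub>M i\<in>(UNIV::'k set). \<nu>) (\<Pi>\<^sub>M i\<in>UNIV. ?B) (\<lambda>Y. \<lambda>i\<in>UNIV. normalize_vec n (Y i))"
  proof -
    have "normalize_vec n \<in> \<nu> \<rightarrow>\<^sub>M ?B" unfolding \<nu>_def by measurable
    then show ?thesis
      using distr_PiM_map[of "UNIV::'k set" "\<lambda>_. \<nu>" "\<lambda>_. normalize_vec n" "\<lambda>_. ?B"]
      by (simp add: \<nu>d sph spheres_uniform_def \<nu>.sigma_finite_measure_axioms)
  qed
  have P2: "(\<Pi>\<^sub>M i\<in>(UNIV::'k set). \<nu>) = density (conf_lborel n) (\<lambda>Y. \<Prod>i\<in>UNIV. d (Y i))"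
    using density_PiM[of "UNIV::'k set" "\<lambda>_. ?L" "\<lambda>_. d"] \<nu>.sigma_finite_measure_axioms d
    by (simp add: \<nu>_def sigma_finite_vec_lborel)
  have mn: "(\<lambda>Y. \<lambda>i\<in>UNIV. normalize_vec n (Y i)) \<in> conf_lborel n \<rightarrow>\<^sub>M (\<Pi>\<^sub>M i\<in>(UNIV::'k set). ?B)"
    by measurable
  have md: "(\<lambda>Y. \<Prod>i\<in>UNIV. d (Y i)) \<in> borel_measurable (conf_lborel n :: ('k \<Rightarrow> _) measure)"
    by (intro borel_measurable_prod_ennreal) measurable
  have gm: "(\<lambda>Y. g (\<lambda>i. normalize_vec n (Y i))) \<in> borel_measurable (conf_lborel n)"
    using measurable_compose[OF mn g] by (simp add: restrict_UNIV)
  have "(\<integral>\<^sup>+x. g x \<partial>spheres_uniform n) = (\<integral>\<^sup>+Y. g (\<lambda>i. normalize_vec n (Y i)) \<partial>density (conf_lborel n) (\<lambda>Y. \<Prod>i\<in>UNIV. d (Y i)))"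
    unfolding P1 P2 using mn g by (subst nn_integral_distr) (auto simp: md restrict_UNIV)
  also have "\<dots> = (\<integral>\<^sup>+Y. (\<Prod>i\<in>UNIV. d (Y i)) * g (\<lambda>i. normalize_vec n (Y i)) \<partial>conf_lborel n)"
    by (rule nn_integral_density[OF md gm])
  finally have "c ^ CARD('k) * (\<integral>\<^sup>+x. g x \<partial>spheres_uniform n)
     = (\<integral>\<^sup>+Y. c ^ CARD('k) * ((\<Prod>i\<in>UNIV. d (Y i)) * g (\<lambda>i. normalize_vec n (Y i))) \<partial>conf_lborel n)"
    using md gm by (simp add: nn_integral_cmult)
  also have "\<dots> = (\<integral>\<^sup>+Y. (\<Prod>i\<in>UNIV. h (L2_set (Y i) {..<n})) * g (\<lambda>i. normalize_vec n (Y i)) \<partial>conf_lborel n)"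
  proof (intro nn_integral_cong)
    fix Y :: "'k \<Rightarrow> nat \<Rightarrow> real"
    have "c * (x / c) = x" for x using c by (simp add: ennreal_times_divide ennreal_mult_divide_eq mult.commute[of c])
    then have "(\<Prod>i\<in>UNIV. h (L2_set (Y i) {..<n})) = (\<Prod>i\<in>(UNIV::'k set). c * d (Y i))" by (simp add: d_def)
    also have "\<dots> = c ^ CARD('k) * (\<Prod>i\<in>UNIV. d (Y i))" by (simp add: prod.distrib)
    finally show "c ^ CARD('k) * ((\<Prod>i\<in>UNIV. d (Y i)) * g (\<lambda>i. normalize_vec n (Y i)))
       = (\<Prod>i\<in>UNIV. h (L2_set (Y i) {..<n})) * g (\<lambda>i. normalize_vec n (Y i))" by (simp add: mult.assoc)
  qed
  finally show ?thesis by simp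
qed

lemma emeasure_vec_ball:
  assumes "n \<ge> 1" "b > 0"
  shows "emeasure (vec_lborel n) {y \<in> space (vec_lborel n). L2_set y {..<n} \<le> b} = ennreal (unit_ball_vol (real n) * b ^ n)"
  using emeasure_cball_aux[of "{..<n}" b] assms by (simp add: L2_set_def Int_def conj_commute)

lemma nn_integral_shell:
  assumes "n \<ge> 1" "0 < a" "a \<le> b"
  shows "(\<integral>\<^sup>+y. indicator {a<..b} (L2_set y {..<n}) \<partial>vec_lborel n) = ennreal (unit_ball_vol (real n) * (b ^ n - a ^ n))"
proof -
  let ?L = "vec_lborel n"
  have [measurable]: "(\<lambda>x. L2_set x {..<n}) \<in> borel_measurable ?L"
    using measurable_L2_set measurable_cong_sets[OF sets_vec_lborel refl] by blast
  let ?C = "\<lambda>b. {y \<in> space ?L. L2_set y {..<n} \<le> b}"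
  have "(\<integral>\<^sup>+y. indicator {a<..b} (L2_set y {..<n}) \<partial>?L) = (\<integral>\<^sup>+y. indicator (?C b - ?C a) y \<partial>?L)"
    by (intro nn_integral_cong) (auto simp: indicator_def)
  also have "\<dots> = emeasure ?L (?C b - ?C a)" by (intro nn_integral_indicator) measurable
  also have "\<dots> = emeasure ?L (?C b) - emeasure ?L (?C a)"
    using assms by (intro emeasure_Diff) (auto simp: emeasure_vec_ball)
  also have "\<dots> = ennreal (unit_ball_vol (real n) * (b ^ n - a ^ n))"
    using assms by (simp add: emeasure_vec_ball ennreal_minus right_diff_distrib)
  finally show ?thesis .
qed

section \<open>The Gaussian model\<close>

text \<open>Second difference quotients of the generating function: (exp (q X) + exp (- q X) - 2) /
  q^2 tends to X^2, while its mean is known exactly and tends to \<open>c\<close>. Dominated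
  convergence exchanges the limit with the integral.\<close>

lemma (in prob_space) second_moment_if_gaussian_mgf:
  fixes X :: "'a \<Rightarrow> real"
  assumes X[measurable]: "X \<in> borel_measurable M"
    and mgf: "\<And>s. (\<integral>\<^sup>+x. ennreal (exp (s * X x)) \<partial>M) = ennreal (exp (s\<^sup>2 * c / 2))"
  shows "has_bochner_integral M (\<lambda>x. (X x)\<^sup>2) c"
proof -
  have e: "has_bochner_integral M (\<lambda>x. exp (s * X x)) (exp (s\<^sup>2 * c / 2))" for s
    by (rule has_bochner_integral_nn_integral[OF _ _ _ mgf]) auto
  define q where "q j = 1 / real (Suc j)" for j
  have q: "0 < q j" "q j \<le> 1" for j by (auto simp: q_def)
  have nz: "q j \<noteq> 0" for j using q(1)[of j] by simp
  have q0: "q \<longlonglongrightarrow> 0" unfolding q_def by (rule LIMSEQ_Suc[OF lim_const_over_n])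
  have q0': "filterlim q (at 0) sequentially"
    unfolding filterlim_at using q0 nz by simp
  have lim: "(\<lambda>j. (exp (q j * a) - 1) / q j) \<longlonglongrightarrow> a" for a :: real
  proof -
    have "((\<lambda>t. exp (t * a)) has_real_derivative a) (at 0)" by (auto intro!: derivative_eq_intros)
    then have "((\<lambda>t. (exp (t * a) - 1) / t) \<longlongrightarrow> a) (at 0)" by (simp add: has_field_derivative_iff)
    from filterlim_compose[OF this q0'] show ?thesis by simp
  qed
  define f where "f j x = (exp (q j * X x) + exp (- q j * X x) - 2) / (q j)\<^sup>2" for j x
  \<comment> \<open>As an exponential times the square of a first-order quotient, \<open>f\<close>
    has an evident limit and is easily dominated.\<close>
  have f_eq: "f j x = exp (- q j * X x) * ((exp (q j * X x) - 1) / q j)\<^sup>2" for j x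
    using q(1)[of j] by (simp add: f_def field_simps power2_eq_square flip: exp_add)
  have fi: "has_bochner_integral M (f j) ((exp ((q j)\<^sup>2 * c / 2) + exp ((- q j)\<^sup>2 * c / 2) - 2) / (q j)\<^sup>2)" for j
    unfolding f_def
    by (intro has_bochner_integral_divide_zero has_bochner_integral_diff has_bochner_integral_add e)
       (simp add: has_bochner_integral_iff prob_space)
  have fl: "(\<lambda>j. f j x) \<longlonglongrightarrow> (X x)\<^sup>2" for x
  proof -
    have "(\<lambda>j. exp (- q j * X x) * ((exp (q j * X x) - 1) / q j)\<^sup>2) \<longlonglongrightarrow> exp (- 0 * X x) * (X x)\<^sup>2"
      by (intro tendsto_intros q0 lim)
    then show ?thesis by (simp add: f_eq[abs_def])
  qed
  \<comment> \<open>The factored form is at most exp |X| (|X| exp |X|)^2 = X^2 exp (3 |X|), and X^2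
    \<le> 2 exp |X| turns this into 2 exp (4 |X|).\<close>
  define w where "w x = 2 * (exp (4 * X x) + exp ((-4) * X x))" for x
  have wi: "integrable M w"
    unfolding w_def using e[of 4] e[of "-4"] by (auto intro!: Bochner_Integration.integrable_add simp: has_bochner_integral_iff)
  have fb: "norm (f j x) \<le> w x" for j x
  proof -
    define y where "y = q j * X x"
    have yX: "\<bar>y\<bar> \<le> \<bar>X x\<bar>" using q[of j] by (simp add: y_def abs_mult mult_left_le_one_le)
    have "\<bar>exp y - 1\<bar> \<le> \<bar>y\<bar> * exp \<bar>y\<bar>"
    proof (cases "y \<ge> 0")
      case True
      have "1 - exp (- y) \<le> y" using exp_ge_add_one_self[of "- y"] by simp
      then have "(1 - exp (- y)) * exp y \<le> y * exp y" by (rule mult_right_mono) simp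
      then show ?thesis using True by (simp add: left_diff_distrib flip: exp_add)
    next
      case False
      have "1 - exp y \<le> - y" using exp_ge_add_one_self[of y] by linarith
      also have "- y \<le> - y * exp (- y)" using False by (intro mult_le_cancel_left1[THEN iffD2]) auto
      finally show ?thesis using False by simp
    qed
    then have "\<bar>(exp y - 1) / q j\<bar> \<le> \<bar>y\<bar> * exp \<bar>y\<bar> / q j"
      using q(1)[of j] by (simp add: divide_right_mono)
    also have "\<dots> = \<bar>X x\<bar> * exp \<bar>y\<bar>" using q(1)[of j] by (simp add: y_def abs_mult)
    also have "\<dots> \<le> \<bar>X x\<bar> * exp \<bar>X x\<bar>" using yX by (intro mult_left_mono) auto
    finally have 1: "((exp y - 1) / q j)\<^sup>2 \<le> (\<bar>X x\<bar> * exp \<bar>X x\<bar>)\<^sup>2"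
      by (metis power2_abs power_mono abs_ge_zero)
    have 2: "exp (- y) \<le> exp \<bar>X x\<bar>" using yX by simp
    have "norm (f j x) = exp (- y) * ((exp y - 1) / q j)\<^sup>2" by (simp add: f_eq y_def)
    also have "\<dots> \<le> exp \<bar>X x\<bar> * (\<bar>X x\<bar> * exp \<bar>X x\<bar>)\<^sup>2" by (intro mult_mono 1 2) auto
    also have "\<dots> = (X x)\<^sup>2 * exp (3 * \<bar>X x\<bar>)"
      by (simp add: power_mult_distrib power2_eq_square mult_ac flip: exp_add)
    also have "\<dots> \<le> (2 * exp \<bar>X x\<bar>) * exp (3 * \<bar>X x\<bar>)"
    proof (rule mult_right_mono)
      have "\<bar>X x\<bar>\<^sup>2 / 2 \<le> exp \<bar>X x\<bar>"
        using exp_lower_Taylor_quadratic[of "\<bar>X x\<bar>"] by (simp add: field_simps)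
      then show "(X x)\<^sup>2 \<le> 2 * exp \<bar>X x\<bar>" by simp
    qed simp
    also have "\<dots> = 2 * exp (4 * \<bar>X x\<bar>)" by (simp flip: exp_add)
    also have "\<dots> \<le> w x" by (cases "X x \<ge> 0") (auto simp: w_def)
    finally show ?thesis .
  qed
  have D: "integrable M (\<lambda>x. (X x)\<^sup>2)" "(\<lambda>j. integral\<^sup>L M (f j)) \<longlonglongrightarrow> (\<integral>x. (X x)\<^sup>2 \<partial>M)"
  proof -
    have fm: "f j \<in> borel_measurable M" for j unfolding f_def by measurable
    show "integrable M (\<lambda>x. (X x)\<^sup>2)"
      by (rule integrable_dominated_convergence[where s = f and w = w]) (use fm wi fl fb in auto)
    show "(\<lambda>j. integral\<^sup>L M (f j)) \<longlonglongrightarrow> (\<integral>x. (X x)\<^sup>2 \<partial>M)"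
      by (rule integral_dominated_convergence[where s = f and w = w]) (use fm wi fl fb in auto)
  qed
  have "(\<lambda>j. integral\<^sup>L M (f j)) \<longlonglongrightarrow> c"
  proof -
    have "filterlim (\<lambda>j. (q j)\<^sup>2) (at 0) sequentially"
      unfolding filterlim_at using tendsto_power[OF q0, of 2] nz by simp
    moreover have "((\<lambda>t. exp (t * (c / 2))) has_real_derivative c / 2) (at 0)" by (auto intro!: derivative_eq_intros)
    then have "((\<lambda>t. (exp (t * (c / 2)) - 1) / t) \<longlongrightarrow> c / 2) (at 0)" by (simp add: has_field_derivative_iff)
    ultimately have "(\<lambda>j. (exp ((q j)\<^sup>2 * (c / 2)) - 1) / (q j)\<^sup>2) \<longlonglongrightarrow> c / 2"
      by (rule filterlim_compose[rotated])
    from tendsto_mult[OF tendsto_const[of 2] this]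
    have "(\<lambda>j. 2 * ((exp ((q j)\<^sup>2 * (c / 2)) - 1) / (q j)\<^sup>2)) \<longlonglongrightarrow> c" by simp
    moreover have "integral\<^sup>L M (f j) = 2 * ((exp ((q j)\<^sup>2 * (c / 2)) - 1) / (q j)\<^sup>2)" for j
      using has_bochner_integral_integral_eq[OF fi[of j]] by (simp add: field_simps)
    ultimately show ?thesis by simp
  qed
  then have "(\<integral>x. (X x)\<^sup>2 \<partial>M) = c" using D(2) LIMSEQ_unique by blast
  then show ?thesis using D(1) by (simp add: has_bochner_integral_iff)
qed

section \<open>Gaussian weights and moments of the Gram matrix\<close>

definition gram_row :: "('k \<Rightarrow> nat \<Rightarrow> real) \<Rightarrow> nat \<Rightarrow> real^'k::finite" where
  "gram_row Y m = (\<chi> i. Y i m)"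

lemma inner_gram: "Q \<bullet> gram n Y = (\<Sum>m<n. gram_row Y m \<bullet> (Q *v gram_row Y m))"
proof -
  have "Q \<bullet> gram n Y = (\<Sum>i\<in>UNIV. \<Sum>j\<in>UNIV. \<Sum>m<n. Y i m * Q $ i $ j * Y j m)"
    by (simp add: inner_matrix_eq gram_def vec_inner_def sum_distrib_left mult_ac)
  also have "\<dots> = (\<Sum>i\<in>UNIV. \<Sum>m<n. \<Sum>j\<in>UNIV. Y i m * Q $ i $ j * Y j m)"
    by (intro sum.cong refl sum.swap)
  also have "\<dots> = (\<Sum>m<n. \<Sum>i\<in>UNIV. \<Sum>j\<in>UNIV. Y i m * Q $ i $ j * Y j m)" by (rule sum.swap)
  finally show ?thesis by (simp add: bilinear_form_eq gram_row_def)
qed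

lemma transpose_gram: "transpose (gram n Y) = gram n Y"
  by (simp add: transpose_def gram_def vec_inner_def vec_eq_iff mult.commute)

lemma measurable_conf_component:
  "m < n \<Longrightarrow> (\<lambda>Y. Y i m) \<in> borel_measurable (conf_lborel n :: ('k::finite \<Rightarrow> nat \<Rightarrow> real) measure)"
  by (rule measurable_compose[where f = "\<lambda>x. x i" and g = "\<lambda>y. y m" and N = "vec_lborel n"])
     (auto intro!: measurable_component_singleton[of _ "{..<n}" "\<lambda>_. lborel", simplified])

lemma measurable_gram_conf [measurable]: "gram n \<in> borel_measurable (conf_lborel n)"
  using measurable_gram[of n] measurable_cong_sets[OF sets_conf_lborel refl] by blast

definition gauss_weight :: "nat \<Rightarrow> real^'k^'k \<Rightarrow> ('k::finite \<Rightarrow> nat \<Rightarrow> real) \<Rightarrow> real" where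
  "gauss_weight n Q Y = exp (- (real n / 2) * (Q \<bullet> gram n Y))"

text \<open>This constant is never evaluated: only ratios are estimated, so no Gaussian determinant
  occurs.\<close>

definition gauss_total :: "nat \<Rightarrow> real^'k^'k::finite \<Rightarrow> ennreal" where
  "gauss_total n Q = (\<integral>\<^sup>+Y. ennreal (gauss_weight n Q Y) \<partial>conf_lborel n)"

definition gauss :: "nat \<Rightarrow> real^'k^'k::finite \<Rightarrow> ('k \<Rightarrow> nat \<Rightarrow> real) measure" where
  "gauss n Q = density (conf_lborel n) (\<lambda>Y. ennreal (gauss_weight n Q Y) / gauss_total n Q)"

lemma measurable_gauss_weight [measurable]: "gauss_weight n Q \<in> borel_measurable (conf_lborel n)"
  unfolding gauss_weight_def by measurable

lemma gauss_weight_pos [simp]: "0 < gauss_weight n Q Y" "0 \<le> gauss_weight n Q Y"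
  by (simp_all add: gauss_weight_def)

lemma nn_integral_gaussian_finite:
  assumes "c > 0"
  shows "(\<integral>\<^sup>+x. ennreal (exp (- c * x\<^sup>2)) \<partial>lborel) < \<infinity>"
proof -
  define \<sigma> where "\<sigma> = 1 / sqrt (2 * c)"
  have \<sigma>: "\<sigma> > 0" "\<sigma>\<^sup>2 = 1 / (2 * c)" using assms by (auto simp: \<sigma>_def power_divide)
  have "exp (- c * x\<^sup>2) = sqrt (2 * pi * \<sigma>\<^sup>2) * normal_density 0 \<sigma> x" for x
    using \<sigma> assms by (simp add: normal_density_def field_simps)
  moreover have "integrable lborel (\<lambda>x. sqrt (2 * pi * \<sigma>\<^sup>2) * normal_density 0 \<sigma> x)"
    using \<sigma> by (intro integrable_mult_right integrable_normal_density)
  ultimately have "integrable lborel (\<lambda>x. exp (- c * x\<^sup>2))" by simp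
  then show ?thesis by (simp add: integrable_iff_bounded)
qed

text \<open>The coercivity constant \<open>l\<close> bounds the weight by a product of
  one-dimensional Gaussian weights.\<close>

lemma gauss_total_finite:
  fixes Q :: "real^'k^'k::finite"
  assumes n: "n \<ge> 1" and Q: "positive_definite Q"
  shows "gauss_total n Q < \<infinity>"
proof -
  obtain l where l: "l > 0" "\<And>v. l * (v \<bullet> v) \<le> v \<bullet> (Q *v v)"
    using positive_definite_lower_bound[OF Q] by blast
  define c where "c = real n / 2 * l"
  have c: "c > 0" using n l by (simp add: c_def)
  interpret K: product_sigma_finite "\<lambda>_::'k. vec_lborel n"
    using sigma_finite_vec_lborel by (simp add: product_sigma_finite_def)
  interpret L: product_sigma_finite "\<lambda>_. lborel :: real measure" by standard
  have "gauss_total n Q \<le> (\<integral>\<^sup>+Y. (\<Prod>i\<in>(UNIV::'k set). \<Prod>m<n. ennreal (exp (- c * (Y i m)\<^sup>2))) \<partial>conf_lborel n)"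
    unfolding gauss_total_def
  proof (rule nn_integral_mono)
    fix Y :: "'k \<Rightarrow> nat \<Rightarrow> real"
    have "Q \<bullet> gram n Y \<ge> (\<Sum>m<n. l * (gram_row Y m \<bullet> gram_row Y m))"
      unfolding inner_gram by (intro sum_mono l)
    also have "(\<Sum>m<n. l * (gram_row Y m \<bullet> gram_row Y m)) = (\<Sum>m<n. \<Sum>i\<in>UNIV. l * (Y i m)\<^sup>2)"
      by (simp add: inner_vec_def gram_row_def sum_distrib_left power2_eq_square)
    also have "\<dots> = (\<Sum>i\<in>UNIV. \<Sum>m<n. l * (Y i m)\<^sup>2)" by (rule sum.swap)
    finally have "real n / 2 * (\<Sum>i\<in>UNIV. \<Sum>m<n. l * (Y i m)\<^sup>2) \<le> real n / 2 * (Q \<bullet> gram n Y)"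
      by (rule mult_left_mono) simp
    then have "gauss_weight n Q Y \<le> exp (\<Sum>i\<in>UNIV. \<Sum>m<n. - c * (Y i m)\<^sup>2)"
      by (simp add: gauss_weight_def c_def sum_distrib_left sum_negf mult.assoc)
    also have "\<dots> = (\<Prod>i\<in>UNIV. \<Prod>m<n. exp (- c * (Y i m)\<^sup>2))" by (simp add: exp_sum)
    finally have "ennreal (gauss_weight n Q Y) \<le> ennreal (\<Prod>i\<in>UNIV. \<Prod>m<n. exp (- c * (Y i m)\<^sup>2))"
      by (rule ennreal_leI)
    then show "ennreal (gauss_weight n Q Y) \<le> (\<Prod>i\<in>UNIV. \<Prod>m<n. ennreal (exp (- c * (Y i m)\<^sup>2)))"
      by (simp add: prod_ennreal prod_nonneg)
  qed
  also have "\<dots> = (\<Prod>i\<in>(UNIV::'k set). \<integral>\<^sup>+y. (\<Prod>m<n. ennreal (exp (- c * (y m)\<^sup>2))) \<partial>vec_lborel n)"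
  proof (intro K.product_nn_integral_prod borel_measurable_prod_ennreal)
    fix m assume "m \<in> {..<n}"
    then show "(\<lambda>y. ennreal (exp (- c * (y m)\<^sup>2))) \<in> borel_measurable (vec_lborel n)"
      by (intro measurable_compose[where f = "\<lambda>y. y m" and g = "\<lambda>x. ennreal (exp (- c * x\<^sup>2))" and N = lborel]
          measurable_component_singleton) auto
  qed simp
  also have "\<dots> = (\<Prod>i\<in>(UNIV::'k set). \<Prod>m<n. \<integral>\<^sup>+x. ennreal (exp (- c * x\<^sup>2)) \<partial>lborel)"
    by (intro prod.cong refl L.product_nn_integral_prod) auto
  also have "\<dots> < \<infinity>"
    using nn_integral_gaussian_finite[OF c] by (simp add: power_less_top_ennreal)
  finally show ?thesis .
qed

lemma gauss_total_pos: "gauss_total n (Q :: real^'k^'k::finite) \<noteq> 0"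
proof
  assume "gauss_total n Q = 0"
  then have "AE Y in conf_lborel n. ennreal (gauss_weight n Q Y) = 0"
    unfolding gauss_total_def by (subst (asm) nn_integral_0_iff_AE) auto
  then have "AE Y in (conf_lborel n :: ('k \<Rightarrow> nat \<Rightarrow> real) measure). False" by (simp add: gauss_weight_def)
  then have "emeasure (conf_lborel n :: ('k \<Rightarrow> nat \<Rightarrow> real) measure) (space (conf_lborel n)) = 0"
    by (simp add: AE_iff_null eventually_False trivial_limit_def[symmetric] null_sets_def ae_filter_eq_bot_iff)
  moreover have "emeasure (conf_lborel n :: ('k \<Rightarrow> nat \<Rightarrow> real) measure) (space (conf_lborel n)) \<noteq> 0"
  proof -
    interpret K: product_sigma_finite "\<lambda>_::'k. vec_lborel n"
      using sigma_finite_vec_lborel by (simp add: product_sigma_finite_def)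
    interpret L: product_sigma_finite "\<lambda>_. lborel :: real measure" by standard
    have "emeasure (vec_lborel n) (space (vec_lborel n)) \<noteq> 0"
      unfolding space_PiM by (subst L.emeasure_PiM) (auto simp: prod_zero_iff)
    then show ?thesis
      unfolding space_PiM[of "UNIV::'k set"] by (subst K.emeasure_PiM) (auto simp: prod_zero_iff)
  qed
  ultimately show False by simp
qed

lemma nn_integral_gauss:
  assumes [measurable]: "f \<in> borel_measurable (conf_lborel n)"
  shows "(\<integral>\<^sup>+Y. f Y \<partial>gauss n Q) = (\<integral>\<^sup>+Y. f Y * ennreal (gauss_weight n Q Y) \<partial>conf_lborel n) / gauss_total n Q"
  unfolding gauss_def
  by (subst nn_integral_density) (auto simp: nn_integral_divide[symmetric] ennreal_times_divide mult.commute)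

lemma prob_space_gauss:
  assumes "n \<ge> 1" "positive_definite Q"
  shows "prob_space (gauss n Q)"
proof
  have "emeasure (gauss n Q) (space (gauss n Q)) = (\<integral>\<^sup>+Y. 1 \<partial>gauss n Q)" by simp
  also have "\<dots> = gauss_total n Q / gauss_total n Q"
    by (subst nn_integral_gauss) (auto simp: gauss_total_def)
  also have "\<dots> = 1" using gauss_total_finite[OF assms] gauss_total_pos[of n Q] by (simp add: ennreal_divide_self)
  finally show "emeasure (gauss n Q) (space (gauss n Q)) = 1" .
qed

lemma measurable_gauss_eq: "measurable (gauss n Q) N = measurable (conf_lborel n) N"
  unfolding gauss_def by (intro measurable_cong_sets) simp_all

lemma measurable_gram_row_inner [measurable]:
  "m < n \<Longrightarrow> (\<lambda>Y. w \<bullet> gram_row Y m) \<in> borel_measurable (conf_lborel n)"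
  unfolding inner_vec_def gram_row_def
  by (simp, intro borel_measurable_sum borel_measurable_times borel_measurable_const measurable_conf_component)

text \<open>Completing the square: translating row \<open>m\<close> by
  \<open>- s *\<^sub>R (P *v w)\<close> preserves Lebesgue measure and turns the weight into the
  tilted weight divided by the claimed value.\<close>

lemma gauss_mgf:
  fixes Q P :: "real^'k^'k::finite"
  assumes n: "n \<ge> 1" and Q: "positive_definite Q" and QP: "Q ** P = mat 1" and m: "m < n"
  shows "(\<integral>\<^sup>+Y. ennreal (exp (s * (real n * (w \<bullet> gram_row Y m)))) \<partial>gauss n Q) = ennreal (exp (s\<^sup>2 * (real n * (w \<bullet> (P *v w))) / 2))"
proof -
  define v where "v = P *v w"
  have Qv: "Q *v v = w" by (simp add: v_def matrix_vector_mul_assoc QP)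
  have symQ: "transpose Q = Q" using Q by (simp add: positive_definite_def)
  define V where "V i l = (if l = m then - s * v $ i else 0)" for i l
  define T where "T Y = (\<lambda>i\<in>(UNIV::'k set). \<lambda>l\<in>{..<n}. V i l + Y i l)" for Y :: "'k \<Rightarrow> nat \<Rightarrow> real"
  have T: "distr (conf_lborel n) (conf_lborel n) T = conf_lborel n"
    unfolding T_def by (rule conf_lborel_shift)
  have Tm: "T \<in> conf_lborel n \<rightarrow>\<^sub>M conf_lborel n"
    unfolding T_def by (auto intro!: measurable_restrict borel_measurable_add measurable_conf_component)
  have row: "gram_row (T Y) l = gram_row Y l - (if l = m then s *\<^sub>R v else 0)" if "l < n" for Y l
    using that by (auto simp: gram_row_def T_def V_def vec_eq_iff)
  have gr: "Q \<bullet> gram n (T Y) = Q \<bullet> gram n Y - 2 * s * (w \<bullet> gram_row Y m) + s\<^sup>2 * (w \<bullet> v)" for Y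
  proof -
    have "Q \<bullet> gram n (T Y) = (\<Sum>l<n. gram_row Y l \<bullet> (Q *v gram_row Y l) + (if l = m then - 2 * s * (w \<bullet> gram_row Y m) + s\<^sup>2 * (w \<bullet> v) else 0))"
      unfolding inner_gram
    proof (intro sum.cong refl)
      fix l assume "l \<in> {..<n}"
      have "v \<bullet> (Q *v gram_row Y m) = w \<bullet> gram_row Y m"
        using symmetric_bilinear[OF symQ, of v "gram_row Y m"] by (simp add: Qv inner_commute)
      then show "gram_row (T Y) l \<bullet> (Q *v gram_row (T Y) l) = gram_row Y l \<bullet> (Q *v gram_row Y l) + (if l = m then - 2 * s * (w \<bullet> gram_row Y m) + s\<^sup>2 * (w \<bullet> v) else 0)"
        using \<open>l \<in> {..<n}\<close>
        by (simp add: row matrix_vector_mult_diff_distrib matrix_vector_mult_scaleR Qv inner_diff_left inner_diff_right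
            power2_eq_square inner_commute[of _ w] algebra_simps)
    qed
    also have "\<dots> = Q \<bullet> gram n Y - 2 * s * (w \<bullet> gram_row Y m) + s\<^sup>2 * (w \<bullet> v)"
      using m by (simp add: sum.distrib inner_gram)
    finally show ?thesis .
  qed
  have gw: "gauss_weight n Q (T Y) * exp (s\<^sup>2 * (real n * (w \<bullet> v)) / 2) = exp (s * (real n * (w \<bullet> gram_row Y m))) * gauss_weight n Q Y" for Y
    unfolding gauss_weight_def gr by (simp add: algebra_simps flip: exp_add)
  have "gauss_total n Q = (\<integral>\<^sup>+Y. ennreal (gauss_weight n Q Y) \<partial>distr (conf_lborel n) (conf_lborel n) T)"
    unfolding T gauss_total_def ..
  also have "\<dots> = (\<integral>\<^sup>+Y. ennreal (gauss_weight n Q (T Y)) \<partial>conf_lborel n)"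
    by (rule nn_integral_distr[OF Tm]) measurable
  finally have Z: "gauss_total n Q = (\<integral>\<^sup>+Y. ennreal (gauss_weight n Q (T Y)) \<partial>conf_lborel n)" .
  have gTm: "(\<lambda>Y. ennreal (gauss_weight n Q (T Y))) \<in> borel_measurable (conf_lborel n)"
    using measurable_compose[OF Tm measurable_gauss_weight[of n Q]] by simp
  have "(\<integral>\<^sup>+Y. ennreal (exp (s * (real n * (w \<bullet> gram_row Y m)))) * ennreal (gauss_weight n Q Y) \<partial>conf_lborel n)
     = (\<integral>\<^sup>+Y. ennreal (gauss_weight n Q (T Y)) * ennreal (exp (s\<^sup>2 * (real n * (w \<bullet> v)) / 2)) \<partial>conf_lborel n)"
    by (intro nn_integral_cong) (simp add: gw flip: ennreal_mult)
  also have "\<dots> = gauss_total n Q * ennreal (exp (s\<^sup>2 * (real n * (w \<bullet> v)) / 2))"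
    unfolding Z by (rule nn_integral_multc[OF gTm])
  finally have "(\<integral>\<^sup>+Y. ennreal (exp (s * (real n * (w \<bullet> gram_row Y m)))) \<partial>gauss n Q)
     = gauss_total n Q * ennreal (exp (s\<^sup>2 * (real n * (w \<bullet> v)) / 2)) / gauss_total n Q"
    using m by (subst nn_integral_gauss) auto
  also have "\<dots> = ennreal (exp (s\<^sup>2 * (real n * (w \<bullet> v)) / 2))"
    using gauss_total_finite[OF n Q] gauss_total_pos[of n Q] by (simp add: mult.commute[of "gauss_total n Q"] ennreal_mult_divide_eq)
  finally show ?thesis by (simp add: v_def)
qed

text \<open>By the generating function each row has second moment
  \<open>w \<bullet> (P *v w) / real n\<close> in direction \<open>w\<close>. Summing over the n
  rows gives the form of \<open>P\<close>, and polarisation recovers its entries.\<close>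

lemma gauss_expectation_gram:
  fixes Q P :: "real^'k^'k::finite"
  assumes n: "n \<ge> 1" and Q: "positive_definite Q" and QP: "Q ** P = mat 1"
  shows "has_bochner_integral (gauss n Q) (\<lambda>Y. gram n Y $ i $ j) (P $ i $ j)"
proof -
  interpret prob_space "gauss n Q" by (rule prob_space_gauss[OF n Q])
  have symP: "transpose P = P"
  proof -
    have "transpose P ** Q = mat 1" using arg_cong[OF QP, of transpose] Q
      by (simp add: matrix_transpose_mul positive_definite_def)
    then have "transpose P ** (Q ** P) = P" by (simp add: matrix_mul_assoc)
    then show ?thesis by (simp add: QP)
  qed
  have row: "has_bochner_integral (gauss n Q) (\<lambda>Y. (w \<bullet> gram_row Y m)\<^sup>2) (w \<bullet> (P *v w) / real n)" if m: "m < n" for m w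
  proof -
    have "has_bochner_integral (gauss n Q) (\<lambda>Y. (real n * (w \<bullet> gram_row Y m))\<^sup>2) (real n * (w \<bullet> (P *v w)))"
      by (rule second_moment_if_gaussian_mgf[OF _ gauss_mgf[OF n Q QP m]])
         (use m in \<open>simp add: measurable_gauss_eq\<close>)
    from has_bochner_integral_divide_zero[OF this, of "(real n)\<^sup>2"] show ?thesis
      using n by (simp add: power_mult_distrib power2_eq_square)
  qed
  have form: "w \<bullet> (gram n Y *v w) = (\<Sum>m<n. (w \<bullet> gram_row Y m)\<^sup>2)" for w Y
  proof -
    have "w \<bullet> (gram n Y *v w) = (\<chi> i j. w $ i * w $ j) \<bullet> gram n Y"
      by (simp add: bilinear_form_eq inner_matrix_eq mult_ac)
    also have "\<dots> = (\<Sum>m<n. (w \<bullet> gram_row Y m)\<^sup>2)"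
      unfolding inner_gram by (intro sum.cong refl)
        (unfold bilinear_form_eq, simp add: inner_vec_def power2_eq_square sum_product mult_ac)
    finally show ?thesis .
  qed
  have F: "has_bochner_integral (gauss n Q) (\<lambda>Y. w \<bullet> (gram n Y *v w)) (w \<bullet> (P *v w))" for w
  proof -
    have "has_bochner_integral (gauss n Q) (\<lambda>Y. \<Sum>m<n. (w \<bullet> gram_row Y m)\<^sup>2) (\<Sum>m<n. w \<bullet> (P *v w) / real n)"
      by (intro has_bochner_integral_sum row) auto
    then show ?thesis using n by (simp add: form)
  qed
  have pol: "B $ i $ j = ((axis i 1 + axis j 1) \<bullet> (B *v (axis i 1 + axis j 1)) - axis i 1 \<bullet> (B *v axis i 1) - axis j 1 \<bullet> (B *v axis j 1)) / 2"
    if "transpose B = B" for B :: "real^'k^'k"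
    using symmetric_entry[OF that, of j i]
    by (simp add: matrix_vector_right_distrib inner_add_left inner_add_right bilinear_form_axis)
  show ?thesis
    unfolding pol[OF transpose_gram] pol[OF symP]
    by (intro has_bochner_integral_divide_zero has_bochner_integral_diff F)
qed

lemma gauss_expectation_inner_gram:
  fixes Q P H :: "real^'k^'k::finite"
  assumes "n \<ge> 1" "positive_definite Q" "Q ** P = mat 1"
  shows "has_bochner_integral (gauss n Q) (\<lambda>Y. H \<bullet> gram n Y) (H \<bullet> P)"
  unfolding inner_matrix_eq
  by (intro has_bochner_integral_sum has_bochner_integral_mult_right gauss_expectation_gram assms) 

text \<open>Jensen's inequality is applied under the tilted law: there the mean of the exponent
  \<open>X\<close> is exactly \<open>a\<close>, and the mean of its exponential is the inverse of
  the ratio to be bounded.\<close>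

lemma gauss_total_tilt_le:
  fixes Q P' H :: "real^'k^'k::finite"
  assumes n: "n \<ge> 1" and Q: "positive_definite Q"
    and Q': "positive_definite (Q - \<theta> *\<^sub>R H)" "(Q - \<theta> *\<^sub>R H) ** P' = mat 1"
  shows "gauss_total n (Q - \<theta> *\<^sub>R H) \<le> ennreal (exp (real n / 2 * \<theta> * (H \<bullet> P'))) * gauss_total n Q"
proof -
  let ?Q = "Q - \<theta> *\<^sub>R H"
  interpret prob_space "gauss n ?Q" by (rule prob_space_gauss[OF n Q'(1)])
  define X where "X Y = - (real n / 2) * \<theta> * (H \<bullet> gram n Y)" for Y :: "'k \<Rightarrow> nat \<Rightarrow> real"
  define a where "a = - (real n / 2) * \<theta> * (H \<bullet> P')"
  have X: "has_bochner_integral (gauss n ?Q) X a"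
    unfolding X_def a_def by (intro has_bochner_integral_mult_right gauss_expectation_inner_gram n Q')
  have Xm: "X \<in> borel_measurable (conf_lborel n)" unfolding X_def by measurable
  have w: "gauss_weight n Q Y = exp (X Y) * gauss_weight n ?Q Y" for Y
    by (simp add: gauss_weight_def X_def inner_diff_left algebra_simps flip: exp_add)
  have e: "(\<integral>\<^sup>+Y. ennreal (exp (X Y)) \<partial>gauss n ?Q) = gauss_total n Q / gauss_total n ?Q"
    using Xm by (subst nn_integral_gauss) (auto simp: gauss_total_def[of n Q] w ennreal_mult)
  have fin: "gauss_total n Q / gauss_total n ?Q < \<infinity>"
    using gauss_total_finite[OF n Q] gauss_total_pos[of n ?Q] by (simp add: less_top[symmetric] ennreal_divide_eq_top_iff)
  have int: "integrable (gauss n ?Q) (\<lambda>Y. exp (X Y))"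
    using Xm fin e by (intro integrableI_nonneg) (auto simp: measurable_gauss_eq)
  \<comment> \<open>The tangent line of exp at \<open>a\<close> is integrated, which is Jensen's
    inequality.\<close>
  have "exp a = (\<integral>Y. exp a * (1 + X Y - a) \<partial>gauss n ?Q)"
    using X by (simp add: has_bochner_integral_iff prob_space)
  also have "\<dots> \<le> (\<integral>Y. exp (X Y) \<partial>gauss n ?Q)"
  proof (rule integral_mono[OF _ int])
    show "integrable (gauss n ?Q) (\<lambda>Y. exp a * (1 + X Y - a))"
      using X by (auto simp: has_bochner_integral_iff)
    fix Y
    have "1 + (X Y - a) \<le> exp (X Y - a)" by (rule exp_ge_add_one_self)
    then have "exp a * (1 + (X Y - a)) \<le> exp a * exp (X Y - a)" by (rule mult_left_mono) simp
    then show "exp a * (1 + X Y - a) \<le> exp (X Y)" by (simp add: algebra_simps flip: exp_add)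
  qed
  finally have "ennreal (exp a) \<le> (\<integral>\<^sup>+Y. ennreal (exp (X Y)) \<partial>gauss n ?Q)"
    using int by (subst nn_integral_eq_integral) (auto intro: ennreal_leI)
  then have "ennreal (exp a) * gauss_total n ?Q \<le> gauss_total n Q / gauss_total n ?Q * gauss_total n ?Q"
    unfolding e by (rule mult_right_mono) simp
  also have "\<dots> = gauss_total n Q"
    using ennreal_mult_divide_cancel[of "gauss_total n ?Q" "gauss_total n Q"] gauss_total_pos[of n ?Q] gauss_total_finite[OF n Q'(1)]
    by (simp add: mult.commute)
  finally have "ennreal (exp (- a)) * (ennreal (exp a) * gauss_total n ?Q) \<le> ennreal (exp (- a)) * gauss_total n Q"
    by (rule mult_left_mono) simp
  moreover have "ennreal (exp (- a)) * ennreal (exp a) = 1" by (simp flip: ennreal_mult exp_add)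
  ultimately show ?thesis by (simp add: a_def flip: mult.assoc)
qed

section \<open>Comparison of the Gaussian model with the spheres\<close>

text \<open>Entrywise distance, so that finitely many linear functionals and a union bound control
  it; passing to the Frobenius norm costs only a factor k^2.\<close>

definition entry_far :: "real^'k^'k::finite \<Rightarrow> real \<Rightarrow> real^'k^'k \<Rightarrow> bool" where
  "entry_far P s G \<longleftrightarrow> (\<exists>i j. s \<le> \<bar>G $ i $ j - P $ i $ j\<bar>)"

lemma sets_entry_far [measurable]: "{G. entry_far P s G} \<in> sets borel"
proof -
  have "{G. entry_far P s G} = (\<Union>i. \<Union>j. {G. s \<le> \<bar>G $ i $ j - P $ i $ j\<bar>})" by (auto simp: entry_far_def)
  moreover have "closed {G. s \<le> \<bar>G $ i $ j - P $ i $ j\<bar>}" for i j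
    by (intro closed_Collect_le continuous_intros)
  ultimately have "closed {G. entry_far P s G}" by (simp only:) (intro closed_UN, auto)
  then show ?thesis by (rule borel_closed)
qed

lemma pred_entry_far_gram [measurable]: "Measurable.pred (conf_lborel n) (\<lambda>Y. entry_far P s (gram n Y))"
  using measurable_sets[OF measurable_gram_conf sets_entry_far[of P s]]
  by (simp add: pred_def vimage_def Int_def conj_commute)

text \<open>Exponential Markov inequality with the tilt \<theta> H, which replaces the mean
  \<open>P\<close> of the Gram matrix by \<open>P'\<close>. The resolvent identity bounds
  \<open>H \<bullet> P' - H \<bullet> P\<close> by \<theta> C, so the exponent is at most (n/2)
  \<theta> (\<theta> C - s).\<close>

lemma gauss_chernoff:
  fixes Q P :: "real^'k^'k::finite"
  assumes Q: "positive_definite Q" and QP: "Q ** P = mat 1"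
  obtains c s0 where "c > 0" "s0 > 0"
    "\<And>n s H. n \<ge> 1 \<Longrightarrow> 0 < s \<Longrightarrow> s \<le> s0 \<Longrightarrow> transpose H = H \<Longrightarrow> norm H \<le> 1 \<Longrightarrow>
       emeasure (gauss n Q) {Y \<in> space (conf_lborel n). s \<le> H \<bullet> (gram n Y - P)} \<le> ennreal (exp (- c * real n * s\<^sup>2))"
proof -
  obtain l where l: "l > 0" "\<And>v. l * (v \<bullet> v) \<le> v \<bullet> (Q *v v)"
    using positive_definite_lower_bound[OF Q] by blast
  define C where "C = real CARD('k) * real CARD('k) / (l / 2) * norm P + 1"
  have C: "C > 0" using l(1) by (simp add: C_def add_nonneg_pos)
  have symQ: "transpose Q = Q" using Q by (simp add: positive_definite_def)
  show ?thesis
  proof (rule that[of "1 / (8 * C)" "l * C"])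
    show "1 / (8 * C) > 0" "l * C > 0" using C l by simp_all
    fix n :: nat and s :: real and H :: "real^'k^'k"
    assume n: "n \<ge> 1" and s: "0 < s" "s \<le> l * C" and H: "transpose H = H" "norm H \<le> 1"
    \<comment> \<open>The minimiser of \<theta> (\<theta> C - s), which yields the rate 1/(8 C). The
      restriction \<open>s \<le> l * C\<close> gives \<theta> \<le> l/2, so the tilted matrix keeps
      half of the coercivity of \<open>Q\<close>.\<close>
    define \<theta> where "\<theta> = s / (2 * C)"
    have th: "0 < \<theta>" "\<theta> \<le> l / 2" using s C by (simp_all add: \<theta>_def field_simps)
    let ?Q = "Q - \<theta> *\<^sub>R H"
    have "\<theta> * norm H \<le> \<theta> * 1" by (rule mult_left_mono[OF H(2)]) (use th in simp)
    moreover have "\<bar>- \<theta>\<bar> * norm H = \<theta> * norm H" using th by simp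
    ultimately have "\<bar>- \<theta>\<bar> * norm H \<le> l / 2" using th by linarith
    then have lQ: "l / 2 * (v \<bullet> v) \<le> v \<bullet> (?Q *v v)" for v
      using positive_definite_perturbation[OF H(1) symQ l(2), of "- \<theta>" v] by simp
    have "transpose ?Q = ?Q" using symQ H(1) by (simp add: transpose_def vec_eq_iff)
    then have Q': "positive_definite ?Q"
      by (rule positive_definiteI_lower_bound[OF _ _ lQ]) (use l in simp)
    obtain P' where P': "positive_definite P'" "P' ** ?Q = mat 1" "?Q ** P' = mat 1"
      using positive_definite_inverse[OF Q'] .
    have nP': "norm P' \<le> real CARD('k) * real CARD('k) / (l / 2)"
      by (rule norm_inverse_le[OF _ lQ P'(3)]) (use l in simp)
    have "H \<bullet> P' - H \<bullet> P = \<theta> * (H \<bullet> (P' ** H ** P))"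
    proof -
      have "P' - P = P' ** (Q - ?Q) ** P" by (rule inverse_difference[OF P'(2) QP])
      then show ?thesis by (simp add: matrix_scaleR_left matrix_scaleR_right flip: inner_diff_right)
    qed
    also have "\<dots> \<le> \<theta> * C"
    proof (rule mult_left_mono)
      have "H \<bullet> (P' ** H ** P) \<le> norm H * norm (P' ** H ** P)" by (rule norm_cauchy_schwarz)
      also have "\<dots> \<le> 1 * (norm P' * 1 * norm P)"
      proof (rule mult_mono[OF H(2)])
        have "norm (P' ** H ** P) \<le> norm (P' ** H) * norm P" by (rule norm_matrix_mult_le)
        also have "norm (P' ** H) \<le> norm P' * norm H" by (rule norm_matrix_mult_le)
        also have "norm P' * norm H \<le> norm P' * 1" by (rule mult_left_mono[OF H(2)]) simp
        finally show "norm (P' ** H ** P) \<le> norm P' * 1 * norm P" by (simp add: mult_right_mono)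
      qed auto
      also have "\<dots> \<le> real CARD('k) * real CARD('k) / (l / 2) * norm P"
        using mult_right_mono[OF nP', of "norm P"] by simp
      finally show "H \<bullet> (P' ** H ** P) \<le> C" by (simp add: C_def)
    qed (use th in simp)
    finally have HP: "H \<bullet> P' - H \<bullet> P \<le> \<theta> * C" .
    define e where "e Y = real n / 2 * \<theta> * (H \<bullet> gram n Y) - real n / 2 * \<theta> * (H \<bullet> P + s)" for Y :: "'k \<Rightarrow> nat \<Rightarrow> real"
    have em: "e \<in> borel_measurable (conf_lborel n)" unfolding e_def by measurable
    have w: "exp (e Y) * gauss_weight n Q Y = exp (- (real n / 2 * \<theta> * (H \<bullet> P + s))) * gauss_weight n ?Q Y" for Y
      by (simp add: e_def gauss_weight_def inner_diff_left algebra_simps flip: exp_add)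
    let ?F = "{Y \<in> space (conf_lborel n). s \<le> H \<bullet> (gram n Y - P)}"
    have F: "?F \<in> sets (conf_lborel n)" by measurable
    have "emeasure (gauss n Q) ?F = (\<integral>\<^sup>+Y. indicator ?F Y \<partial>gauss n Q)"
      by (rule nn_integral_indicator[symmetric]) (use F in \<open>simp add: gauss_def\<close>)
    also have "\<dots> \<le> (\<integral>\<^sup>+Y. ennreal (exp (e Y)) \<partial>gauss n Q)"
    proof (rule nn_integral_mono)
      fix Y
      show "indicator ?F Y \<le> ennreal (exp (e Y))"
      proof (cases "Y \<in> ?F")
        case True
        then have "0 \<le> real n / 2 * \<theta> * (H \<bullet> gram n Y - H \<bullet> P - s)"
          using th by (intro mult_nonneg_nonneg) (auto simp: inner_diff_right)
        then have "0 \<le> e Y" by (simp add: e_def algebra_simps)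
        then show ?thesis using True by simp
      qed simp
    qed
    also have "\<dots> = (\<integral>\<^sup>+Y. ennreal (exp (e Y)) * ennreal (gauss_weight n Q Y) \<partial>conf_lborel n) / gauss_total n Q"
      by (rule nn_integral_gauss[OF measurable_compose[OF em]]) measurable
    also have "(\<integral>\<^sup>+Y. ennreal (exp (e Y)) * ennreal (gauss_weight n Q Y) \<partial>conf_lborel n)
      = (\<integral>\<^sup>+Y. ennreal (exp (- (real n / 2 * \<theta> * (H \<bullet> P + s)))) * ennreal (gauss_weight n ?Q Y) \<partial>conf_lborel n)"
      by (intro nn_integral_cong) (simp add: w flip: ennreal_mult)
    also have "\<dots> = ennreal (exp (- (real n / 2 * \<theta> * (H \<bullet> P + s)))) * gauss_total n ?Q"
      unfolding gauss_total_def by (rule nn_integral_cmult) measurable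
    also have "\<dots> / gauss_total n Q \<le> (ennreal (exp (- (real n / 2 * \<theta> * (H \<bullet> P + s)))) * (ennreal (exp (real n / 2 * \<theta> * (H \<bullet> P'))) * gauss_total n Q)) / gauss_total n Q"
      by (intro divide_right_mono_ennreal mult_left_mono gauss_total_tilt_le n Q Q' P'(3)) simp
    also have "\<dots> = ennreal (exp (- (real n / 2 * \<theta> * (H \<bullet> P + s)))) * ennreal (exp (real n / 2 * \<theta> * (H \<bullet> P')))"
      using gauss_total_finite[OF n Q] gauss_total_pos[of n Q] by (simp add: ennreal_mult_divide_eq flip: mult.assoc)
    also have "\<dots> = ennreal (exp (real n / 2 * \<theta> * (H \<bullet> P' - H \<bullet> P - s)))"
      by (simp add: algebra_simps flip: ennreal_mult exp_add)
    also have "\<dots> \<le> ennreal (exp (- (1 / (8 * C)) * real n * s\<^sup>2))"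
    proof -
      have "real n / 2 * \<theta> * (H \<bullet> P' - H \<bullet> P - s) \<le> real n / 2 * \<theta> * (\<theta> * C - s)"
        using HP th by (intro mult_left_mono) auto
      also have "\<dots> = - (1 / (8 * C)) * real n * s\<^sup>2"
        using C by (simp add: \<theta>_def field_simps power2_eq_square)
      finally show ?thesis by (intro ennreal_leI) simp
    qed
    finally show "emeasure (gauss n Q) ?F \<le> ennreal (exp (- (1 / (8 * C)) * real n * s\<^sup>2))" .
  qed
qed

lemma gauss_entry_far:
  fixes Q P :: "real^'k^'k::finite"
  assumes Q: "positive_definite Q" and QP: "Q ** P = mat 1" and symP: "transpose P = P"
  obtains c s0 where "c > 0" "s0 > 0"
    "\<And>n s. n \<ge> 1 \<Longrightarrow> 0 < s \<Longrightarrow> s \<le> s0 \<Longrightarrow>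
       emeasure (gauss n Q) {Y \<in> space (conf_lborel n). entry_far P s (gram n Y)} \<le> ennreal (2 * (real CARD('k))\<^sup>2 * exp (- c * real n * s\<^sup>2))"
proof -
  obtain c s0 where c: "c > 0" "s0 > 0" and ch: "\<And>n s H. n \<ge> 1 \<Longrightarrow> 0 < s \<Longrightarrow> s \<le> s0 \<Longrightarrow> transpose H = H \<Longrightarrow> norm H \<le> 1 \<Longrightarrow>
       emeasure (gauss n Q) {Y \<in> space (conf_lborel n). s \<le> H \<bullet> (gram n Y - P)} \<le> ennreal (exp (- c * real n * s\<^sup>2))"
    using gauss_chernoff[OF Q QP] by blast
  \<comment> \<open>Symmetrised matrix units, because the Chernoff bound asks for symmetric
    directions of norm at most 1. With both signs there are 2 k^2 events in the union bound.\<close>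
  define H :: "'k \<times> 'k \<Rightarrow> real^'k^'k" where
    "H = (\<lambda>(i, j). (1/2) *\<^sub>R axis i (axis j 1) + (1/2) *\<^sub>R axis j (axis i 1))"
  have H: "transpose (H z) = H z" for z
    by (cases z) (auto simp: H_def transpose_def vec_eq_iff axis_def)
  have nH: "norm (H z) \<le> 1" for z
    unfolding H_def by (cases z) (auto intro!: order_trans[OF norm_triangle_ineq] simp: norm_eq_sqrt_inner[of "axis _ _"] inner_axis_axis)
  have HB: "H (i, j) \<bullet> B = B $ i $ j" if "transpose B = B" for i j and B :: "real^'k^'k"
    using symmetric_entry[OF that, of j i] by (simp add: H_def inner_add_left inner_axis')
  show ?thesis
  proof (rule that[OF c])
    fix n :: nat and s :: real assume n: "n \<ge> 1" and s: "0 < s" "s \<le> s0"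
    let ?E = "\<lambda>H. {Y \<in> space (conf_lborel n). s \<le> H \<bullet> (gram n Y - P)}"
    have E: "?E H \<in> sets (gauss n Q)" for H unfolding gauss_def by simp measurable
    have nH': "norm (- H z) \<le> 1" "transpose (- H z) = - H z" for z using nH[of z] H[of z] by (simp_all add: transpose_def vec_eq_iff)
    have "{Y \<in> space (conf_lborel n). entry_far P s (gram n Y)} \<subseteq> (\<Union>z. ?E (H z) \<union> ?E (- H z))"
    proof
      fix Y :: "'k \<Rightarrow> nat \<Rightarrow> real" assume "Y \<in> {Y \<in> space (conf_lborel n). entry_far P s (gram n Y)}"
      then obtain i j where Y: "Y \<in> space (conf_lborel n)" and ij: "s \<le> \<bar>(gram n Y - P) $ i $ j\<bar>"
        by (auto simp: entry_far_def)
      have "transpose (gram n Y - P) = gram n Y - P"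
        using transpose_gram[of n Y] symP by (simp add: transpose_def vec_eq_iff)
      from HB[OF this, of i j] ij have "s \<le> H (i, j) \<bullet> (gram n Y - P) \<or> s \<le> - H (i, j) \<bullet> (gram n Y - P)"
        by (simp only: inner_minus_left) linarith
      then show "Y \<in> (\<Union>z. ?E (H z) \<union> ?E (- H z))" using Y by blast
    qed
    then have "emeasure (gauss n Q) {Y \<in> space (conf_lborel n). entry_far P s (gram n Y)} \<le> emeasure (gauss n Q) (\<Union>z. ?E (H z) \<union> ?E (- H z))"
      by (rule emeasure_mono) (intro sets.finite_UN sets.Un E finite)
    also have "\<dots> \<le> (\<Sum>z\<in>UNIV. emeasure (gauss n Q) (?E (H z) \<union> ?E (- H z)))"
      by (rule emeasure_subadditive_finite) (auto intro!: sets.Un E simp del: inner_minus_left)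
    also have "\<dots> \<le> (\<Sum>z\<in>(UNIV :: ('k \<times> 'k) set). ennreal (exp (- c * real n * s\<^sup>2)) + ennreal (exp (- c * real n * s\<^sup>2)))"
      by (intro sum_mono order_trans[OF emeasure_subadditive] add_mono E ch n s H nH nH')
    also have "\<dots> = ennreal (2 * (real CARD('k))\<^sup>2 * exp (- c * real n * s\<^sup>2))"
      by (simp add: power2_eq_square ennreal_mult ennreal_of_nat_eq_real_of_nat mult_2[symmetric] mult_ac flip: ennreal_plus)
    finally show "emeasure (gauss n Q) {Y \<in> space (conf_lborel n). entry_far P s (gram n Y)} \<le> ennreal (2 * (real CARD('k))\<^sup>2 * exp (- c * real n * s\<^sup>2))" .
  qed
qed

section \<open>Radial comparison in both directions\<close>

lemma gram_diag: "gram n Y $ i $ i = (L2_set (Y i) {..<n})\<^sup>2"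
  by (simp add: gram_def vec_inner_def L2_set_def sum_nonneg power2_eq_square)

lemma gram_normalize:
  assumes "\<And>i. L2_set (Y i) {..<n} > 0"
  shows "gram n (\<lambda>i. normalize_vec n (Y i)) $ i $ j = gram n Y $ i $ j / (L2_set (Y i) {..<n} * L2_set (Y j) {..<n})"
  by (simp add: gram_def vec_inner_def normalize_vec_def sum_divide_distrib)

lemma abs_gram_le:
  assumes "\<And>i. L2_set (Y i) {..<n} = 1" shows "\<bar>gram n Y $ i $ j\<bar> \<le> 1"
  using abs_vec_inner_le[of n "Y i" "Y j"] assms by (simp add: gram_def)

lemma L2_set_normalize_vec:
  assumes "L2_set y {..<n} > 0" shows "L2_set (normalize_vec n y) {..<n} = 1"
proof -
  have "(L2_set (normalize_vec n y) {..<n})\<^sup>2 = 1"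
  proof -
    have "(L2_set (normalize_vec n y) {..<n})\<^sup>2 = gram n (\<lambda>_::unit. normalize_vec n y) $ () $ ()"
      by (simp only: gram_diag)
    also have "\<dots> = gram n (\<lambda>_::unit. y) $ () $ () / (L2_set y {..<n} * L2_set y {..<n})"
      by (rule gram_normalize) (rule assms)
    also have "\<dots> = 1" using assms by (simp add: gram_diag power2_eq_square)
    finally show ?thesis .
  qed
  then show ?thesis using L2_set_nonneg[of "normalize_vec n y" "{..<n}"] by (simp add: power2_eq_1_iff)
qed

abbreviation entry_sum :: "real^'k^'k::finite \<Rightarrow> real" where
  "entry_sum Q \<equiv> (\<Sum>i\<in>UNIV. \<Sum>j\<in>UNIV. \<bar>Q $ i $ j\<bar>)"

lemma abs_inner_matrix_le:
  fixes Q B :: "real^'k^'k::finite"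
  assumes "\<And>i j. \<bar>B $ i $ j\<bar> \<le> b"
  shows "\<bar>Q \<bullet> B\<bar> \<le> (entry_sum Q) * b"
proof -
  have "\<bar>Q \<bullet> B\<bar> \<le> (\<Sum>i\<in>UNIV. \<Sum>j\<in>UNIV. \<bar>Q $ i $ j * B $ i $ j\<bar>)"
    unfolding inner_matrix_eq by (intro order_trans[OF sum_abs] sum_mono sum_abs)
  also have "\<dots> \<le> (\<Sum>i\<in>UNIV. \<Sum>j\<in>UNIV. \<bar>Q $ i $ j\<bar> * b)"
    unfolding abs_mult by (intro sum_mono mult_left_mono assms) simp
  finally show ?thesis by (simp add: sum_distrib_right)
qed

text \<open>Radii within 1/n of 1 move each Gram entry by at most 2/n, so the factor n/2 in the
  exponent leaves an error of at most \<open>entry_sum Q\<close>, uniformly in n.\<close>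

lemma thin_shell_comparison:
  fixes Q P :: "real^'k^'k::finite" and Y :: "'k \<Rightarrow> nat \<Rightarrow> real"
  assumes n: "n \<ge> 2" and r: "\<And>i. L2_set (Y i) {..<n} \<in> {1 - 1 / real n <.. 1}"
  defines "U \<equiv> \<lambda>i. normalize_vec n (Y i)"
  shows "\<bar>(gram n Y - gram n U) $ i $ j\<bar> \<le> 2 / real n"
    and "gauss_weight n Q U \<le> exp (entry_sum Q) * gauss_weight n Q Y"
proof -
  define \<rho> where "\<rho> i = L2_set (Y i) {..<n}" for i
  have n1: "1 / real n \<le> 1 / 2" using n by (simp add: field_simps)
  have \<rho>: "1 - 1 / real n < \<rho> i" "\<rho> i \<le> 1" "\<rho> i > 0" for i using r[of i] n1 by (auto simp: \<rho>_def)
  have U: "gram n Y $ i $ j = \<rho> i * \<rho> j * gram n U $ i $ j" for i j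
    using gram_normalize[of Y n i j] \<rho>(3) unfolding U_def \<rho>_def by (simp add: less_imp_neq[symmetric])
  have U1: "\<bar>gram n U $ i $ j\<bar> \<le> 1" for i j
    by (rule abs_gram_le) (use \<rho>(3) in \<open>simp add: U_def \<rho>_def L2_set_normalize_vec\<close>)
  show e: "\<bar>(gram n Y - gram n U) $ i $ j\<bar> \<le> 2 / real n" for i j
  proof -
    have "(1 - \<rho> i) * (1 - \<rho> j) \<ge> 0" using \<rho> by (intro mult_nonneg_nonneg) (auto simp: less_imp_le)
    then have "1 - \<rho> i * \<rho> j \<le> (1 - \<rho> i) + (1 - \<rho> j)" by (simp add: algebra_simps)
    also have "\<dots> \<le> 2 / real n" using \<rho>(1)[of i] \<rho>(1)[of j] by simp
    finally have 1: "1 - \<rho> i * \<rho> j \<le> 2 / real n" .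
    have 0: "\<rho> i * \<rho> j \<le> 1" using \<rho> by (simp add: mult_le_one less_imp_le)
    have "(gram n Y - gram n U) $ i $ j = - ((1 - \<rho> i * \<rho> j) * gram n U $ i $ j)"
      by (simp add: U algebra_simps)
    then have "\<bar>(gram n Y - gram n U) $ i $ j\<bar> = (1 - \<rho> i * \<rho> j) * \<bar>gram n U $ i $ j\<bar>"
      using 0 by (simp only: abs_minus_cancel abs_mult abs_of_nonneg diff_ge_0_iff_ge)
    also have "\<dots> \<le> (2 / real n) * 1" using 0 by (intro mult_mono 1 U1) auto
    finally show ?thesis by simp
  qed
  have "\<bar>Q \<bullet> (gram n Y - gram n U)\<bar> \<le> (entry_sum Q) * (2 / real n)"
    by (rule abs_inner_matrix_le) (rule e)
  then have "real n / 2 * (Q \<bullet> (gram n Y - gram n U)) \<le> real n / 2 * ((entry_sum Q) * (2 / real n))"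
    by (intro mult_left_mono) auto
  also have "\<dots> = (entry_sum Q)" using n by simp
  finally have "- (real n / 2) * (Q \<bullet> gram n U) \<le> (entry_sum Q) + - (real n / 2) * (Q \<bullet> gram n Y)"
    by (simp add: inner_diff_right right_diff_distrib)
  then show "gauss_weight n Q U \<le> exp (entry_sum Q) * gauss_weight n Q Y"
    unfolding gauss_weight_def by (subst exp_add[symmetric]) simp
qed

text \<open>On the bulk of the Gaussian measure the radii are \<open>1 + O(1/\<surd>n)\<close>. Since \<open>(QP)\<^sub>i\<^sub>i = 1\<close>, the first-order effect
  of the radii on the exponent cancels the volume factor \<open>\<Prod> r\<^sub>i\<^sup>n\<close>.\<close>
lemma bulk_comparison:
  fixes Q P :: "real^'k^'k::finite" and Y :: "'k \<Rightarrow> nat \<Rightarrow> real"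
  assumes P: "sdp_feasible P" and QP: "Q ** P = mat 1" and n: "n \<ge> 1"
    and d: "\<delta> \<le> 1 / 4" "real n * \<delta>\<^sup>2 \<le> D" and Y: "\<not> entry_far P \<delta> (gram n Y)"
  defines "U \<equiv> \<lambda>i. normalize_vec n (Y i)"
  shows "L2_set (Y i) {..<n} \<in> {1/2<..2}"
    and "gauss_weight n Q Y \<le> exp (D * (2 * real CARD('k) + 2 * entry_sum Q))
       * ((\<Prod>i\<in>UNIV. 1 / L2_set (Y i) {..<n} ^ n) * gauss_weight n Q U)"
proof -
  define q where "q = (entry_sum Q)"
  have q0: "q \<ge> 0" by (simp add: q_def sum_nonneg)
  define G where "G = gram n Y"
  define r where "r i = L2_set (Y i) {..<n}" for i
  have GP: "\<bar>G $ i $ j - P $ i $ j\<bar> < \<delta>" for i j using Y by (auto simp: entry_far_def G_def not_le)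
  have d0: "\<delta> > 0" using GP[of undefined undefined] by linarith
  have Pd: "P $ i $ i = 1" for i using P by (simp add: sdp_feasible_def)
  have symP: "transpose P = P" using P by (simp add: sdp_feasible_def positive_semidefinite_def)
  have r2: "\<bar>(r i)\<^sup>2 - 1\<bar> < \<delta>" for i using GP[of i i] by (simp add: G_def gram_diag Pd r_def)
  have r0: "r i \<ge> 0" for i by (simp add: r_def)
  have r1: "3/4 \<le> r i" "r i \<le> 2" for i
  proof -
    have "(3/4)\<^sup>2 \<le> (r i)\<^sup>2" "(r i)\<^sup>2 \<le> 2\<^sup>2" using r2[of i] d(1) by (auto simp: power2_eq_square abs_less_iff)
    then show "3/4 \<le> r i" "r i \<le> 2" using r0[of i] by (auto intro: power2_le_imp_le)
  qed
  show "L2_set (Y i) {..<n} \<in> {1/2<..2}" for i using r1[of i] by (auto simp: r_def)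
  have rp: "r i > 0" for i using r1[of i] by simp
  \<comment> \<open>Deviations of the inverse radii: normalisation multiplies the Gram entries
    exactly by (1 + a i) (1 + a j).\<close>
  define a where "a i = 1 / r i - 1" for i
  have ra: "1 / r i = 1 + a i" for i by (simp add: a_def)
  have a: "\<bar>a i\<bar> \<le> \<delta>" for i
  proof -
    have "3/4 * (7/4) \<le> r i * (1 + r i)" using r1[of i] by (intro mult_mono) auto
    then have ge: "1 \<le> r i * (1 + r i)" by simp
    have "a i * (r i * (1 + r i)) = 1 - (r i)\<^sup>2" using rp[of i] by (simp add: a_def field_simps power2_eq_square)
    then have "\<bar>a i\<bar> * (r i * (1 + r i)) = \<bar>(r i)\<^sup>2 - 1\<bar>" using rp[of i] by (simp add: abs_mult[symmetric] abs_minus_commute abs_mult_pos)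
    moreover have "\<bar>a i\<bar> * 1 \<le> \<bar>a i\<bar> * (r i * (1 + r i))" using ge by (intro mult_left_mono) auto
    ultimately show ?thesis using r2[of i] by simp
  qed
  have lnr: "ln (r i) \<le> - a i + 2 * \<delta>\<^sup>2" for i
  proof -
    have "ln (r i) = - ln (1 + a i)" using rp[of i] by (simp add: ra[symmetric] ln_div)
    moreover have "\<bar>ln (1 + a i) - a i\<bar> \<le> 2 * (a i)\<^sup>2"
      by (rule abs_ln_one_plus_x_minus_x_bound) (use a[of i] d(1) in simp)
    moreover have "(a i)\<^sup>2 \<le> \<delta>\<^sup>2" using a[of i] d0 by (simp add: abs_le_square_iff[symmetric])
    ultimately show ?thesis by linarith
  qed
  have UG: "gram n U $ i $ j = G $ i $ j * ((1 + a i) * (1 + a j))" for i j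
    using gram_normalize[of Y n i j] rp unfolding U_def r_def[symmetric] G_def[symmetric] by (simp add: ra[symmetric])
  have b1: "\<bar>((G - P) $ i $ j) * (a i + a j)\<bar> \<le> \<delta> * (2 * \<delta>)" for i j
    unfolding abs_mult
  proof (rule mult_mono)
    show "\<bar>(G - P) $ i $ j\<bar> \<le> \<delta>" using GP[of i j] by simp
    show "\<bar>a i + a j\<bar> \<le> 2 * \<delta>" using a[of i] a[of j] by linarith
  qed (use d0 in auto)
  have b2: "\<bar>G $ i $ j * (a i * a j)\<bar> \<le> 2 * (\<delta> * \<delta>)" for i j
    unfolding abs_mult
  proof (intro mult_mono)
    show "\<bar>G $ i $ j\<bar> \<le> 2" using GP[of i j] d(1) sdp_feasible_entry_le[OF P, of i j] by linarith
  qed (use a d0 in auto)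
  have QPs: "Q \<bullet> (\<chi> i j. P $ i $ j * (a i + a j)) = 2 * (\<Sum>i\<in>UNIV. a i)"
  proof -
    have row: "(\<Sum>j\<in>UNIV. Q $ i $ j * P $ i $ j) = 1" for i
    proof -
      have "(\<Sum>j\<in>UNIV. Q $ i $ j * P $ i $ j) = (Q ** P) $ i $ i"
        by (simp add: matrix_matrix_mult_def symmetric_entry[OF symP, of i])
      then show ?thesis by (simp add: QP mat_def)
    qed
    have col: "(\<Sum>i\<in>UNIV. Q $ i $ j * P $ i $ j) = 1" for j
    proof -
      have "P ** Q = mat 1" using QP by (simp add: matrix_left_right_inverse)
      moreover have "(\<Sum>i\<in>UNIV. Q $ i $ j * P $ i $ j) = (P ** Q) $ j $ j"
        by (simp add: matrix_matrix_mult_def symmetric_entry[OF symP, of j] mult.commute)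
      ultimately show ?thesis by (simp add: mat_def)
    qed
    have "Q \<bullet> (\<chi> i j. P $ i $ j * (a i + a j)) = (\<Sum>i\<in>UNIV. \<Sum>j\<in>UNIV. a i * (Q $ i $ j * P $ i $ j)) + (\<Sum>i\<in>UNIV. \<Sum>j\<in>UNIV. a j * (Q $ i $ j * P $ i $ j))"
      by (simp add: inner_matrix_eq sum.distrib[symmetric] algebra_simps)
    also have "(\<Sum>i\<in>UNIV. \<Sum>j\<in>UNIV. a j * (Q $ i $ j * P $ i $ j)) = (\<Sum>j\<in>UNIV. \<Sum>i\<in>UNIV. a j * (Q $ i $ j * P $ i $ j))"
      by (rule sum.swap)
    finally show ?thesis by (simp add: sum_distrib_left[symmetric] row col)
  qed
  \<comment> \<open>Only the first summand is of first order in \<delta>. The other two are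
    quadratic and cost O(n \<delta>^2) = O(D) in the exponent.\<close>
  have "gram n U - G = (\<chi> i j. P $ i $ j * (a i + a j)) + (\<chi> i j. ((G - P) $ i $ j) * (a i + a j)) + (\<chi> i j. G $ i $ j * (a i * a j))"
    by (simp add: vec_eq_iff UG algebra_simps)
  then have "Q \<bullet> (gram n U - G) = 2 * (\<Sum>i\<in>UNIV. a i) + Q \<bullet> (\<chi> i j. ((G - P) $ i $ j) * (a i + a j)) + Q \<bullet> (\<chi> i j. G $ i $ j * (a i * a j))"
    by (simp add: inner_add_right QPs)
  moreover have "\<bar>Q \<bullet> (\<chi> i j. ((G - P) $ i $ j) * (a i + a j))\<bar> \<le> q * (\<delta> * (2 * \<delta>))"
    unfolding q_def using b1 by (intro abs_inner_matrix_le) simp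
  moreover have "\<bar>Q \<bullet> (\<chi> i j. G $ i $ j * (a i * a j))\<bar> \<le> q * (2 * (\<delta> * \<delta>))"
    unfolding q_def using b2 by (intro abs_inner_matrix_le) simp
  ultimately have 1: "Q \<bullet> (gram n U - G) \<le> 2 * (\<Sum>i\<in>UNIV. a i) + 4 * q * \<delta>\<^sup>2"
    by (simp add: power2_eq_square abs_le_iff)
  have 2: "(\<Sum>i\<in>UNIV. ln (r i)) \<le> - (\<Sum>i\<in>UNIV. a i) + real CARD('k) * (2 * \<delta>\<^sup>2)"
  proof -
    have "(\<Sum>i\<in>UNIV. ln (r i)) \<le> (\<Sum>i\<in>(UNIV::'k set). - a i + 2 * \<delta>\<^sup>2)" by (intro sum_mono lnr)
    then show ?thesis by (simp add: sum_subtractf)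
  qed
  \<comment> \<open>After halving, the sum of the \<open>a i\<close> in \<open>1\<close> meets its
    negative in \<open>2\<close>; this is the cancellation.\<close>
  have 3: "(\<Sum>i\<in>UNIV. ln (r i)) + Q \<bullet> (gram n U - G) / 2 \<le> \<delta>\<^sup>2 * (2 * real CARD('k) + 2 * q)"
  proof -
    have "\<delta>\<^sup>2 * (2 * real CARD('k) + 2 * q) = real CARD('k) * (2 * \<delta>\<^sup>2) + (4 * q * \<delta>\<^sup>2) / 2"
      by (simp add: algebra_simps)
    then show ?thesis using 1 2 by linarith
  qed
  have "real n * ((\<Sum>i\<in>UNIV. ln (r i)) + Q \<bullet> (gram n U - G) / 2) \<le> real n * (\<delta>\<^sup>2 * (2 * real CARD('k) + 2 * q))"
    by (rule mult_left_mono[OF 3]) simp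
  also have "\<dots> = (real n * \<delta>\<^sup>2) * (2 * real CARD('k) + 2 * q)" by simp
  also have "\<dots> \<le> D * (2 * real CARD('k) + 2 * q)" using d(2) q0 by (intro mult_right_mono) auto
  finally have 5: "real n * ((\<Sum>i\<in>UNIV. ln (r i)) + Q \<bullet> (gram n U - G) / 2) \<le> D * (2 * real CARD('k) + 2 * q)" .
  have 4: "- (real n / 2) * (Q \<bullet> G) \<le> D * (2 * real CARD('k) + 2 * q) + ((\<Sum>i\<in>UNIV. - real n * ln (r i)) + - (real n / 2) * (Q \<bullet> gram n U))"
  proof -
    have "(\<Sum>i\<in>UNIV. - real n * ln (r i)) = - (real n * (\<Sum>i\<in>UNIV. ln (r i)))"
      by (simp add: sum_distrib_left sum_negf)
    moreover have "real n * ((\<Sum>i\<in>UNIV. ln (r i)) + Q \<bullet> (gram n U - G) / 2)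
        = real n * (\<Sum>i\<in>UNIV. ln (r i)) + real n / 2 * (Q \<bullet> gram n U) - real n / 2 * (Q \<bullet> G)"
      by (simp add: inner_diff_right field_simps)
    ultimately show ?thesis using 5 by linarith
  qed
  have "exp (\<Sum>i\<in>UNIV. - real n * ln (r i)) = (\<Prod>i\<in>UNIV. 1 / r i ^ n)"
    unfolding exp_sum[OF finite_class.finite_UNIV]
  proof (intro prod.cong refl)
    fix i
    have "exp (real n * ln (r i)) = r i ^ n" using rp[of i] by (simp add: exp_of_nat_mult)
    then show "exp (- real n * ln (r i)) = 1 / r i ^ n" by (simp add: exp_minus field_simps)
  qed
  moreover have "gauss_weight n Q Y \<le> exp (D * (2 * real CARD('k) + 2 * q) + ((\<Sum>i\<in>UNIV. - real n * ln (r i)) + - (real n / 2) * (Q \<bullet> gram n U)))"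
    unfolding gauss_weight_def G_def[symmetric] using 4 by simp
  ultimately show "gauss_weight n Q Y \<le> exp (D * (2 * real CARD('k) + 2 * entry_sum Q))
       * ((\<Prod>i\<in>UNIV. 1 / L2_set (Y i) {..<n} ^ n) * gauss_weight n Q U)"
    by (simp only: exp_add q_def[symmetric] r_def[symmetric]) (simp add: gauss_weight_def)
qed

text \<open>A majorant of the scale-invariant density \<open>r\<^sup>-\<^sup>n\<close>, constant on shells of ratio \<open>1 + 1/n\<close> so that its integral is explicit.\<close>
lemma shell_majorant:
  assumes n: "n \<ge> 1"
  obtains h :: "real \<Rightarrow> ennreal" and C where "h \<in> borel_measurable borel"
    "(\<integral>\<^sup>+y. h (L2_set y {..<n}) \<partial>vec_lborel n) = ennreal C" "0 < C" "C \<le> 4 * real n * unit_ball_vol (real n)"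
    "\<And>r. r \<in> {1/2<..2} \<Longrightarrow> ennreal (1 / r ^ n) \<le> h r"
proof -
  \<comment> \<open>As \<rho>^n lies between 2 and 3, 2 n shells starting at radius 1/2 reach at
    least 1/2 * 4 = 2, and each contributes V (\<rho>^n - 1) \<le> 2 V to the integral; hence the
    bound 4 n V.\<close>
  define \<rho> where "\<rho> = 1 + 1 / real n"
  define a where "a m = \<rho> ^ m / 2" for m
  have \<rho>: "\<rho> > 1" using n by (simp add: \<rho>_def)
  have a: "a m > 0" "a m < a (Suc m)" for m using \<rho> by (simp_all add: a_def)
  have \<rho>n: "2 \<le> \<rho> ^ n" "\<rho> ^ n \<le> 3"
  proof -
    have "1 + real n * (1 / real n) \<le> (1 + 1 / real n) ^ n" by (rule Bernoulli_inequality) (rule order_trans[of _ 0], auto)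
    then show "2 \<le> \<rho> ^ n" using n by (simp add: \<rho>_def)
    have "\<rho> ^ n \<le> exp (1 / real n) ^ n"
      unfolding \<rho>_def using n by (intro power_mono exp_ge_add_one_self) auto
    also have "\<dots> = exp 1" using n by (simp flip: exp_of_nat_mult)
    also have "\<dots> \<le> 3" by (rule exp_le)
    finally show "\<rho> ^ n \<le> 3" .
  qed
  define h where "h r = (\<Sum>m<2*n. ennreal (1 / a m ^ n) * indicator {a m<..a (Suc m)} r)" for r
  have hm: "h \<in> borel_measurable borel" unfolding h_def by measurable
  have Lm: "(\<lambda>x. L2_set x {..<n}) \<in> borel_measurable (vec_lborel n)"
    using measurable_L2_set measurable_cong_sets[OF sets_vec_lborel refl] by blast
  have im: "(\<lambda>y. indicator {a m<..a (Suc m)} (L2_set y {..<n}) :: ennreal) \<in> borel_measurable (vec_lborel n)" for m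
    by (rule measurable_compose[OF Lm]) measurable
  define V where "V = unit_ball_vol (real n)"
  have V: "V > 0" by (simp add: V_def)
  have "(\<integral>\<^sup>+y. h (L2_set y {..<n}) \<partial>vec_lborel n) = (\<Sum>m<2*n. ennreal (1 / a m ^ n) * (\<integral>\<^sup>+y. indicator {a m<..a (Suc m)} (L2_set y {..<n}) \<partial>vec_lborel n))"
  proof -
    have "(\<integral>\<^sup>+y. h (L2_set y {..<n}) \<partial>vec_lborel n) = (\<Sum>m<2*n. \<integral>\<^sup>+y. ennreal (1 / a m ^ n) * indicator {a m<..a (Suc m)} (L2_set y {..<n}) \<partial>vec_lborel n)"
      unfolding h_def by (rule nn_integral_sum) (intro borel_measurable_times_ennreal im borel_measurable_const)
    then show ?thesis by (simp only: nn_integral_cmult[OF im])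
  qed
  also have "\<dots> = (\<Sum>m<2*n. ennreal (V * (\<rho> ^ n - 1)))"
  proof (intro sum.cong refl)
    fix m
    have "a (Suc m) = \<rho> * a m" by (simp add: a_def)
    then have "1 / a m ^ n * (V * (a (Suc m) ^ n - a m ^ n)) = V * (\<rho> ^ n - 1)"
      using a(1)[of m] by (simp add: power_mult_distrib field_simps)
    moreover have "0 \<le> V * (a (Suc m) ^ n - a m ^ n)" using V a[of m] by (simp add: power_mono)
    ultimately show "ennreal (1 / a m ^ n) * (\<integral>\<^sup>+y. indicator {a m<..a (Suc m)} (L2_set y {..<n}) \<partial>vec_lborel n) = ennreal (V * (\<rho> ^ n - 1))"
      using a[of m] by (simp add: nn_integral_shell[OF n] V_def[symmetric] less_imp_le flip: ennreal_mult)
  qed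
  also have "\<dots> = ennreal (2 * real n * (V * (\<rho> ^ n - 1)))"
    using V \<rho>n by (simp add: ennreal_of_nat_eq_real_of_nat ennreal_mult)
  finally have I: "(\<integral>\<^sup>+y. h (L2_set y {..<n}) \<partial>vec_lborel n) = ennreal (2 * real n * (V * (\<rho> ^ n - 1)))" .
  have "V * (\<rho> ^ n - 1) \<le> V * 2" using V \<rho>n by (intro mult_left_mono) auto
  then have "2 * real n * (V * (\<rho> ^ n - 1)) \<le> 2 * real n * (V * 2)" by (rule mult_left_mono) simp
  then have le: "2 * real n * (V * (\<rho> ^ n - 1)) \<le> 4 * real n * unit_ball_vol (real n)" by (simp add: V_def)
  have maj: "ennreal (1 / r ^ n) \<le> h r" if r: "r \<in> {1/2<..2}" for r
  proof -
    have "a (2 * n) = \<rho> ^ n * \<rho> ^ n / 2" by (simp add: a_def mult_2 power_add)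
    moreover have "2 * 2 \<le> \<rho> ^ n * \<rho> ^ n" using \<rho>n by (intro mult_mono) auto
    ultimately have "r \<le> a (2 * n)" using r by simp
    then have ex: "\<exists>m. r \<le> a m" by blast
    define m where "m = (LEAST m. r \<le> a m)"
    have m1: "r \<le> a m" unfolding m_def using ex by (rule LeastI_ex)
    have m2: "m \<le> 2 * n" unfolding m_def using \<open>r \<le> a (2 * n)\<close> by (rule Least_le)
    have "m \<noteq> 0" using m1 r by (auto simp: a_def intro!: Nat.gr0I)
    then obtain p where p: "m = Suc p" by (cases m) auto
    have p1: "a p < r" using not_less_Least[of p "\<lambda>m. r \<le> a m"] p by (auto simp: m_def[symmetric] not_le)
    have "1 / r ^ n \<le> 1 / a p ^ n" using p1 a(1)[of p] by (intro divide_left_mono power_mono) auto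
    then have "ennreal (1 / r ^ n) \<le> ennreal (1 / a p ^ n) * indicator {a p<..a (Suc p)} r"
      using p1 m1 p by (simp add: ennreal_leI)
    also have "\<dots> \<le> h r" unfolding h_def
      using m2 p by (intro member_le_sum[where f = "\<lambda>m. ennreal (1 / a m ^ n) * indicator {a m<..a (Suc m)} r"]) auto
    finally show ?thesis .
  qed
  show ?thesis
    by (rule that[OF hm I _ le maj]) (use n V \<rho>n in auto)
qed

lemma emeasure_gauss_mult:
  fixes Q :: "real^'k^'k::finite"
  assumes n: "n \<ge> 1" and Q: "positive_definite Q"
    and p[measurable]: "Measurable.pred (conf_lborel n) p"
  shows "(\<integral>\<^sup>+Y. indicator {Y. p Y} Y * ennreal (gauss_weight n Q Y) \<partial>conf_lborel n)
    = gauss_total n Q * emeasure (gauss n Q) {Y \<in> space (conf_lborel n). p Y}"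
proof -
  let ?S = "{Y \<in> space (conf_lborel n). p Y}"
  have S: "?S \<in> sets (conf_lborel n)" by measurable
  have "emeasure (gauss n Q) ?S = (\<integral>\<^sup>+Y. indicator ?S Y \<partial>gauss n Q)"
    by (rule nn_integral_indicator[symmetric]) (use S in \<open>simp add: gauss_def\<close>)
  also have "\<dots> = (\<integral>\<^sup>+Y. indicator ?S Y * ennreal (gauss_weight n Q Y) \<partial>conf_lborel n) / gauss_total n Q"
    by (rule nn_integral_gauss) (use S in measurable)
  also have "(\<integral>\<^sup>+Y. indicator ?S Y * ennreal (gauss_weight n Q Y) \<partial>conf_lborel n)
      = (\<integral>\<^sup>+Y. indicator {Y. p Y} Y * ennreal (gauss_weight n Q Y) \<partial>conf_lborel n)"
    by (intro nn_integral_cong) (auto simp: indicator_def)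
  finally show ?thesis
    using gauss_total_finite[OF n Q] gauss_total_pos[of n Q] ennreal_mult_divide_cancel[of "gauss_total n Q"] by simp
qed

lemma measurable_gauss_weight_borel [measurable]:
  "gauss_weight n Q \<in> borel_measurable (\<Pi>\<^sub>M i\<in>UNIV. \<Pi>\<^sub>M l\<in>{..<n}. borel)"
  unfolding gauss_weight_def by measurable

text \<open>At least half of the Gaussian mass lies in the bulk, where the weight is bounded by the
  scale-invariant density times the weight at the normalised point. With the shell majorant in place
  of that density, polar coordinates leave an integral over the spheres; each column costs a factor
  4 n times the volume of the unit ball.\<close>

lemma gauss_total_le_spheres:
  fixes A :: "real^'k^'k::finite"
  assumes op: "optimal_pair A t P Q"
    and n: "n \<ge> 1" and d: "\<delta> \<le> 1 / 4" "real n * \<delta>\<^sup>2 \<le> D"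
    and bulk: "emeasure (gauss n Q) {Y \<in> space (conf_lborel n). entry_far P \<delta> (gram n Y)} \<le> ennreal (1 / 2)"
  shows "gauss_total n Q \<le> ennreal (2 * exp (D * (2 * real CARD('k) + 2 * entry_sum Q))
      * (4 * real n * unit_ball_vol (real n)) ^ CARD('k)) * (\<integral>\<^sup>+x. ennreal (gauss_weight n Q x) \<partial>spheres_uniform n)"
proof -
  have Q: "positive_definite Q" and QP: "Q ** P = mat 1" and P: "sdp_feasible P"
    using op by (auto simp: optimal_pair_def intro: optimal_pair_feasible)
  define K where "K = exp (D * (2 * real CARD('k) + 2 * entry_sum Q))"
  define I where "I = (\<integral>\<^sup>+x. ennreal (gauss_weight n Q x) \<partial>spheres_uniform n)"
  interpret prob_space "gauss n Q" by (rule prob_space_gauss[OF n Q])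
  obtain h C where h[measurable]: "h \<in> borel_measurable borel"
    and hC: "(\<integral>\<^sup>+y. h (L2_set y {..<n}) \<partial>vec_lborel n) = ennreal C" "0 < C" "C \<le> 4 * real n * unit_ball_vol (real n)"
    and hr: "\<And>r. r \<in> {1/2<..2} \<Longrightarrow> ennreal (1 / r ^ n) \<le> h r"
    using shell_majorant[OF n] by blast
  let ?far = "{Y \<in> space (conf_lborel n). entry_far P \<delta> (gram n Y)}"
  let ?near = "{Y \<in> space (conf_lborel n). \<not> entry_far P \<delta> (gram n Y)}"
  have far: "?far \<in> events" unfolding gauss_def by simp
  have sp: "space (gauss n Q) = space (conf_lborel n)" by (simp add: gauss_def)
  have "prob ?far \<le> 1 / 2" using bulk unfolding emeasure_eq_measure by (subst (asm) ennreal_le_iff) simp_all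
  moreover have "?near = space (gauss n Q) - ?far" by (auto simp: sp)
  ultimately have "1 / 2 \<le> prob ?near" using prob_compl[OF far] by simp
  then have "ennreal (1 / 2) \<le> emeasure (gauss n Q) ?near" unfolding emeasure_eq_measure by (rule ennreal_leI)
  then have "gauss_total n Q * ennreal (1 / 2) \<le> gauss_total n Q * emeasure (gauss n Q) ?near"
    by (rule mult_left_mono) simp
  also have "\<dots> = (\<integral>\<^sup>+Y. indicator {Y. \<not> entry_far P \<delta> (gram n Y)} Y * ennreal (gauss_weight n Q Y) \<partial>conf_lborel n)"
    by (rule emeasure_gauss_mult[OF n Q, symmetric]) measurable
  also have "\<dots> \<le> (\<integral>\<^sup>+Y. ennreal K * ((\<Prod>i\<in>UNIV. h (L2_set (Y i) {..<n})) * ennreal (gauss_weight n Q (\<lambda>i. normalize_vec n (Y i)))) \<partial>conf_lborel n)"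
  proof (rule nn_integral_mono)
    fix Y :: "'k \<Rightarrow> nat \<Rightarrow> real"
    show "indicator {Y. \<not> entry_far P \<delta> (gram n Y)} Y * ennreal (gauss_weight n Q Y)
      \<le> ennreal K * ((\<Prod>i\<in>UNIV. h (L2_set (Y i) {..<n})) * ennreal (gauss_weight n Q (\<lambda>i. normalize_vec n (Y i))))"
    proof (cases "entry_far P \<delta> (gram n Y)")
      case False
      note b = bulk_comparison[OF P QP n d False]
      have "ennreal (gauss_weight n Q Y) \<le> ennreal (K * ((\<Prod>i\<in>UNIV. 1 / L2_set (Y i) {..<n} ^ n) * gauss_weight n Q (\<lambda>i. normalize_vec n (Y i))))"
        unfolding K_def by (intro ennreal_leI b(2))
      also have "\<dots> = ennreal K * ((\<Prod>i\<in>UNIV. ennreal (1 / L2_set (Y i) {..<n} ^ n)) * ennreal (gauss_weight n Q (\<lambda>i. normalize_vec n (Y i))))"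
        by (simp add: K_def ennreal_mult prod_nonneg L2_set_nonneg prod_ennreal)
      also have "\<dots> \<le> ennreal K * ((\<Prod>i\<in>UNIV. h (L2_set (Y i) {..<n})) * ennreal (gauss_weight n Q (\<lambda>i. normalize_vec n (Y i))))"
        by (intro mult_left_mono mult_right_mono prod_mono_ennreal hr b(1)) auto
      finally show ?thesis using False by simp
    qed simp
  qed
  also have "\<dots> = ennreal K * (\<integral>\<^sup>+Y. (\<Prod>i\<in>UNIV. h (L2_set (Y i) {..<n})) * ennreal (gauss_weight n Q (\<lambda>i. normalize_vec n (Y i))) \<partial>conf_lborel n)"
  proof (rule nn_integral_cmult)
    have nm: "(\<lambda>Y. \<lambda>i\<in>UNIV. normalize_vec n (Y i)) \<in> conf_lborel n \<rightarrow>\<^sub>M (\<Pi>\<^sub>M i\<in>(UNIV::'k set). \<Pi>\<^sub>M l\<in>{..<n}. borel)"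
      by measurable
    have "(\<lambda>Y. gauss_weight n Q (\<lambda>i. normalize_vec n (Y i))) \<in> borel_measurable (conf_lborel n)"
      using measurable_compose[OF nm measurable_gauss_weight_borel[of n Q]] by (simp add: restrict_UNIV)
    moreover have "(\<lambda>Y. \<Prod>i\<in>UNIV. h (L2_set (Y i) {..<n})) \<in> borel_measurable (conf_lborel n :: ('k \<Rightarrow> _) measure)"
      by (intro borel_measurable_prod_ennreal) measurable
    ultimately show "(\<lambda>Y. (\<Prod>i\<in>UNIV. h (L2_set (Y i) {..<n})) * ennreal (gauss_weight n Q (\<lambda>i. normalize_vec n (Y i)))) \<in> borel_measurable (conf_lborel n)"
      by (intro borel_measurable_times_ennreal measurable_compose[OF _ measurable_ennreal])
  qed
  also have "(\<integral>\<^sup>+Y. (\<Prod>i\<in>UNIV. h (L2_set (Y i) {..<n})) * ennreal (gauss_weight n Q (\<lambda>i. normalize_vec n (Y i))) \<partial>conf_lborel n)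
      = ennreal C ^ CARD('k) * I"
    unfolding I_def using hC by (intro nn_integral_radial_spheres n h hC) auto
  also have "\<dots> \<le> ennreal ((4 * real n * unit_ball_vol (real n)) ^ CARD('k)) * I"
    using hC by (intro mult_right_mono) (auto simp: ennreal_power intro!: ennreal_leI power_mono)
  finally have "gauss_total n Q * ennreal (1 / 2) \<le> ennreal K * (ennreal ((4 * real n * unit_ball_vol (real n)) ^ CARD('k)) * I)"
    by (simp add: mult_left_mono)
  then have "ennreal 2 * (gauss_total n Q * ennreal (1 / 2)) \<le> ennreal 2 * (ennreal K * (ennreal ((4 * real n * unit_ball_vol (real n)) ^ CARD('k)) * I))"
    by (rule mult_left_mono) simp
  moreover have "ennreal 2 * (gauss_total n Q * ennreal (1 / 2)) = gauss_total n Q"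
  proof -
    have "ennreal 2 * ennreal (1 / 2) = 1" by (subst ennreal_mult[symmetric]) auto
    moreover have "ennreal 2 * (gauss_total n Q * ennreal (1 / 2)) = gauss_total n Q * (ennreal 2 * ennreal (1 / 2))"
      by (simp only: mult_ac)
    ultimately show ?thesis by (simp only: mult_1_right)
  qed
  moreover have "ennreal 2 * (ennreal K * (ennreal ((4 * real n * unit_ball_vol (real n)) ^ CARD('k)) * I))
     = ennreal (2 * K * (4 * real n * unit_ball_vol (real n)) ^ CARD('k)) * I"
    by (simp add: K_def ennreal_mult mult.assoc)
  ultimately show ?thesis unfolding K_def I_def by simp
qed

text \<open>Each column is thickened to radii in (1 - 1/n, 1], a shell with at least half of the
  volume of the ball because (1 - 1/n)^n \<le> 1/e. This moves Gram entries by at most 2/n \<le>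
  \<epsilon>/2, so far points stay far at half the distance.\<close>

lemma spheres_far_le_gauss:
  fixes Q P :: "real^'k^'k::finite"
  assumes Q: "positive_definite Q" and n: "n \<ge> 2" and e: "4 / real n \<le> \<epsilon>"
  shows "ennreal ((unit_ball_vol (real n) / 2) ^ CARD('k)) * (\<integral>\<^sup>+x. indicator {x. entry_far P \<epsilon> (gram n x)} x * ennreal (gauss_weight n Q x) \<partial>spheres_uniform n)
    \<le> ennreal (exp (entry_sum Q)) * (gauss_total n Q * emeasure (gauss n Q) {Y \<in> space (conf_lborel n). entry_far P (\<epsilon> / 2) (gram n Y)})"
proof -
  define h :: "real \<Rightarrow> ennreal" where "h = indicator {1 - 1 / real n<..1}"
  define c where "c = unit_ball_vol (real n) * (1 ^ n - (1 - 1 / real n) ^ n)"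
  define g where "g x = indicator {x. entry_far P \<epsilon> (gram n x)} x * ennreal (gauss_weight n Q x)" for x :: "'k \<Rightarrow> nat \<Rightarrow> real"
  define q where "q = exp (entry_sum Q)"
  have n1: "n \<ge> 1" "0 < 1 - 1 / real n" using n by (auto simp: field_simps)
  have "(1 - 1 / real n) ^ n \<le> exp (- (1 / real n)) ^ n"
    using n1 exp_ge_add_one_self[of "- (1 / real n)"] by (intro power_mono) auto
  also have "\<dots> = exp (- 1)" using n1 by (simp flip: exp_of_nat_mult)
  also have "\<dots> \<le> 1 / 2" using exp_ge_add_one_self[of 1] by (simp add: exp_minus field_simps)
  finally have pw: "(1 - 1 / real n) ^ n \<le> 1 / 2" .
  have c2: "unit_ball_vol (real n) / 2 \<le> c"
  proof -
    have "unit_ball_vol (real n) * (1 / 2) \<le> c" unfolding c_def using pw by (intro mult_left_mono) auto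
    then show ?thesis by simp
  qed
  have c0: "c > 0" using c2 unit_ball_vol_pos[of "real n"] by (simp del: unit_ball_vol_pos)
  have hm: "h \<in> borel_measurable borel" unfolding h_def by measurable
  have hc: "(\<integral>\<^sup>+y. h (L2_set y {..<n}) \<partial>vec_lborel n) = ennreal c"
    unfolding h_def c_def by (rule nn_integral_shell[OF n1]) simp
  have gram_far: "Measurable.pred (\<Pi>\<^sub>M i\<in>UNIV. \<Pi>\<^sub>M l\<in>{..<n}. borel) (\<lambda>x :: 'k \<Rightarrow> nat \<Rightarrow> real. entry_far P \<epsilon> (gram n x))"
    using measurable_sets[OF measurable_gram sets_entry_far[of P \<epsilon>]]
    by (simp add: pred_def vimage_def Int_def conj_commute)
  have gm: "g \<in> borel_measurable (\<Pi>\<^sub>M i\<in>UNIV. \<Pi>\<^sub>M l\<in>{..<n}. borel)"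
    unfolding g_def using gram_far by measurable
  have "ennreal ((unit_ball_vol (real n) / 2) ^ CARD('k)) * (\<integral>\<^sup>+x. g x \<partial>spheres_uniform n) \<le> ennreal c ^ CARD('k) * (\<integral>\<^sup>+x. g x \<partial>spheres_uniform n)"
    using c2 c0 by (intro mult_right_mono) (auto simp: ennreal_power intro!: ennreal_leI power_mono)
  also have "\<dots> = (\<integral>\<^sup>+Y. (\<Prod>i\<in>UNIV. h (L2_set (Y i) {..<n})) * g (\<lambda>i. normalize_vec n (Y i)) \<partial>conf_lborel n)"
    by (rule nn_integral_radial_spheres[OF n1(1) hm hc _ _ gm, symmetric]) (use c0 in auto)
  also have "\<dots> \<le> (\<integral>\<^sup>+Y. ennreal q * (indicator {Y. entry_far P (\<epsilon> / 2) (gram n Y)} Y * ennreal (gauss_weight n Q Y)) \<partial>conf_lborel n)"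
  proof (rule nn_integral_mono)
    fix Y :: "'k \<Rightarrow> nat \<Rightarrow> real"
    let ?U = "\<lambda>i. normalize_vec n (Y i)"
    show "(\<Prod>i\<in>UNIV. h (L2_set (Y i) {..<n})) * g ?U \<le> ennreal q * (indicator {Y. entry_far P (\<epsilon> / 2) (gram n Y)} Y * ennreal (gauss_weight n Q Y))"
    proof (cases "(\<forall>i. L2_set (Y i) {..<n} \<in> {1 - 1 / real n<..1}) \<and> entry_far P \<epsilon> (gram n ?U)")
      case True
      then have r: "\<And>i. L2_set (Y i) {..<n} \<in> {1 - 1 / real n<..1}" by blast
      obtain i j where "\<epsilon> \<le> \<bar>gram n ?U $ i $ j - P $ i $ j\<bar>" using True by (auto simp: entry_far_def)
      moreover have "\<bar>gram n Y $ i $ j - gram n ?U $ i $ j\<bar> \<le> 2 / real n"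
        using thin_shell_comparison(1)[of n Y i j, OF n r] by simp
      moreover have "2 / real n \<le> \<epsilon> / 2" using e by simp
      ultimately have "\<epsilon> / 2 \<le> \<bar>gram n Y $ i $ j - P $ i $ j\<bar>" by linarith
      then have f: "entry_far P (\<epsilon> / 2) (gram n Y)" by (auto simp: entry_far_def)
      have "ennreal (gauss_weight n Q ?U) \<le> ennreal (q * gauss_weight n Q Y)"
        unfolding q_def by (intro ennreal_leI thin_shell_comparison(2) n r)
      then show ?thesis using r f True by (simp add: h_def g_def q_def ennreal_mult)
    next
      case False
      then have z: "(\<Prod>i\<in>UNIV. h (L2_set (Y i) {..<n})) * g ?U = 0"
      proof (cases "entry_far P \<epsilon> (gram n ?U)")
        case True
        then obtain i where "L2_set (Y i) {..<n} \<notin> {1 - 1 / real n<..1}" using False by blast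
        then have "h (L2_set (Y i) {..<n}) = 0" by (simp add: h_def)
        then have "(\<Prod>i\<in>UNIV. h (L2_set (Y i) {..<n})) = 0" by (intro prod_zero) auto
        then show ?thesis by simp
      qed (simp add: g_def)
      show ?thesis unfolding z by simp
    qed
  qed
  also have "\<dots> = ennreal q * (\<integral>\<^sup>+Y. indicator {Y. entry_far P (\<epsilon> / 2) (gram n Y)} Y * ennreal (gauss_weight n Q Y) \<partial>conf_lborel n)"
    by (rule nn_integral_cmult) measurable
  also have "\<dots> = ennreal q * (gauss_total n Q * emeasure (gauss n Q) {Y \<in> space (conf_lborel n). entry_far P (\<epsilon> / 2) (gram n Y)})"
    by (subst emeasure_gauss_mult[OF n1(1) Q]) auto
  finally show ?thesis by (simp add: g_def q_def)
qed

text \<open>The two comparisons are divided by each other. The volume of the unit ball occurs to the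
  power k in both and cancels, which leaves the factor n^k; the exponent loses a factor 4 through
  the halved distance.\<close>

lemma spheres_far_bound:
  fixes A :: "real^'k^'k::finite"
  assumes op: "optimal_pair A t P Q"
  obtains M c s0 N where "M > 0" "c > 0" "s0 > 0"
    "\<And>n \<epsilon>. n \<ge> N \<Longrightarrow> 4 / real n \<le> \<epsilon> \<Longrightarrow> \<epsilon> \<le> s0 \<Longrightarrow>
      (\<integral>\<^sup>+x. indicator {x. entry_far P \<epsilon> (gram n x)} x * ennreal (gauss_weight n Q x) \<partial>spheres_uniform n)
      \<le> ennreal (M * real n ^ CARD('k) * exp (- c * (real n * \<epsilon>\<^sup>2))) * (\<integral>\<^sup>+x. ennreal (gauss_weight n Q x) \<partial>spheres_uniform n)"
proof -
  have Q: "positive_definite Q" and QP: "Q ** P = mat 1" and symP: "transpose P = P"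
    using op by (auto simp: optimal_pair_def) (simp add: positive_definite_def)
  define k where "k = real CARD('k)"
  have k: "k \<ge> 1" by (simp add: k_def Suc_le_eq)
  obtain c s0 where c: "c > 0" "s0 > 0" and far: "\<And>n s. n \<ge> 1 \<Longrightarrow> 0 < s \<Longrightarrow> s \<le> s0 \<Longrightarrow>
       emeasure (gauss n Q) {Y \<in> space (conf_lborel n). entry_far P s (gram n Y)} \<le> ennreal (2 * k\<^sup>2 * exp (- c * real n * s\<^sup>2))"
    unfolding k_def using gauss_entry_far[OF Q QP symP] by blast
  \<comment> \<open>At distance \<delta> = sqrt (D/n) the bound 2 k^2 exp (- c n \<delta>^2) equals
    1/2, which is the bulk condition.\<close>
  define D where "D = ln (4 * k\<^sup>2) / c"
  have k2: "4 * k\<^sup>2 > 1" using power_mono[OF k, of 2] by simp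
  have D: "D > 0" unfolding D_def using k2 c by (intro divide_pos_pos ln_gt_zero)
  have eD: "2 * k\<^sup>2 * exp (- c * D) = 1 / 2"
    using k2 c k by (simp add: D_def exp_minus exp_ln field_simps)
  define m where "m = min s0 (1 / 4)"
  have m: "0 < m" "m \<le> s0" "m \<le> 1 / 4" using c by (auto simp: m_def)
  define q where "q = (entry_sum Q)"
  define K where "K = 2 * exp (D * (2 * k + 2 * q))"
  have K: "K > 0" by (simp add: K_def)
  define M where "M = exp q * K * 8 ^ CARD('k) * (2 * k\<^sup>2)"
  \<comment> \<open>Beyond \<open>N\<close>, \<delta> \<le> m holds, that is, \<delta> \<le> 1/4 for
    the bulk comparison and \<delta> \<le> s0 for the Gaussian tail bound; the thin shell asks for n
    \<ge> 2.\<close>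
  define N where "N = max 2 (nat \<lceil>D / m\<^sup>2\<rceil>)"
  show ?thesis
  proof (rule that[of M "c / 4" "s0" N])
    show "M > 0" using K k by (simp add: M_def)
    show "c / 4 > 0" "s0 > 0" using c by auto
    fix n :: nat and \<epsilon> :: real assume nN: "n \<ge> N" and e: "4 / real n \<le> \<epsilon>" "\<epsilon> \<le> s0"
    have n: "n \<ge> 2" "n \<ge> 1" using nN by (auto simp: N_def)
    have e0: "\<epsilon> > 0" by (rule less_le_trans[OF _ e(1)]) (use n in simp)
    define I where "I = (\<integral>\<^sup>+x. ennreal (gauss_weight n Q x) \<partial>(spheres_uniform n :: ('k \<Rightarrow> _) measure))"
    define J where "J = (\<integral>\<^sup>+x. indicator {x. entry_far P \<epsilon> (gram n x)} x * ennreal (gauss_weight n Q x) \<partial>spheres_uniform n)"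
    define V where "V = unit_ball_vol (real n)"
    have V: "V > 0" by (simp add: V_def)
    define \<delta> where "\<delta> = sqrt (D / real n)"
    have d2: "real n * \<delta>\<^sup>2 = D" using D n by (simp add: \<delta>_def)
    have d0: "\<delta> > 0" using D n by (simp add: \<delta>_def)
    have "D / m\<^sup>2 \<le> real n"
      using nN by (simp add: N_def)
    then have "D / real n \<le> m\<^sup>2" using m n by (simp add: field_simps)
    then have dm: "\<delta> \<le> m" unfolding \<delta>_def using m by (simp add: real_le_lsqrt)
    have bulk: "emeasure (gauss n Q) {Y \<in> space (conf_lborel n). entry_far P \<delta> (gram n Y)} \<le> ennreal (1 / 2)"
    proof -
      have "2 * k\<^sup>2 * exp (- c * real n * \<delta>\<^sup>2) = 1 / 2" using eD by (simp only: mult.assoc d2)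
      moreover have "\<delta> \<le> s0" using dm m by linarith
      ultimately show ?thesis using far[OF n(2) d0] by (simp only:)
    qed
    have Z: "gauss_total n Q \<le> ennreal (K * (4 * real n * V) ^ CARD('k)) * I"
      unfolding K_def k_def q_def V_def I_def
      by (rule gauss_total_le_spheres[OF op n(2) _ _ bulk]) (use dm m d2 in auto)
    define p where "p = 2 * k\<^sup>2 * exp (- (c / 4) * (real n * \<epsilon>\<^sup>2))"
    have p: "emeasure (gauss n Q) {Y \<in> space (conf_lborel n). entry_far P (\<epsilon> / 2) (gram n Y)} \<le> ennreal p"
      using far[OF n(2), of "\<epsilon> / 2"] e e0 by (simp add: p_def power_divide mult.assoc)
    have "ennreal ((V / 2) ^ CARD('k)) * J \<le> ennreal (exp q) * (gauss_total n Q * emeasure (gauss n Q) {Y \<in> space (conf_lborel n). entry_far P (\<epsilon> / 2) (gram n Y)})"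
      unfolding V_def J_def q_def by (rule spheres_far_le_gauss[OF Q n(1) e(1)])
    also have "\<dots> \<le> ennreal (exp q) * ((ennreal (K * (4 * real n * V) ^ CARD('k)) * I) * ennreal p)"
      by (intro mult_left_mono mult_mono Z p) auto
    also have "\<dots> = ennreal (exp q * (K * (4 * real n * V) ^ CARD('k)) * p) * I"
      using K V by (simp add: p_def ennreal_mult mult_ac)
    also have "exp q * (K * (4 * real n * V) ^ CARD('k)) * p = (V / 2) ^ CARD('k) * (M * real n ^ CARD('k) * exp (- (c / 4) * (real n * \<epsilon>\<^sup>2)))"
    proof -
      have "(4 * real n * V) ^ CARD('k) = (V / 2) ^ CARD('k) * 8 ^ CARD('k) * real n ^ CARD('k)"
        unfolding power_mult_distrib[symmetric] by (rule arg_cong[where f = "\<lambda>z. z ^ CARD('k)"]) simp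
      then show ?thesis unfolding M_def p_def by (simp only: mult_ac)
    qed
    also have "ennreal \<dots> = ennreal ((V / 2) ^ CARD('k)) * ennreal (M * real n ^ CARD('k) * exp (- (c / 4) * (real n * \<epsilon>\<^sup>2)))"
      using V K by (intro ennreal_mult) (auto simp: M_def)
    finally have "ennreal ((V / 2) ^ CARD('k)) * J \<le> ennreal ((V / 2) ^ CARD('k)) * (ennreal (M * real n ^ CARD('k) * exp (- (c / 4) * (real n * \<epsilon>\<^sup>2))) * I)"
      by (simp add: mult.assoc)
    then have "J \<le> ennreal (M * real n ^ CARD('k) * exp (- (c / 4) * (real n * \<epsilon>\<^sup>2))) * I"
      using V by (subst (asm) ennreal_mult_le_mult_iff) (auto simp: ennreal_eq_0_iff not_le)
    then show "(\<integral>\<^sup>+x. indicator {x. entry_far P \<epsilon> (gram n x)} x * ennreal (gauss_weight n Q x) \<partial>spheres_uniform n)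
      \<le> ennreal (M * real n ^ CARD('k) * exp (- (c / 4) * (real n * \<epsilon>\<^sup>2))) * (\<integral>\<^sup>+x. ennreal (gauss_weight n Q x) \<partial>spheres_uniform n)"
      by (simp add: J_def I_def)
  qed
qed

section \<open>From the weights on the spheres to the law of the Gram matrix\<close>

lemma boltzmann_weight_eq_gauss_weight:
  fixes A :: "real^'k^'k::finite"
  assumes op: "optimal_pair A (2 * \<beta>) P Q" and x: "\<And>i. L2_set (x i) {..<n} = 1"
  shows "boltzmann_weight n \<beta> A x = exp (real n / 2 * trace (Q + (2 * \<beta>) *\<^sub>R A)) * gauss_weight n Q x"
proof -
  have bw: "boltzmann_weight n \<beta> A x = exp (\<beta> * real n * (A \<bullet> gram n x))"
    by (simp add: boltzmann_weight_def inner_matrix_eq gram_def mult.commute)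
  have "(Q + (2 * \<beta>) *\<^sub>R A) \<bullet> gram n x = (\<Sum>i\<in>UNIV. \<Sum>j\<in>UNIV. if i = j then (Q + (2 * \<beta>) *\<^sub>R A) $ i $ i else 0)"
    unfolding inner_matrix_eq
  proof (intro sum.cong refl)
    fix i j
    have "(Q + (2 * \<beta>) *\<^sub>R A) $ i $ j = 0" if "i \<noteq> j" using op that by (simp add: optimal_pair_def)
    moreover have "gram n x $ i $ i = 1" by (simp add: gram_diag x)
    ultimately show "(Q + (2 * \<beta>) *\<^sub>R A) $ i $ j * gram n x $ i $ j = (if i = j then (Q + (2 * \<beta>) *\<^sub>R A) $ i $ i else 0)"
      by (cases "i = j") auto
  qed
  then have "trace (Q + (2 * \<beta>) *\<^sub>R A) = Q \<bullet> gram n x + 2 * \<beta> * (A \<bullet> gram n x)"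
    by (simp add: trace_def inner_add_left)
  then have "\<beta> * real n * (A \<bullet> gram n x) = real n / 2 * trace (Q + (2 * \<beta>) *\<^sub>R A) + - (real n / 2) * (Q \<bullet> gram n x)"
    by (simp add: algebra_simps)
  then show ?thesis unfolding bw gauss_weight_def by (simp only: exp_add)
qed

text \<open>The constant factor between Boltzmann and Gaussian weights occurs in the numerator and
  in the partition function and cancels.\<close>

lemma gram_law_far_le:
  fixes A :: "real^'k^'k::finite"
  assumes op: "optimal_pair A (2 * \<beta>) P Q" and n: "n \<ge> 1"
    and le: "(\<integral>\<^sup>+x. indicator {x. entry_far P \<epsilon> (gram n x)} x * ennreal (gauss_weight n Q x) \<partial>spheres_uniform n)
      \<le> M * (\<integral>\<^sup>+x. ennreal (gauss_weight n Q x) \<partial>spheres_uniform n)"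
  shows "emeasure (gram_law n \<beta> A) {S. entry_far P \<epsilon> S} \<le> M"
proof -
  let ?S = "spheres_uniform n :: ('k \<Rightarrow> nat \<Rightarrow> real) measure"
  define Z where "Z = partition_function n \<beta> A"
  have Z: "Z > 0" unfolding Z_def by (rule partition_function_pos[OF n])
  define E where "E = exp (real n / 2 * trace (Q + (2 * \<beta>) *\<^sub>R A))"
  have E: "E > 0" by (simp add: E_def)
  have ae: "AE x in ?S. boltzmann_weight n \<beta> A x = E * gauss_weight n Q x"
    using AE_spheres_uniform[OF n] unfolding E_def
    by eventually_elim (rule boltzmann_weight_eq_gauss_weight[OF op], blast)
  have far[measurable]: "Measurable.pred (\<Pi>\<^sub>M i\<in>UNIV. \<Pi>\<^sub>M l\<in>{..<n}. borel) (\<lambda>x :: 'k \<Rightarrow> nat \<Rightarrow> real. entry_far P \<epsilon> (gram n x))"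
    using measurable_sets[OF measurable_gram sets_entry_far[of P \<epsilon>]]
    by (simp add: pred_def vimage_def Int_def conj_commute)
  have gwm: "gauss_weight n Q \<in> borel_measurable ?S" by measurable
  have "ennreal Z = (\<integral>\<^sup>+x. ennreal (boltzmann_weight n \<beta> A x) \<partial>?S)"
    unfolding Z_def partition_function_def
    by (rule nn_integral_eq_integral[symmetric, OF integrable_boltzmann_weight[OF n]]) (simp add: boltzmann_weight_def)
  also have "\<dots> = (\<integral>\<^sup>+x. ennreal E * ennreal (gauss_weight n Q x) \<partial>?S)"
    using ae by (intro nn_integral_cong_AE) (auto simp: E_def ennreal_mult elim!: eventually_mono)
  also have "\<dots> = ennreal E * (\<integral>\<^sup>+x. ennreal (gauss_weight n Q x) \<partial>?S)"
    using gwm by (intro nn_integral_cmult) measurable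
  finally have ZI: "ennreal Z = ennreal E * (\<integral>\<^sup>+x. ennreal (gauss_weight n Q x) \<partial>?S)" .
  have gm: "gram n \<in> n_vector_model n \<beta> A \<rightarrow>\<^sub>M borel" unfolding n_vector_model_def by measurable
  let ?F = "gram n -` {S. entry_far P \<epsilon> S} \<inter> space ?S"
  have F: "?F \<in> sets ?S" by (rule measurable_sets[OF _ sets_entry_far]) measurable
  have "emeasure (gram_law n \<beta> A) {S. entry_far P \<epsilon> S} = emeasure (n_vector_model n \<beta> A) ?F"
    unfolding gram_law_def by (subst emeasure_distr[OF gm sets_entry_far]) (simp add: n_vector_model_def)
  also have "\<dots> = (\<integral>\<^sup>+x. ennreal (boltzmann_weight n \<beta> A x / Z) * indicator ?F x \<partial>?S)"
    unfolding n_vector_model_def Z_def by (rule emeasure_density[OF _ F]) measurable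
  also have "\<dots> = (\<integral>\<^sup>+x. ennreal (E / Z) * (indicator {x. entry_far P \<epsilon> (gram n x)} x * ennreal (gauss_weight n Q x)) \<partial>?S)"
  proof (intro nn_integral_cong_AE)
    show "AE x in ?S. ennreal (boltzmann_weight n \<beta> A x / Z) * indicator ?F x
       = ennreal (E / Z) * (indicator {x. entry_far P \<epsilon> (gram n x)} x * ennreal (gauss_weight n Q x))"
      using ae AE_space
    proof eventually_elim
      case (elim x)
      then show ?case using E Z by (auto simp: indicator_def ennreal_mult[symmetric])
    qed
  qed
  also have "\<dots> = ennreal (E / Z) * (\<integral>\<^sup>+x. indicator {x. entry_far P \<epsilon> (gram n x)} x * ennreal (gauss_weight n Q x) \<partial>?S)"
    by (rule nn_integral_cmult) measurable
  also have "\<dots> \<le> ennreal (E / Z) * (M * (\<integral>\<^sup>+x. ennreal (gauss_weight n Q x) \<partial>?S))"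
    by (intro mult_left_mono le) simp
  also have "\<dots> = M * (ennreal (1 / Z) * (ennreal E * (\<integral>\<^sup>+x. ennreal (gauss_weight n Q x) \<partial>?S)))"
  proof -
    have "ennreal (E / Z) = ennreal (1 / Z) * ennreal E" using E Z by (simp flip: ennreal_mult)
    then show ?thesis by (simp only: mult_ac)
  qed
  also have "\<dots> = M" unfolding ZI[symmetric] using Z by (simp flip: ennreal_mult)
  finally show ?thesis .
qed

section \<open>Concentration\<close>

lemma powr_at_top:
  fixes b :: real
  assumes "b > 0" shows "filterlim (\<lambda>x. x powr b) at_top at_top"
proof -
  have "filterlim (\<lambda>x. exp (b * ln x)) at_top at_top"
    by (intro filterlim_compose[OF exp_at_top] filterlim_tendsto_pos_mult_at_top[OF tendsto_const assms] ln_at_top)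
  moreover have "eventually (\<lambda>x. x powr b = exp (b * ln x)) at_top"
    using eventually_gt_at_top[of 0] by eventually_elim (simp add: powr_def)
  ultimately show ?thesis by (simp add: filterlim_cong)
qed

lemma power_mult_exp_powr_tendsto_0:
  assumes "c > 0" "b > 0"
  shows "(\<lambda>n. real n ^ k * exp (- c * real n powr b)) \<longlonglongrightarrow> 0"
proof -
  \<comment> \<open>With \<open>real k \<le> b * real m\<close> the factor \<open>real n ^ k\<close>
    is at most the m-th power of n^b, which the exponential in n^b beats.\<close>
  define m where "m = nat \<lceil>real k / b\<rceil>"
  have m: "real k \<le> b * real m"
  proof -
    have "real k / b \<le> real m" unfolding m_def by (rule real_nat_ceiling_ge)
    then show ?thesis using assms by (simp add: field_simps)
  qed
  have lim: "filterlim (\<lambda>n. c * real n powr b) at_top sequentially"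
    by (intro filterlim_tendsto_pos_mult_at_top[OF tendsto_const assms(1)]
        filterlim_compose[OF powr_at_top[OF assms(2)] filterlim_real_sequentially])
  have "(\<lambda>n. (c * real n powr b) ^ m / exp (c * real n powr b)) \<longlonglongrightarrow> 0"
    by (rule filterlim_compose[OF tendsto_power_div_exp_0 lim])
  from tendsto_mult[OF tendsto_const[of "1 / c ^ m"] this]
  have lim0: "(\<lambda>n. 1 / c ^ m * ((c * real n powr b) ^ m / exp (c * real n powr b))) \<longlonglongrightarrow> 0" by simp
  show ?thesis
  proof (rule Lim_null_comparison[OF _ lim0])
    show "\<forall>\<^sub>F n in sequentially. norm (real n ^ k * exp (- c * real n powr b)) \<le> 1 / c ^ m * ((c * real n powr b) ^ m / exp (c * real n powr b))"
      using eventually_ge_at_top[of 1]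
    proof eventually_elim
      case (elim n)
      have "real n ^ k = real n powr real k" using elim by (simp add: powr_realpow)
      also have "\<dots> \<le> real n powr (b * real m)" using elim m by (intro powr_mono) auto
      also have "\<dots> = (real n powr b) ^ m" using elim by (simp add: powr_powr[symmetric] powr_realpow)
      finally have "real n ^ k * exp (- c * real n powr b) \<le> (real n powr b) ^ m * exp (- c * real n powr b)"
        by (rule mult_right_mono) simp
      also have "\<dots> = 1 / c ^ m * ((c * real n powr b) ^ m / exp (c * real n powr b))"
        using assms by (simp add: power_mult_distrib exp_minus field_simps)
      finally show ?case by simp
    qed
  qed
qed

lemma gram_law_concentration:
  fixes A :: "real^'k^'k::finite"
  assumes op: "optimal_pair A (2 * \<beta>) P Q" and b: "b \<in> {0<..<1/2}"
  shows "(\<lambda>n. measure (gram_law n \<beta> A) {S. norm (S - P) < real n powr (-1/2 + b)}) \<longlonglongrightarrow> 1"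
proof -
  define k where "k = real CARD('k)"
  have k: "k \<ge> 1" by (simp add: k_def Suc_le_eq)
  obtain M c s0 N where c: "M > 0" "c > 0" "s0 > 0"
    and bound: "\<And>n \<epsilon>. n \<ge> N \<Longrightarrow> 4 / real n \<le> \<epsilon> \<Longrightarrow> \<epsilon> \<le> s0 \<Longrightarrow>
      (\<integral>\<^sup>+x. indicator {x. entry_far P \<epsilon> (gram n x)} x * ennreal (gauss_weight n Q x) \<partial>spheres_uniform n)
      \<le> ennreal (M * real n ^ CARD('k) * exp (- c * (real n * \<epsilon>\<^sup>2))) * (\<integral>\<^sup>+x. ennreal (gauss_weight n Q x) \<partial>spheres_uniform n)"
    using spheres_far_bound[OF op] by blast
  define r where "r n = real n powr (-1/2 + b)" for n
  \<comment> \<open>A matrix with all entries at most \<open>e n\<close> in absolute value has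
    Frobenius norm at most k^2 \<open>e n\<close>, which is half of \<open>r n\<close>.\<close>
  define e where "e n = r n / (2 * k\<^sup>2)" for n
  \<comment> \<open>The tail bound at distance \<open>e n\<close>, since n times the square of
    \<open>e n\<close> is n^(2 b) / (4 k^4).\<close>
  define B where "B n = M * (real n ^ CARD('k) * exp (- (c / (4 * k ^ 4)) * real n powr (2 * b)))" for n
  have B0: "B \<longlonglongrightarrow> 0"
  proof -
    have "(\<lambda>n. real n ^ CARD('k) * exp (- (c / (4 * k ^ 4)) * real n powr (2 * b))) \<longlonglongrightarrow> 0"
      using c b k by (intro power_mult_exp_powr_tendsto_0) auto
    from tendsto_mult[OF tendsto_const[of M] this] show ?thesis by (simp add: B_def[abs_def])
  qed
  have r0: "r \<longlonglongrightarrow> 0"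
    unfolding r_def using b by (intro tendsto_neg_powr filterlim_real_sequentially) auto
  have "e \<longlonglongrightarrow> 0 / (2 * k\<^sup>2)" unfolding e_def[abs_def] by (intro tendsto_divide r0 tendsto_const) (use k in auto)
  then have ev1: "eventually (\<lambda>n. e n < s0) sequentially" using c by (intro order_tendstoD) auto
  \<comment> \<open>This is \<open>4 / real n \<le> e n\<close> in disguise, because n times
    \<open>r n\<close> is n^(1/2 + b).\<close>
  have ev2: "eventually (\<lambda>n. 8 * k\<^sup>2 \<le> real n powr (1/2 + b)) sequentially"
  proof -
    have "filterlim (\<lambda>n. real n powr (1/2 + b)) at_top sequentially"
      using b by (intro filterlim_compose[OF powr_at_top filterlim_real_sequentially]) auto
    then show ?thesis by (simp add: filterlim_at_top)
  qed
  have ev: "eventually (\<lambda>n. 1 - B n \<le> measure (gram_law n \<beta> A) {S. norm (S - P) < r n} \<and> measure (gram_law n \<beta> A) {S. norm (S - P) < r n} \<le> 1) sequentially"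
    using ev1 ev2 eventually_ge_at_top[of "max 1 N"]
  proof eventually_elim
    case (elim n)
    then have n: "n \<ge> 1" "n \<ge> N" "real n > 0" by auto
    interpret prob_space "gram_law n \<beta> A" by (rule prob_space_gram_law[OF n(1)])
    have rp: "r n > 0" using n by (simp add: r_def)
    have e4: "4 / real n \<le> e n"
    proof -
      have "real n powr (1/2 + b) = real n * r n"
      proof -
        have "real n powr (1/2 + b) = real n powr (1 + (-1/2 + b))" by (rule arg_cong[where f = "\<lambda>z. real n powr z"]) simp
        also have "\<dots> = real n powr 1 * r n" unfolding r_def by (rule powr_add)
        finally show ?thesis using n by simp
      qed
      then show ?thesis using elim(2) n k by (simp add: e_def field_simps)
    qed
    have ne2: "real n * (e n)\<^sup>2 = real n powr (2 * b) / (4 * k ^ 4)"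
    proof -
      have "real n * (r n)\<^sup>2 = real n powr 1 * (real n powr (-1/2 + b) * real n powr (-1/2 + b))"
        using n by (simp add: r_def power2_eq_square)
      also have "\<dots> = real n powr (1 + ((-1/2 + b) + (-1/2 + b)))" by (simp only: powr_add)
      also have "1 + ((-1/2 + b) + (-1/2 + b)) = 2 * b" by simp
      finally show ?thesis by (simp add: e_def power_divide power_mult_distrib flip: power_mult)
    qed
    have Be: "M * real n ^ CARD('k) * exp (- c * (real n * (e n)\<^sup>2)) = B n"
      by (simp add: ne2 B_def mult.assoc)
    have "emeasure (gram_law n \<beta> A) {S. entry_far P (e n) S} \<le> ennreal (B n)"
      using gram_law_far_le[OF op n(1) bound[OF n(2) e4]] elim(1) unfolding Be by simp
    then have far: "prob {S. entry_far P (e n) S} \<le> B n"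
      unfolding emeasure_eq_measure using c by (subst (asm) ennreal_le_iff) (auto simp: B_def)
    have sets: "sets (gram_law n \<beta> A) = sets borel" "space (gram_law n \<beta> A) = UNIV" by (simp_all add: gram_law_def)
    have near: "{S. norm (S - P) < r n} \<in> events"
      unfolding sets by (intro borel_open open_Collect_less continuous_intros)
    have "space (gram_law n \<beta> A) - {S. norm (S - P) < r n} \<subseteq> {S. entry_far P (e n) S}"
    proof
      fix S assume "S \<in> space (gram_law n \<beta> A) - {S. norm (S - P) < r n}"
      then have S: "r n \<le> norm (S - P)" by simp
      show "S \<in> {S. entry_far P (e n) S}"
      proof (rule ccontr)
        assume "S \<notin> {S. entry_far P (e n) S}"
        then have "\<bar>(S - P) $ i $ j\<bar> \<le> e n" for i j by (auto simp: entry_far_def not_le less_imp_le)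
        then have "norm (S - P) \<le> k * k * e n" unfolding k_def by (rule norm_matrix_le_entries)
        also have "\<dots> = r n / 2" using k by (simp add: e_def power2_eq_square)
        finally show False using S rp by simp
      qed
    qed
    then have "prob (space (gram_law n \<beta> A) - {S. norm (S - P) < r n}) \<le> prob {S. entry_far P (e n) S}"
      by (rule finite_measure_mono) (simp add: sets sets_entry_far)
    then have "1 - B n \<le> prob {S. norm (S - P) < r n}" using far prob_compl[OF near] by simp
    then show ?case by simp
  qed
  have "(\<lambda>n. 1 - B n) \<longlonglongrightarrow> 1 - 0" by (intro tendsto_diff tendsto_const B0)
  then have lo: "(\<lambda>n. 1 - B n) \<longlonglongrightarrow> 1" by simp
  have "(\<lambda>n. measure (gram_law n \<beta> A) {S. norm (S - P) < r n}) \<longlonglongrightarrow> 1"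
    by (rule real_tendsto_sandwich[OF _ _ lo tendsto_const]) (use ev in \<open>auto elim: eventually_mono\<close>)
  then show ?thesis by (simp add: r_def)
qed

lemma weakly_converges_return_if_concentrates:
  fixes \<mu> :: "nat \<Rightarrow> 'a::{real_normed_vector, second_countable_topology} measure"
  assumes ps: "\<And>n. n \<ge> 1 \<Longrightarrow> prob_space (\<mu> n)" and s: "\<And>n. sets (\<mu> n) = sets borel"
    and r: "r \<longlonglongrightarrow> 0" and conc: "(\<lambda>n. measure (\<mu> n) {x. norm (x - a) < r n}) \<longlonglongrightarrow> 1"
  shows "weakly_converges \<mu> (return borel a)"
  unfolding weakly_converges_def
proof (intro allI impI)
  fix f :: "'a \<Rightarrow> real" assume cf: "continuous_on UNIV f" and bf: "bounded (range f)"
  have fm: "f \<in> borel_measurable borel" by (rule borel_measurable_continuous_onI[OF cf])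
  obtain K where K: "\<And>x. \<bar>f x\<bar> \<le> K" using bf by (auto simp: bounded_iff)
  have K0: "K \<ge> 0" using K[of a] by linarith
  have "(\<lambda>n. \<integral>x. f x \<partial>\<mu> n) \<longlonglongrightarrow> f a"
  proof (rule LIMSEQ_I)
    fix e :: real assume e: "e > 0"
    have "isCont f a" using cf by (simp add: continuous_on_eq_continuous_at)
    then obtain d where d: "d > 0" "\<And>x. norm (x - a) < d \<Longrightarrow> \<bar>f x - f a\<bar> < e / 2"
      using e unfolding isCont_def LIM_eq by (metis diff_self half_gt_zero norm_zero abs_zero real_norm_def)
    \<comment> \<open>The region away from \<open>a\<close> then contributes less than 2 (K + 1)
      \<eta> = e/2; the summand 1 covers K = 0.\<close>
    define \<eta> where "\<eta> = e / (4 * (K + 1))"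
    have \<eta>: "\<eta> > 0" using e K0 by (simp add: \<eta>_def)
    have "eventually (\<lambda>n. r n < d) sequentially" using r d(1) by (intro order_tendstoD) auto
    moreover have "eventually (\<lambda>n. 1 - \<eta> < measure (\<mu> n) {x. norm (x - a) < r n}) sequentially"
      using conc \<eta> by (intro order_tendstoD) auto
    ultimately have "eventually (\<lambda>n. norm ((\<integral>x. f x \<partial>\<mu> n) - f a) < e) sequentially"
      using eventually_ge_at_top[of 1]
    proof eventually_elim
      case (elim n)
      interpret prob_space "\<mu> n" by (rule ps[OF elim(3)])
      have fM: "f \<in> borel_measurable (\<mu> n)" using fm s[of n] measurable_cong_sets by blast
      have sp: "space (\<mu> n) = UNIV" using sets_eq_imp_space_eq[OF s[of n]] by simp
      let ?F = "{x. d \<le> norm (x - a)}"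
      have F: "?F \<in> events" unfolding s by (intro borel_closed closed_Collect_le continuous_intros)
      have N: "{x. norm (x - a) < r n} \<in> events" unfolding s by (intro borel_open open_Collect_less continuous_intros)
      have int: "integrable (\<mu> n) f" by (rule integrable_const_bound[where B = K]) (use K fM in auto)
      have "?F \<subseteq> space (\<mu> n) - {x. norm (x - a) < r n}" using elim(1) by (auto simp: sp)
      then have "prob ?F \<le> prob (space (\<mu> n) - {x. norm (x - a) < r n})"
        using N by (intro finite_measure_mono) auto
      then have pF: "prob ?F < \<eta>" using elim(2) prob_compl[OF N] by simp
      have "(\<integral>x. f x \<partial>\<mu> n) - f a = (\<integral>x. f x - f a \<partial>\<mu> n)" using int by (simp add: prob_space)
      also have "norm \<dots> \<le> (\<integral>x. norm (f x - f a) \<partial>\<mu> n)" by (rule integral_norm_bound)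
      also have "\<dots> \<le> (\<integral>x. e / 2 + 2 * K * indicator ?F x \<partial>\<mu> n)"
      proof (rule integral_mono)
        show "integrable (\<mu> n) (\<lambda>x. norm (f x - f a))" using int by (intro integrable_norm Bochner_Integration.integrable_diff) auto
        show "integrable (\<mu> n) (\<lambda>x. e / 2 + 2 * K * indicator ?F x)"
          using F by (intro Bochner_Integration.integrable_add integrable_mult_right) (auto simp: emeasure_eq_measure)
        fix x
        have "\<bar>f x - f a\<bar> \<le> 2 * K" using K[of x] K[of a] by linarith
        then show "norm (f x - f a) \<le> e / 2 + 2 * K * indicator ?F x"
          using d(2)[of x] e by (auto simp: indicator_def not_le)
      qed
      also have "\<dots> = e / 2 + 2 * K * prob ?F"
        using F by (subst Bochner_Integration.integral_add) (auto simp: prob_space emeasure_eq_measure)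
      also have "\<dots> \<le> e / 2 + 2 * (K + 1) * prob ?F" by (simp add: mult_right_mono)
      also have "\<dots> < e / 2 + 2 * (K + 1) * \<eta>" using pF K0 by simp
      also have "\<dots> = e" using K0 by (simp add: \<eta>_def field_simps)
      finally show ?case .
    qed
    then show "\<exists>no. \<forall>n\<ge>no. norm ((\<integral>x. f x \<partial>\<mu> n) - f a) < e" by (simp add: eventually_sequentially)
  qed
  then show "(\<lambda>n. \<integral>x. f x \<partial>\<mu> n) \<longlonglongrightarrow> (\<integral>x. f x \<partial>return borel a)"
    using fm by (simp add: integral_return)
qed

theorem theorem3:
  fixes A :: "real^'k::finite^'k"
  assumes "transpose A = A"
  shows "\<exists>Sstar :: real \<Rightarrow> real^'k^'k.
    (\<forall>\<beta>>0.
       positive_definite (Sstar \<beta>) \<and>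
       (\<forall>S. is_arg_max (free_energy \<beta> A) sdp_feasible S \<longleftrightarrow> S = Sstar \<beta>) \<and>
       weakly_converges (\<lambda>n. gram_law n \<beta> A) (return borel (Sstar \<beta>)) \<and>
       (\<forall>b\<in>{0<..<1/2}.
          (\<lambda>n. measure (gram_law n \<beta> A) {S. norm (S - Sstar \<beta>) < real n powr (-1/2 + b)})
            \<longlonglongrightarrow> 1)) \<and>
    ((\<lambda>\<beta>. trace (A ** Sstar \<beta>)) \<longlongrightarrow> (SUP S\<in>Collect sdp_feasible. trace (A ** S))) at_top \<and>
    (\<exists>Smax. is_arg_max (\<lambda>S. trace (A ** S)) sdp_feasible Smax \<and>
       (Sstar \<longlongrightarrow> Smax) at_top)"
proof -
  have tr: "trace (A ** S) = A \<bullet> S" for S :: "real^'k^'k" by (simp add: trace_mult_eq_inner assms)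
  have "\<forall>t. \<exists>SQ. optimal_pair A t (fst SQ) (snd SQ)"
  proof
    fix t
    obtain S Q where "optimal_pair A t S Q" using optimal_pair_exists[OF assms] .
    then show "\<exists>SQ. optimal_pair A t (fst SQ) (snd SQ)" by (intro exI[of _ "(S, Q)"]) simp
  qed
  from choice[OF this] obtain SQ where SQ: "\<And>t. optimal_pair A t (fst (SQ t)) (snd (SQ t))" by blast
  define S where "S t = fst (SQ t)" for t
  define Q where "Q t = snd (SQ t)" for t
  have op: "optimal_pair A t (S t) (Q t)" for t unfolding S_def Q_def by (rule SQ)
  \<comment> \<open>The factor 1/2 of the log-determinant: the objective is half of t tr (A S) + ln
    det S for t = 2 \<beta>.\<close>
  define Sstar where "Sstar \<beta> = S (2 * \<beta>)" for \<beta>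
  have opb: "optimal_pair A (2 * \<beta>) (Sstar \<beta>) (Q (2 * \<beta>))" for \<beta> unfolding Sstar_def by (rule op)
  note conc = gram_law_concentration[OF opb]
  \<comment> \<open>Any b in (0, 1/2) makes the radius tend to 0; b = 1/4 is taken.\<close>
  have weak: "weakly_converges (\<lambda>n. gram_law n \<beta> A) (return borel (Sstar \<beta>))" for \<beta>
  proof (rule weakly_converges_return_if_concentrates[OF prob_space_gram_law])
    show "(\<lambda>n. measure (gram_law n \<beta> A) {x. norm (x - Sstar \<beta>) < real n powr (-1/2 + 1/4)}) \<longlonglongrightarrow> 1"
      by (rule conc) simp
    show "(\<lambda>n. real n powr (-1/2 + 1/4)) \<longlonglongrightarrow> 0"
      by (intro tendsto_neg_powr filterlim_real_sequentially) simp
  qed (simp_all add: gram_law_def)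
  obtain Smax where "(S \<longlongrightarrow> Smax) at_top" using optimal_path_converges[OF op] .
  then have lim: "(Sstar \<longlongrightarrow> Smax) at_top"
    unfolding Sstar_def[abs_def]
    by (rule filterlim_compose) (intro filterlim_tendsto_pos_mult_at_top[OF tendsto_const _ filterlim_ident], simp)
  have feas: "sdp_feasible (Sstar \<beta>)" for \<beta> by (rule optimal_pair_feasible[OF opb])
  have "Smax \<in> Collect sdp_feasible"
    by (rule Lim_in_closed_set[OF compact_imp_closed[OF compact_sdp_feasible] _ _ lim]) (use feas in auto)
  then have fmax: "sdp_feasible Smax" by simp
  have limA: "((\<lambda>\<beta>. A \<bullet> Sstar \<beta>) \<longlongrightarrow> A \<bullet> Smax) at_top" by (intro tendsto_intros lim)
  \<comment> \<open>The duality gap at t = 2 \<beta> is k/(2 \<beta>), which vanishes in the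
    limit.\<close>
  have max: "A \<bullet> S' \<le> A \<bullet> Smax" if S': "sdp_feasible S'" for S'
  proof (rule tendsto_lowerbound)
    have "((\<lambda>\<beta>. A \<bullet> Sstar \<beta> + real CARD('k) / 2 * inverse \<beta>) \<longlongrightarrow> A \<bullet> Smax + real CARD('k) / 2 * 0) at_top"
      by (intro tendsto_intros limA tendsto_inverse_0_at_top filterlim_ident)
    then show "((\<lambda>\<beta>. A \<bullet> Sstar \<beta> + real CARD('k) / 2 * inverse \<beta>) \<longlongrightarrow> A \<bullet> Smax) at_top" by simp
    show "\<forall>\<^sub>F \<beta> in at_top. A \<bullet> S' \<le> A \<bullet> Sstar \<beta> + real CARD('k) / 2 * inverse \<beta>"
      using eventually_gt_at_top[of 0]
    proof eventually_elim
      case (elim \<beta>)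
      then show ?case using optimal_pair_trace_gap[OF opb[of \<beta>] S'] by (simp add: field_simps)
    qed
  qed simp
  have sup: "(SUP S\<in>Collect sdp_feasible. trace (A ** S)) = A \<bullet> Smax"
    unfolding tr using fmax max by (intro cSup_eq_maximum) auto
  show ?thesis
  proof (intro exI[of _ Sstar] conjI allI impI ballI)
    show "positive_definite (Sstar \<beta>)" for \<beta> using opb[of \<beta>] by (simp add: optimal_pair_def)
    show "is_arg_max (free_energy \<beta> A) sdp_feasible S \<longleftrightarrow> S = Sstar \<beta>" for \<beta> S
      by (rule optimal_pair_is_arg_max_iff[OF assms opb])
    show "((\<lambda>\<beta>. trace (A ** Sstar \<beta>)) \<longlongrightarrow> (SUP S\<in>Collect sdp_feasible. trace (A ** S))) at_top"
      unfolding sup unfolding tr by (rule limA)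
    have "is_arg_max (\<lambda>S. trace (A ** S)) sdp_feasible Smax"
      unfolding is_arg_max_def tr using fmax max by (auto simp: not_less)
    then show "\<exists>Smax. is_arg_max (\<lambda>S. trace (A ** S)) sdp_feasible Smax \<and> (Sstar \<longlongrightarrow> Smax) at_top"
      using lim by blast
  qed (rule weak, rule conc)
qed

end
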